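(* Let $f:M^n\to\mathbb{R}^{n+1}$ be a hypersurface of rank $3<n$ such that $M^n$ has generic nullity, with the eigenvalues of the splitting tensors real. Let $g=g^{\varphi}$ and $\tilde g=\tilde g^{\tilde\varphi}$ be two distinct elements of $\mathcal{H}^2_{M^n,x_0}$, with ambient space the Lorentz space $\mathbb{R}^{n+2}_1$, such that $\varphi_0=\tilde\varphi_0$. Let $\Lambda$, $N^{n+1}\subseteq\Lambda$ and the immersions $G,\tilde G:N^{n+1}\to\mathbb{R}^{n+2}_1$ be as defined in the context. Then $G$ and $\tilde G$ are isometric in the sense that $$T:=G^*h=\tilde G^*h,$$ where $h$ is the canonical inner product of $\mathbb{R}^{n+2}_1$. Moreover, $T$ is a Riemannian (respectively, Lorentzian) inner product at the points of $N^{n+1}\subseteq\Lambda$ lying over points of $M^n$ where $1+\varphi_0^{-1}$ is positive (respectively, negative). However, $T$ is degenerate at the points of $N^{n+1}\subseteq\Lambda$ lying over points of $M^n$ where $\varphi_0=-1$.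
   Context: **Honest immersions.** $\mathbb{R}^N_\nu$ is $\mathbb{R}^N$ with a non-degenerate inner product of index $\nu$. The nullity of a Riemannian manifold $M^n$ is $\Gamma(x)=\{X\in T_xM:R(X,Y)Z=0\ \forall Y,Z\}$; the relative nullity of an isometric immersion $f$ is the nullity $\Delta_f$ of its second fundamental form $\alpha^f$; the rank of $f$ is $n-\dim\Delta_f$. $\mathcal{R}^p_{M^n,x_0}$ is the set of isometric immersions $g:U\to\mathbb{R}^{n+p}_\nu$ ($x_0\in U\subseteq M^n$ open, any index $\nu$) modulo equality of germs at $x_0$ and rigid motions of the ambient space. For a hypersurface of rank $3$, $\Delta_f=\Gamma$ and $\mathcal{R}^1_{M^n,x_0}=\{f\}$. $\mathcal{C}\subseteq\mathcal{R}^2_{M^n,x_0}$ is the set of germs $k\circ f$, with $k$ an isometric immersion of a neighborhood of $f(x_0)$ in $\mathbb{R}^{n+1}$ into a semi-Euclidean space of dimension $n+2$. $\mathcal{H}^2_{M^n,x_0}:=\mathcal{R}^2_{M^n,x_0}\setminus\mathcal{C}$. Any $g\in\mathcal{H}^2_{M^n,x_0}$ has $\Delta_g=\Gamma$. We replace $M^n$ by a neighborhood of $x_0$ where $g,\tilde g$ are defined. **Generic nullity.** For $T\in\Gamma$ the splitting tensor $C_T:\Gamma^\perp\to\Gamma^\perp$ is $C_T(X)=-(\nabla_XT)_{\Gamma^\perp}$ (orthogonal projection). $M^n$ has generic nullity if for some $T\in\Gamma$ the characteristic polynomial of $C_T$ has only simple roots over $\mathbb{C}$; these roots are assumed real. **Conjugate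 chart.** Let $\pi:M^n\to L^3=M^n/\Gamma$ be the (local) quotient by the leaves of $\Gamma$. The Gauss map of $f$ descends to an immersion of $L^3$ into $\mathbb{S}^n$, and $L^3$ carries the induced metric. It is known that, if $\mathcal{H}^2_{M^n,x_0}\neq\emptyset$, the eigenvectors of the splitting tensor give vector fields $X_0,X_1,X_2\in\Gamma^\perp$ diagonalizing all the $C_T$, which after rescaling satisfy $\pi_*X_i=\partial_i\circ\pi$, $\partial_i=\partial_{u_i}$, for a chart $(u_0,u_1,u_2)$ of $L^3$, and $\alpha^f(X_i,X_j)=0=\alpha^g(X_i,X_j)$ for $i\neq j$ and all $g\in\mathcal{H}^2_{M^n,x_0}$. $\Gamma_{ij}^k$ are the Christoffel symbols of $L^3$ in this chart (composed with $\pi$ when used on $M^n$); $\Gamma_{ij}^k=0$ for distinct $i,j,k$. **The functions $\varphi_i$.** Let $A$ be the shape operator of $f$ with respect to its Gauss map; $\langle AX_i,X_i\rangle\ne0$. For $g\in\mathcal{H}^2_{M^n,x_0}$ set $\eta_i=\alpha^g(X_i,X_i)/\langle AX_i,X_i\rangle\in T^\perp_gM$. Then $\langle\eta_i,\eta_j\rangle=1+\delta_{ij}/\varphi_i$ for nowhere zero functions $\varphi_i$, which descend to $L^3$. They satisfy $\sum_i\varphi_i=-1$, $\sum_i\varphi_i\eta_i=0$, $\partial_i\varphi_j=2\Gamma_{ij}^j\varphi_j$ $(i\neq j)$ and $\partial_i\varphi_i=-\sum_{j\neq i}2\Gamma_{ij}^j\varphi_j$. The normal connection of $g$ satisfies $\nabla^\perp_T\eta_i=0$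 for $T\in\Gamma$, $\nabla^\perp_{X_j}\eta_i=\Gamma_{ji}^i(\eta_j-\eta_i)$ for $i\neq j$, and $\nabla^\perp_{X_i}\eta_i=\tfrac12\partial_i(\varphi_i^{-1})\varphi_i\eta_i-\varphi_i^{-1}\sum_{j\neq i}\Gamma_{ij}^j\varphi_j\eta_j$. The triple $\varphi=(\varphi_i)$ determines $g$, and one writes $g=g^\varphi$. The objects $\tilde\eta_i,\tilde\varphi_i$ are defined analogously for $\tilde g$. **The maps $G$ and $\tilde G$.** Let $L=\operatorname{span}\{\eta_0\}\subseteq T^\perp_gM$ and $$\lambda=\eta_0+Y\in TM\oplus L,\qquad Y=-\frac{\Gamma_{10}^0}{\langle AX_1,X_1\rangle}X_1-\frac{\Gamma_{20}^0}{\langle AX_2,X_2\rangle}X_2 .$$ Let $\Lambda=\operatorname{span}\{\lambda\}\subseteq TM\oplus L$, a line bundle over $M^n$. Let $\tilde\lambda=\tilde\eta_0+Y\in TM\oplus\operatorname{span}\{\tilde\eta_0\}$. Identifying tangent vectors of $M^n$ with their images under $g_*$ (resp. $\tilde g_*$), define $$G(t\lambda_p)=g(p)+t\lambda_p,\qquad \tilde G(t\lambda_p)=\tilde g(p)+t\tilde\lambda_p,$$ on a sufficiently small neighborhood $N^{n+1}$ of the zero section of $\Lambda$, chosen so that $G$ and $\tilde G$ are immersions. A point $t\lambda_p$ lies over $p$. **Convention.** All is local: one works on a connected component of an open dense subset of $M^n$ on which the dimensions of all subspaces considered are constant. *)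

theory Defs
  imports "HOL-Analysis.Analysis" "HOL-Computational_Algebra.Computational_Algebra"
begin

section \<open>Smooth maps on open subsets of Euclidean spaces\<close>

text \<open>
  Everything in this development is local, so a manifold is an open subset \<open>M\<close> of a Euclidean
  space \<open>'a\<close> (the image of a coordinate chart), every tangent space is \<open>'a\<close>, and a vector field is
  a function from \<open>'a\<close> to \<open>'a\<close>.  All notions below are meant on open sets only.
\<close>

abbreviation D :: "('a::real_normed_vector \<Rightarrow> 'b::real_normed_vector) \<Rightarrow> 'a \<Rightarrow> 'a \<Rightarrow> 'b" where
  "D f p \<equiv> frechet_derivative f (at p)"

fun Ck_on :: "nat \<Rightarrow> ('a::euclidean_space \<Rightarrow> 'b::euclidean_space) \<Rightarrow> 'a set \<Rightarrow> bool" where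
  "Ck_on 0 f S \<longleftrightarrow> continuous_on S f"
| "Ck_on (Suc k) f S \<longleftrightarrow>
     (\<forall>p\<in>S. f differentiable (at p)) \<and> (\<forall>v. Ck_on k (\<lambda>p. D f p v) S)"

definition smooth_on :: "('a::euclidean_space \<Rightarrow> 'b::euclidean_space) \<Rightarrow> 'a set \<Rightarrow> bool" where
  "smooth_on f S \<longleftrightarrow> (\<forall>k. Ck_on k f S)"

definition immersion_on :: "'a set \<Rightarrow> ('a::euclidean_space \<Rightarrow> 'b::euclidean_space) \<Rightarrow> bool" where
  "immersion_on S f \<longleftrightarrow> smooth_on f S \<and> (\<forall>p\<in>S. inj (D f p))"

section \<open>Symmetric bilinear forms\<close>

type_synonym 'a form = "'a \<Rightarrow> 'a \<Rightarrow> real"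

definition symmetric_form :: "'a::euclidean_space form \<Rightarrow> bool" where
  "symmetric_form B \<longleftrightarrow> bilinear B \<and> (\<forall>v w. B v w = B w v)"

definition degenerate :: "'a::euclidean_space form \<Rightarrow> bool" where
  "degenerate B \<longleftrightarrow> (\<exists>v. v \<noteq> 0 \<and> (\<forall>w. B v w = 0))"

definition form_index :: "'a::euclidean_space form \<Rightarrow> nat" where
  "form_index B = Max {dim S |S. subspace S \<and> (\<forall>v\<in>S. v \<noteq> 0 \<longrightarrow> B v v < 0)}"

definition riemannian_product :: "'a::euclidean_space form \<Rightarrow> bool" where
  "riemannian_product B \<longleftrightarrow> symmetric_form B \<and> (\<forall>v. v \<noteq> 0 \<longrightarrow> B v v > 0)"

definition lorentzian_product :: "'a::euclidean_space form \<Rightarrow> bool" where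
  "lorentzian_product B \<longleftrightarrow> symmetric_form B \<and> \<not> degenerate B \<and> form_index B = 1"

text \<open>The canonical inner product of the Lorentz space, one dimension up from \<open>'b\<close>.\<close>

definition lorentz :: "('b::euclidean_space \<times> real) form" where
  "lorentz v w = fst v \<bullet> fst w - snd v * snd w"

section \<open>Riemannian geometry in a chart\<close>

text \<open>A field of forms \<open>m\<close>: the inner product of the tangent vectors \<open>v\<close>, \<open>w\<close> at \<open>p\<close> is \<open>m p v w\<close>.\<close>

definition riemannian_metric :: "'a set \<Rightarrow> ('a::euclidean_space \<Rightarrow> 'a form) \<Rightarrow> bool" where
  "riemannian_metric M m \<longleftrightarrow>
     (\<forall>p\<in>M. riemannian_product (m p)) \<and> (\<forall>v w. smooth_on (\<lambda>p. m p v w) M)"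

text \<open>
  The Levi-Civita derivative of the constant field \<open>Y\<close> in direction \<open>X\<close>, by Koszul's formula on
  constant (hence commuting) fields.
\<close>

definition christoffel :: "('a::euclidean_space \<Rightarrow> 'a form) \<Rightarrow> 'a \<Rightarrow> 'a \<Rightarrow> 'a \<Rightarrow> 'a" where
  "christoffel m p X Y = (THE W. \<forall>Z. 2 * m p W Z =
      D (\<lambda>q. m q Y Z) p X + D (\<lambda>q. m q X Z) p Y - D (\<lambda>q. m q X Y) p Z)"

definition nabla ::
  "('a::euclidean_space \<Rightarrow> 'a form) \<Rightarrow> 'a \<Rightarrow> ('a \<Rightarrow> 'a) \<Rightarrow> 'a \<Rightarrow> 'a" where
  "nabla m X Y p = D Y p X + christoffel m p X (Y p)"

text \<open>The vectors \<open>X\<close>, \<open>Y\<close>, \<open>Z\<close> are extended as constant fields, so there is no bracket term.\<close>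

definition curvature ::
  "('a::euclidean_space \<Rightarrow> 'a form) \<Rightarrow> 'a \<Rightarrow> 'a \<Rightarrow> 'a \<Rightarrow> 'a \<Rightarrow> 'a" where
  "curvature m p X Y Z =
     nabla m X (nabla m Y (\<lambda>_. Z)) p - nabla m Y (nabla m X (\<lambda>_. Z)) p"

definition nullity :: "('a::euclidean_space \<Rightarrow> 'a form) \<Rightarrow> 'a \<Rightarrow> 'a set" where
  "nullity m p = {X. \<forall>Y Z. curvature m p X Y Z = 0}"

definition conullity :: "('a::euclidean_space \<Rightarrow> 'a form) \<Rightarrow> 'a \<Rightarrow> 'a set" where
  "conullity m p = {X. \<forall>Z\<in>nullity m p. m p X Z = 0}"

definition conullity_part :: "('a::euclidean_space \<Rightarrow> 'a form) \<Rightarrow> 'a \<Rightarrow> 'a \<Rightarrow> 'a" where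
  "conullity_part m p V = (THE W. W \<in> conullity m p \<and> V - W \<in> nullity m p)"

text \<open>
  The splitting tensor is tensorial in \<open>T\<close>; here \<open>T\<close> is any smooth section of the nullity
  on a neighbourhood of the point.
\<close>

definition nullity_section ::
  "('a::euclidean_space \<Rightarrow> 'a form) \<Rightarrow> 'a set \<Rightarrow> ('a \<Rightarrow> 'a) \<Rightarrow> bool" where
  "nullity_section m U T \<longleftrightarrow> smooth_on T U \<and> (\<forall>p\<in>U. T p \<in> nullity m p)"

definition splitting ::
  "('a::euclidean_space \<Rightarrow> 'a form) \<Rightarrow> ('a \<Rightarrow> 'a) \<Rightarrow> 'a \<Rightarrow> 'a \<Rightarrow> 'a" where
  "splitting m T p X = - conullity_part m p (nabla m X T p)"

section \<open>Generic nullity\<close>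

text \<open>
  The complex characteristic polynomial of an operator \<open>\<phi>\<close> on a three-dimensional subspace \<open>S\<close>,
  computed from its matrix in an arbitrary basis of \<open>S\<close>.
\<close>

definition basis_of :: "(3 \<Rightarrow> 'a::euclidean_space) \<Rightarrow> 'a set \<Rightarrow> bool" where
  "basis_of b S \<longleftrightarrow> inj b \<and> independent (range b) \<and> span (range b) = S"

definition char_poly_of :: "real^3^3 \<Rightarrow> complex poly" where
  "char_poly_of C = det (\<chi> i j. (if i = j then [:0, 1:] else 0) - [:of_real (C $ i $ j):])"

definition is_char_poly ::
  "'a set \<Rightarrow> ('a::euclidean_space \<Rightarrow> 'a) \<Rightarrow> complex poly \<Rightarrow> bool" where
  "is_char_poly S \<phi> c \<longleftrightarrow>
     (\<exists>b C. basis_of b S \<and> (\<forall>j. \<phi> (b j) = (\<Sum>i\<in>UNIV. C $ i $ j *\<^sub>R b i)) \<and> c = char_poly_of C)"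

definition generic_nullity :: "'a set \<Rightarrow> ('a::euclidean_space \<Rightarrow> 'a form) \<Rightarrow> bool" where
  "generic_nullity M m \<longleftrightarrow>
     (\<forall>p\<in>M. \<exists>U T c. open U \<and> p \<in> U \<and> U \<subseteq> M \<and> nullity_section m U T \<and>
        is_char_poly (conullity m p) (splitting m T p) c \<and> rsquarefree c)"

definition real_splitting_eigenvalues :: "'a set \<Rightarrow> ('a::euclidean_space \<Rightarrow> 'a form) \<Rightarrow> bool" where
  "real_splitting_eigenvalues M m \<longleftrightarrow>
     (\<forall>p\<in>M. \<forall>U T c z. open U \<and> p \<in> U \<and> U \<subseteq> M \<and> nullity_section m U T \<and>
        is_char_poly (conullity m p) (splitting m T p) c \<and> poly c z = 0 \<longrightarrow> z \<in> \<real>)"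

section \<open>Isometric immersions into flat spaces\<close>

definition pullback ::
  "'v form \<Rightarrow> ('a::real_normed_vector \<Rightarrow> 'v::real_normed_vector) \<Rightarrow> 'a \<Rightarrow> 'a form" where
  "pullback h f p v w = h (D f p v) (D f p w)"

definition isometric_immersion ::
  "'a set \<Rightarrow> ('a::euclidean_space \<Rightarrow> 'a form) \<Rightarrow> 'v form \<Rightarrow> ('a \<Rightarrow> 'v::euclidean_space) \<Rightarrow> bool" where
  "isometric_immersion M m h f \<longleftrightarrow>
     immersion_on M f \<and> (\<forall>p\<in>M. \<forall>v w. pullback h f p v w = m p v w)"

definition normal_part ::
  "'v form \<Rightarrow> ('a::euclidean_space \<Rightarrow> 'v::euclidean_space) \<Rightarrow> 'a \<Rightarrow> 'v \<Rightarrow> 'v" where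
  "normal_part h f p v = (THE w. (\<forall>Z. h w (D f p Z) = 0) \<and> v - w \<in> range (D f p))"

text \<open>
  The normal component of the ambient derivative of \<open>f\<^sub>* Y\<close> along \<open>X\<close>, the vectors being extended
  as constant fields.
\<close>

definition second_ff ::
  "'v form \<Rightarrow> ('a::euclidean_space \<Rightarrow> 'v::euclidean_space) \<Rightarrow> 'a \<Rightarrow> 'a \<Rightarrow> 'a \<Rightarrow> 'v" where
  "second_ff h f p X Y = normal_part h f p (D (\<lambda>q. D f q Y) p X)"

definition relative_nullity ::
  "'v form \<Rightarrow> ('a::euclidean_space \<Rightarrow> 'v::euclidean_space) \<Rightarrow> 'a \<Rightarrow> 'a set" where
  "relative_nullity h f p = {X. \<forall>Y. second_ff h f p X Y = 0}"

definition immersion_rank ::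
  "'v form \<Rightarrow> ('a::euclidean_space \<Rightarrow> 'v::euclidean_space) \<Rightarrow> 'a \<Rightarrow> nat" where
  "immersion_rank h f p = DIM('a) - dim (relative_nullity h f p)"

definition gauss_map ::
  "'a set \<Rightarrow> ('a::euclidean_space \<Rightarrow> 'v::euclidean_space) \<Rightarrow> ('a \<Rightarrow> 'v) \<Rightarrow> bool" where
  "gauss_map M f N \<longleftrightarrow>
     smooth_on N M \<and> (\<forall>p\<in>M. norm (N p) = 1 \<and> (\<forall>Z. N p \<bullet> D f p Z = 0))"

definition shape_operator ::
  "('a::euclidean_space \<Rightarrow> 'v::euclidean_space) \<Rightarrow> ('a \<Rightarrow> 'v) \<Rightarrow> 'a \<Rightarrow> 'a \<Rightarrow> 'a" where
  "shape_operator f N p X = (THE W. D f p W = - D N p X)"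

section \<open>Germs up to rigid motions, and honest immersions\<close>

definition rigid_motion :: "'v form \<Rightarrow> ('v::euclidean_space \<Rightarrow> 'v) \<Rightarrow> bool" where
  "rigid_motion h \<tau> \<longleftrightarrow>
     (\<exists>L b. linear L \<and> (\<forall>v w. h (L v) (L w) = h v w) \<and> \<tau> = (\<lambda>v. L v + b))"

definition same_germ ::
  "'v form \<Rightarrow> 'a \<Rightarrow> ('a::euclidean_space \<Rightarrow> 'v::euclidean_space) \<Rightarrow> ('a \<Rightarrow> 'v) \<Rightarrow> bool" where
  "same_germ h x0 g g' \<longleftrightarrow>
     (\<exists>U \<tau>. open U \<and> x0 \<in> U \<and> rigid_motion h \<tau> \<and> (\<forall>p\<in>U. g' p = \<tau> (g p)))"

text \<open>
  In \<open>composition\<close> the ambient space of \<open>k\<close> is that of \<open>g\<close>: classes of immersions into spaces of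
  different index are different.
\<close>

definition composition ::
  "'w form \<Rightarrow> 'a \<Rightarrow> ('a::euclidean_space \<Rightarrow> 'v::euclidean_space) \<Rightarrow> ('a \<Rightarrow> 'w::euclidean_space) \<Rightarrow> bool" where
  "composition h x0 f g \<longleftrightarrow>
     (\<exists>W k. open W \<and> f x0 \<in> W \<and> isometric_immersion W (\<lambda>_. inner) h k \<and> same_germ h x0 (k \<circ> f) g)"

definition honest ::
  "'a set \<Rightarrow> ('a::euclidean_space \<Rightarrow> 'a form) \<Rightarrow> 'a \<Rightarrow> ('a \<Rightarrow> 'v::euclidean_space) \<Rightarrow>
   'w form \<Rightarrow> ('a \<Rightarrow> 'w::euclidean_space) \<Rightarrow> bool" where
  "honest M m x0 f h g \<longleftrightarrow> isometric_immersion M m h g \<and> \<not> composition h x0 f g"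

section \<open>The leaf space and the conjugate chart\<close>

text \<open>Two points lie in the same leaf of the nullity if a curve tangent to it joins them.\<close>

definition same_leaf ::
  "'a set \<Rightarrow> ('a::euclidean_space \<Rightarrow> 'a form) \<Rightarrow> 'a \<Rightarrow> 'a \<Rightarrow> bool" where
  "same_leaf M m p q \<longleftrightarrow>
     (\<exists>\<gamma> \<gamma>'. \<gamma> 0 = p \<and> \<gamma> 1 = q \<and> continuous_on {0..1} \<gamma>' \<and>
        (\<forall>t\<in>{0..1::real}. \<gamma> t \<in> M \<and> (\<gamma> has_vector_derivative \<gamma>' t) (at t within {0..1}) \<and>
           \<gamma>' t \<in> nullity m (\<gamma> t)))"

text \<open>
  \<open>u\<close> stands for the composition of the projection \<open>M \<rightarrow> L = M/\<Gamma>\<close> with a global chart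
  \<open>(u\<^sub>0, u\<^sub>1, u\<^sub>2)\<close> of the leaf space, so \<open>L\<close> is identified with the open set \<open>u ` M\<close>.
  The indices \<open>0, 1, 2\<close> are the elements of the type \<open>3\<close> (in which \<open>3 = 0\<close>).
\<close>

definition leaf_chart ::
  "'a set \<Rightarrow> ('a::euclidean_space \<Rightarrow> 'a form) \<Rightarrow> ('a \<Rightarrow> real^3) \<Rightarrow> bool" where
  "leaf_chart M m u \<longleftrightarrow>
     smooth_on u M \<and>
     (\<forall>p\<in>M. surj (D u p) \<and> {v. D u p v = 0} = nullity m p) \<and>
     (\<forall>p\<in>M. \<forall>q\<in>M. u p = u q \<longleftrightarrow> same_leaf M m p q)"

text \<open>
  Fields \<open>X\<^sub>i\<close> orthogonal to the nullity, projecting onto the coordinate fields of the chart, and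
  diagonalizing all the splitting tensors.
\<close>

definition conjugate_frame ::
  "'a set \<Rightarrow> ('a::euclidean_space \<Rightarrow> 'a form) \<Rightarrow> ('a \<Rightarrow> real^3) \<Rightarrow> (3 \<Rightarrow> 'a \<Rightarrow> 'a) \<Rightarrow> bool" where
  "conjugate_frame M m u X \<longleftrightarrow>
     (\<forall>i. smooth_on (X i) M \<and>
        (\<forall>p\<in>M. X i p \<in> conullity m p \<and> D u p (X i p) = axis i 1 \<and>
           (\<forall>U T. open U \<and> p \<in> U \<and> U \<subseteq> M \<and> nullity_section m U T \<longrightarrow>
              (\<exists>c. splitting m T p (X i p) = c *\<^sub>R X i p))))"

text \<open>The Gauss map descends to an immersion \<open>\<nu>\<close> of the leaf space.\<close>

definition descended_gauss_map ::
  "'a set \<Rightarrow> ('a::euclidean_space \<Rightarrow> real^3) \<Rightarrow> ('a \<Rightarrow> 'v::euclidean_space) \<Rightarrow> (real^3 \<Rightarrow> 'v) \<Rightarrow> bool" where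
  "descended_gauss_map M u N \<nu> \<longleftrightarrow> immersion_on (u ` M) \<nu> \<and> (\<forall>p\<in>M. N p = \<nu> (u p))"

text \<open>
  \<open>christoffel_symbol \<nu> i j k\<close> is \<open>\<Gamma>\<^sub>i\<^sub>j\<^sup>k\<close> for the metric induced by \<open>\<nu>\<close>, that is, the \<open>k\<close>-th component
  of \<open>\<nabla>\<^bsub>\<partial>\<^sub>i\<^esub> \<partial>\<^sub>j\<close>.
\<close>

definition christoffel_symbol ::
  "(real^3 \<Rightarrow> 'v::euclidean_space) \<Rightarrow> 3 \<Rightarrow> 3 \<Rightarrow> 3 \<Rightarrow> real^3 \<Rightarrow> real" where
  "christoffel_symbol \<nu> i j k y = christoffel (pullback inner \<nu>) y (axis i 1) (axis j 1) $ k"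

section \<open>The normal fields, the functions, and the ruled extensions\<close>

definition shape_coeff ::
  "('a::euclidean_space \<Rightarrow> 'a form) \<Rightarrow> ('a \<Rightarrow> 'v::euclidean_space) \<Rightarrow> ('a \<Rightarrow> 'v) \<Rightarrow>
   (3 \<Rightarrow> 'a \<Rightarrow> 'a) \<Rightarrow> 3 \<Rightarrow> 'a \<Rightarrow> real" where
  "shape_coeff m f N X i p = m p (shape_operator f N p (X i p)) (X i p)"

definition eta ::
  "('a::euclidean_space \<Rightarrow> 'a form) \<Rightarrow> ('a \<Rightarrow> 'v::euclidean_space) \<Rightarrow> ('a \<Rightarrow> 'v) \<Rightarrow>
   (3 \<Rightarrow> 'a \<Rightarrow> 'a) \<Rightarrow> 'w form \<Rightarrow> ('a \<Rightarrow> 'w::euclidean_space) \<Rightarrow> 3 \<Rightarrow> 'a \<Rightarrow> 'w" where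
  "eta m f N X h g i p = second_ff h g p (X i p) (X i p) /\<^sub>R shape_coeff m f N X i p"

definition associated_functions ::
  "'a set \<Rightarrow> ('a::euclidean_space \<Rightarrow> 'a form) \<Rightarrow> ('a \<Rightarrow> 'v::euclidean_space) \<Rightarrow> ('a \<Rightarrow> 'v) \<Rightarrow>
   (3 \<Rightarrow> 'a \<Rightarrow> 'a) \<Rightarrow> 'w form \<Rightarrow> ('a \<Rightarrow> 'w::euclidean_space) \<Rightarrow> (3 \<Rightarrow> 'a \<Rightarrow> real) \<Rightarrow> bool" where
  "associated_functions M m f N X h g \<phi> \<longleftrightarrow>
     (\<forall>p\<in>M. \<forall>i j. \<phi> i p \<noteq> 0 \<and>
        h (eta m f N X h g i p) (eta m f N X h g j p) = 1 + (if i = j then 1 / \<phi> i p else 0))"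

definition Y_field ::
  "('a::euclidean_space \<Rightarrow> 'a form) \<Rightarrow> ('a \<Rightarrow> 'v::euclidean_space) \<Rightarrow> ('a \<Rightarrow> 'v) \<Rightarrow>
   (3 \<Rightarrow> 'a \<Rightarrow> 'a) \<Rightarrow> ('a \<Rightarrow> real^3) \<Rightarrow> (real^3 \<Rightarrow> 'v) \<Rightarrow> 'a \<Rightarrow> 'a" where
  "Y_field m f N X u \<nu> p =
     - (christoffel_symbol \<nu> 1 0 0 (u p) / shape_coeff m f N X 1 p) *\<^sub>R X 1 p
     - (christoffel_symbol \<nu> 2 0 0 (u p) / shape_coeff m f N X 2 p) *\<^sub>R X 2 p"

definition lambda_field ::
  "('a::euclidean_space \<Rightarrow> 'a form) \<Rightarrow> ('a \<Rightarrow> 'v::euclidean_space) \<Rightarrow> ('a \<Rightarrow> 'v) \<Rightarrow>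
   (3 \<Rightarrow> 'a \<Rightarrow> 'a) \<Rightarrow> ('a \<Rightarrow> real^3) \<Rightarrow> (real^3 \<Rightarrow> 'v) \<Rightarrow>
   'w form \<Rightarrow> ('a \<Rightarrow> 'w::euclidean_space) \<Rightarrow> 'a \<Rightarrow> 'w" where
  "lambda_field m f N X u \<nu> h g p = eta m f N X h g 0 p + D g p (Y_field m f N X u \<nu> p)"

text \<open>
  The line bundle spanned by \<open>\<lambda>\<close> is trivialized by \<open>\<lambda>\<close>: the pair \<open>(p, t)\<close> stands for \<open>t \<lambda>\<^sub>p\<close>, and
  the zero section is \<open>M \<times> {0}\<close>.  This also identifies the bundles of two immersions.
\<close>

definition extension_map ::
  "('a::euclidean_space \<Rightarrow> 'a form) \<Rightarrow> ('a \<Rightarrow> 'v::euclidean_space) \<Rightarrow> ('a \<Rightarrow> 'v) \<Rightarrow>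
   (3 \<Rightarrow> 'a \<Rightarrow> 'a) \<Rightarrow> ('a \<Rightarrow> real^3) \<Rightarrow> (real^3 \<Rightarrow> 'v) \<Rightarrow>
   'w form \<Rightarrow> ('a \<Rightarrow> 'w::euclidean_space) \<Rightarrow> 'a \<times> real \<Rightarrow> 'w" where
  "extension_map m f N X u \<nu> h g = (\<lambda>(p, t). g p + t *\<^sub>R lambda_field m f N X u \<nu> h g p)"

end

theory Submission
  imports Defs
begin

text \<open>
  The point of the lemma is that the differential of \<open>G\<close> never leaves \<open>TM \<oplus> span \<eta>\<^sub>0\<close>.  If
  \<open>\<nabla>\<^sup>\<bottom>\<^sub>v \<eta>\<^sub>0 + \<alpha>(v, Y)\<close> is a multiple \<open>\<kappa>(v) \<eta>\<^sub>0\<close> for every \<open>v\<close>, then the differential of \<open>\<lambda>\<close> is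
  \<open>v \<mapsto> g\<^sub>*(\<nabla>\<^sub>v Y - A\<^sub>\<eta>\<^sub>0 v) + \<kappa>(v) \<eta>\<^sub>0\<close>, and the induced form at \<open>t \<lambda>\<^sub>p\<close> is the pullback of the diagonal form
  \<open>m \<oplus> (1 + 1/\<phi>\<^sub>0)\<close> under a linear map (\<open>extension_differential\<close>) built from the metric, the shape
  operator of \<open>f\<close>, the Christoffel symbols of the leaf space and \<open>\<phi>\<^sub>0\<close>.  These data are common to
  \<open>g\<close> and \<open>g'\<close>, so \<open>G\<close> and \<open>G'\<close> induce the same form.  As \<open>G\<close> is an immersion the linear map is
  invertible, and the type of the form is read off from the sign of \<open>1 + 1/\<phi>\<^sub>0\<close>
  (\<open>form_in_coordinates\<close>).

  The choice of \<open>Y\<close> makes \<open>\<nabla>\<^sup>\<bottom>\<^sub>v \<eta>\<^sub>0 + \<alpha>(v, Y)\<close> a multiple of \<open>\<eta>\<^sub>0\<close> for \<open>v = X\<^sub>1, X\<^sub>2\<close>.  For \<open>v = X\<^sub>0\<close>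
  this requires \<open>\<Gamma>\<^sub>0\<^sub>1\<^sup>1 = \<Gamma>\<^sub>0\<^sub>2\<^sup>2\<close>, and here the second immersion enters.  Let
  \<open>\<delta>\<^sub>i = \<phi>\<^sub>i - \<phi>'\<^sub>i\<close>.  Since \<open>\<delta>\<^sub>0 = 0\<close> and both triples sum to \<open>-1\<close>, we have \<open>\<delta>\<^sub>2 = -\<delta>\<^sub>1\<close>, and the
  derivative of \<open>\<phi>\<^sub>0 = \<phi>'\<^sub>0\<close> along \<open>X\<^sub>0\<close> gives \<open>(\<Gamma>\<^sub>0\<^sub>1\<^sup>1 - \<Gamma>\<^sub>0\<^sub>2\<^sup>2) \<delta>\<^sub>1 = 0\<close> (\<open>gam_eq\<close>).  The \<open>\<delta>\<^sub>i\<close> satisfy a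
  homogeneous linear system on the connected set \<open>M\<close>, so a zero of \<open>\<delta>\<^sub>1\<close> would force \<open>\<phi> = \<phi>'\<close>
  everywhere (\<open>phi_agree\<close>), and then \<open>g\<close> and \<open>g'\<close> would differ by a rigid motion (\<open>rigidity\<close>).

  The structure equations behind these statements are derived from the symmetry of higher
  derivatives of \<open>g\<close> as a map into a vector space.  The nullity is the kernel of \<open>D u\<close>.  For a
  section \<open>T\<close> of the nullity the second derivative of \<open>g\<^sub>* T\<close> shows that the splitting tensor is
  self-adjoint for \<open>\<alpha>\<close>, and its distinct eigenvalues make \<open>\<alpha>\<close> diagonal in the frame
  (\<open>frame_conjugate\<close>).  So \<open>\<alpha>(v, w) = \<Sum>\<^sub>k du\<^sub>k(v) du\<^sub>k(w) \<beta>\<^sub>k\<close>, and the third derivative of \<open>g\<close>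
  yields the Codazzi equation in terms of the Hessians of the \<open>u\<^sub>k\<close> (\<open>codazzi\<close>).
  Comparing it for \<open>g\<close> and \<open>f\<close> determines the normal derivatives of \<open>\<eta>\<^sub>i\<close> except that along
  \<open>X\<^sub>i\<close>, which follows from the relation \<open>\<Sum>\<^sub>i \<phi>\<^sub>i \<eta>\<^sub>i = 0\<close> in the normal
  plane (\<open>phi_relation\<close>, \<open>perp_eta\<close>).
\<close>

section \<open>Differential calculus of several variables\<close>

lemma D_eqI: "(F has_derivative F') (at p) \<Longrightarrow> D F p = F'"
  using frechet_derivative_at by metis

lemma has_derivative_D: "F differentiable (at p) \<Longrightarrow> (F has_derivative D F p) (at p)"
  by (simp add: frechet_derivative_works)

lemma second_difference_bound:
  fixes F :: "'a::real_normed_vector \<Rightarrow> 'b::real_normed_vector"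
  assumes S: "open S" "p \<in> S" and diff: "\<And>q. q \<in> S \<Longrightarrow> F differentiable (at q)"
    and diff2: "(\<lambda>q. D F q v) differentiable (at p)" and e: "e > 0"
  shows "\<exists>d>0. \<forall>t. 0 < t \<and> t < d \<longrightarrow>
     norm (F (p + t *\<^sub>R v + t *\<^sub>R w) - F (p + t *\<^sub>R v) - F (p + t *\<^sub>R w) + F p
       - (t * t) *\<^sub>R D (\<lambda>q. D F q v) p w) \<le> e * t * t"
proof -
  define L where "L = D (\<lambda>q. D F q v) p"
  have L: "((\<lambda>q. D F q v) has_derivative L) (at p)"
    unfolding L_def by (rule has_derivative_D[OF diff2])
  then have linL: "linear L" by (simp add: has_derivative_linear)
  \<comment> \<open>The remainder \<open>R\<close> below has derivative at most \<open>e' (2 K t) + e' (K t) = e t\<close>.\<close>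
  define K where "K = norm v + norm w + 1"
  have K: "K > 0" "norm v \<le> K" "norm w \<le> K" unfolding K_def by (auto simp: add_nonneg_pos)
  define e' where "e' = e / (3 * K)"
  have e': "e' > 0" using e K by (simp add: e'_def)
  obtain d1 where d1: "d1 > 0"
    "\<And>q. norm (q - p) < d1 \<Longrightarrow> norm (D F q v - D F p v - L (q - p)) \<le> e' * norm (q - p)"
    using L e' unfolding has_derivative_at_alt by blast
  obtain d2 where d2: "d2 > 0" "ball p d2 \<subseteq> S"
    using S open_contains_ball by blast
  define d where "d = min d1 d2 / (2 * K)"
  have d: "d > 0" using d1 d2 K by (simp add: d_def)
  have bound: "norm (F (p + t *\<^sub>R v + t *\<^sub>R w) - F (p + t *\<^sub>R v) - F (p + t *\<^sub>R w) + F p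
       - (t * t) *\<^sub>R L w) \<le> e * t * t" if t: "0 < t" "t < d" for t
  proof -
    define R where "R s = F (p + s *\<^sub>R v + t *\<^sub>R w) - F (p + s *\<^sub>R v) - (s * t) *\<^sub>R L w" for s
    have tK: "2 * K * t < min d1 d2" using t K by (simp add: d_def field_simps)
    have n1: "norm (s *\<^sub>R v + t *\<^sub>R w) \<le> 2 * K * t" "norm (s *\<^sub>R v) \<le> K * t" if "s \<in> {0..t}" for s
    proof -
      have a: "norm (s *\<^sub>R v) \<le> t * K" using that K(2) t by (auto intro!: mult_mono)
      have b: "norm (t *\<^sub>R w) \<le> t * K" using K(3) t by simp
      have "norm (s *\<^sub>R v + t *\<^sub>R w) \<le> norm (s *\<^sub>R v) + norm (t *\<^sub>R w)" by (rule norm_triangle_ineq)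
      then show "norm (s *\<^sub>R v + t *\<^sub>R w) \<le> 2 * K * t" using a b by (simp add: algebra_simps)
      show "norm (s *\<^sub>R v) \<le> K * t" using a by (simp add: algebra_simps)
    qed
    have n2: "norm (s *\<^sub>R v + t *\<^sub>R w) < d1" "norm (s *\<^sub>R v + t *\<^sub>R w) < d2"
      "norm (s *\<^sub>R v) < d1" "norm (s *\<^sub>R v) < d2" if "s \<in> {0..t}" for s
    proof -
      have "K * t \<le> 2 * K * t" using K t by simp
      then show "norm (s *\<^sub>R v + t *\<^sub>R w) < d1" "norm (s *\<^sub>R v + t *\<^sub>R w) < d2"
        "norm (s *\<^sub>R v) < d1" "norm (s *\<^sub>R v) < d2"
        using n1[OF that] tK by linarith+
    qed
    have inS: "p + s *\<^sub>R v + t *\<^sub>R w \<in> S" "p + s *\<^sub>R v \<in> S" if "s \<in> {0..t}" for s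
    proof -
      have "p + (s *\<^sub>R v + t *\<^sub>R w) \<in> ball p d2" using n2(2)[OF that]
        by (metis add_diff_cancel_left' dist_commute dist_norm mem_ball)
      then show "p + s *\<^sub>R v + t *\<^sub>R w \<in> S" using d2(2) by (auto simp: add.assoc)
      have "p + s *\<^sub>R v \<in> ball p d2" using n2(4)[OF that]
        by (metis add_diff_cancel_left' dist_commute dist_norm mem_ball)
      then show "p + s *\<^sub>R v \<in> S" using d2(2) by blast
    qed
    define R' where "R' s = (\<lambda>h. h *\<^sub>R (D F (p + s *\<^sub>R v + t *\<^sub>R w) v - D F (p + s *\<^sub>R v) v - t *\<^sub>R L w))" for s
    have der: "(R has_derivative R' s) (at s within {0..t})" if s: "s \<in> {0..t}" for s
    proof -
      have a: "((\<lambda>s. F (p + s *\<^sub>R v + t *\<^sub>R w)) has_derivative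
          (\<lambda>h. D F (p + s *\<^sub>R v + t *\<^sub>R w) (h *\<^sub>R v))) (at s within {0..t})"
        by (rule has_derivative_compose[where f="\<lambda>s. p + s *\<^sub>R v + t *\<^sub>R w" and g=F, OF _ has_derivative_D[OF diff[OF inS(1)[OF s]]]])
          (auto intro!: derivative_eq_intros)
      have b: "((\<lambda>s. F (p + s *\<^sub>R v)) has_derivative
          (\<lambda>h. D F (p + s *\<^sub>R v) (h *\<^sub>R v))) (at s within {0..t})"
        by (rule has_derivative_compose[where f="\<lambda>s. p + s *\<^sub>R v" and g=F, OF _ has_derivative_D[OF diff[OF inS(2)[OF s]]]])
          (auto intro!: derivative_eq_intros)
      have "(R has_derivative (\<lambda>h. D F (p + s *\<^sub>R v + t *\<^sub>R w) (h *\<^sub>R v) - D F (p + s *\<^sub>R v) (h *\<^sub>R v)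
             - (h * t) *\<^sub>R L w)) (at s within {0..t})"
        unfolding R_def[abs_def] by (intro has_derivative_diff a b) (auto intro!: derivative_eq_intros)
      then show ?thesis
        unfolding R'_def
        using linear_frechet_derivative[OF diff[OF inS(1)[OF s]]]
              linear_frechet_derivative[OF diff[OF inS(2)[OF s]]]
        by (simp add: linear_scale scaleR_diff_right)
    qed
    have bd: "onorm (R' s) \<le> e * t" if s: "s \<in> {0..t}" for s
    proof -
      let ?x = "s *\<^sub>R v + t *\<^sub>R w" and ?y = "s *\<^sub>R v"
      have "norm (D F (p + ?x) v - D F p v - L ?x) \<le> e' * norm ?x"
        using d1(2)[of "p + ?x"] n2[OF s] by simp
      moreover have "norm (D F (p + ?y) v - D F p v - L ?y) \<le> e' * norm ?y"
        using d1(2)[of "p + ?y"] n2[OF s] by simp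
      moreover have "D F (p + s *\<^sub>R v + t *\<^sub>R w) v - D F (p + s *\<^sub>R v) v - t *\<^sub>R L w
         = (D F (p + ?x) v - D F p v - L ?x) - (D F (p + ?y) v - D F p v - L ?y)"
        by (simp add: linear_add[OF linL] linear_scale[OF linL] add.assoc)
      ultimately have "norm (D F (p + s *\<^sub>R v + t *\<^sub>R w) v - D F (p + s *\<^sub>R v) v - t *\<^sub>R L w)
         \<le> e' * norm ?x + e' * norm ?y"
        by (smt (verit) norm_triangle_ineq4)
      also have "\<dots> \<le> e' * (2 * K * t) + e' * (K * t)"
        using n1[OF s] e' by (intro add_mono mult_left_mono) auto
      also have "\<dots> = e * t" using K by (simp add: e'_def field_simps)
      finally have *: "norm (D F (p + s *\<^sub>R v + t *\<^sub>R w) v - D F (p + s *\<^sub>R v) v - t *\<^sub>R L w) \<le> e * t" .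
      show ?thesis
        by (rule onorm_bound) (use * e t in \<open>auto simp: R'_def mult.commute intro!: mult_left_mono\<close>)
    qed
    have "norm (R t - R 0) \<le> e * t * norm (t - 0)"
      by (rule differentiable_bound[where S="{0..t}" and f'=R'])
         (use der bd t in auto)
    then show ?thesis using t by (simp add: R_def algebra_simps)
  qed
  show ?thesis using d bound unfolding L_def by blast
qed

text \<open>
  The second difference of \<open>F\<close> over a small parallelogram is symmetric in the two edges, and the
  mean value inequality along either edge compares it with one of the two iterated derivatives.
\<close>

lemma second_derivative_symmetric:
  fixes F :: "'a::real_normed_vector \<Rightarrow> 'b::real_normed_vector"
  assumes S: "open S" "p \<in> S" and diff: "\<And>q. q \<in> S \<Longrightarrow> F differentiable (at q)"
    and diff2: "\<And>v. (\<lambda>q. D F q v) differentiable (at p)"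
  shows "D (\<lambda>q. D F q v) p w = D (\<lambda>q. D F q w) p v"
proof -
  let ?A = "D (\<lambda>q. D F q v) p w" and ?B = "D (\<lambda>q. D F q w) p v"
  have "norm (?A - ?B) \<le> 0"
  proof (rule field_le_epsilon)
    fix e :: real assume "e > 0"
    then have e: "e/2 > 0" by simp
    obtain d1 where d1: "d1 > 0" "\<And>t. 0 < t \<and> t < d1 \<Longrightarrow>
       norm (F (p + t *\<^sub>R v + t *\<^sub>R w) - F (p + t *\<^sub>R v) - F (p + t *\<^sub>R w) + F p - (t * t) *\<^sub>R ?A) \<le> e/2 * t * t"
      using second_difference_bound[OF S diff diff2 e] by metis
    obtain d2 where d2: "d2 > 0" "\<And>t. 0 < t \<and> t < d2 \<Longrightarrow>
       norm (F (p + t *\<^sub>R w + t *\<^sub>R v) - F (p + t *\<^sub>R w) - F (p + t *\<^sub>R v) + F p - (t * t) *\<^sub>R ?B) \<le> e/2 * t * t"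
      using second_difference_bound[OF S diff diff2 e] by metis
    define t where "t = min d1 d2 / 2"
    have t: "0 < t" "t < d1" "t < d2" using d1 d2 by (auto simp: t_def min_def)
    let ?X = "F (p + t *\<^sub>R v + t *\<^sub>R w) - F (p + t *\<^sub>R v) - F (p + t *\<^sub>R w) + F p"
    have eq: "F (p + t *\<^sub>R w + t *\<^sub>R v) - F (p + t *\<^sub>R w) - F (p + t *\<^sub>R v) + F p = ?X"
      by (simp add: algebra_simps)
    have "(t * t) *\<^sub>R (?A - ?B) = (?X - (t * t) *\<^sub>R ?B) - (?X - (t * t) *\<^sub>R ?A)"
      by (simp add: algebra_simps)
    then have "norm ((t * t) *\<^sub>R (?A - ?B)) \<le> e/2 * t * t + e/2 * t * t"
      using d1(2)[of t] d2(2)[of t] t eq norm_triangle_ineq4[of "?X - (t * t) *\<^sub>R ?B" "?X - (t * t) *\<^sub>R ?A"]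
      by simp
    then have "(t * t) * norm (?A - ?B) \<le> (t * t) * e"
      using t by (simp only: norm_scaleR abs_mult abs_of_pos) (simp add: algebra_simps)
    then show "norm (?A - ?B) \<le> 0 + e" using t by simp
  qed
  then show ?thesis by simp
qed

lemma second_derivative_bilinear:
  fixes F :: "'a::real_normed_vector \<Rightarrow> 'b::real_normed_vector"
  assumes S: "open S" "p \<in> S" and diff: "\<And>q. q \<in> S \<Longrightarrow> F differentiable (at q)"
    and diff2: "\<And>v. (\<lambda>q. D F q v) differentiable (at p)"
  shows "bilinear (\<lambda>v w. D (\<lambda>q. D F q w) p v)"
proof -
  have "(\<lambda>w. D (\<lambda>q. D F q w) p v) = D (\<lambda>q. D F q v) p" for v
    by (rule ext) (rule second_derivative_symmetric[OF S diff diff2])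
  then have "linear (\<lambda>w. D (\<lambda>q. D F q w) p v)" for v
    using linear_frechet_derivative[OF diff2[of v]] by simp
  moreover have "linear (\<lambda>v. D (\<lambda>q. D F q w) p v)" for w
    by (rule linear_frechet_derivative[OF diff2])
  ultimately show ?thesis unfolding bilinear_def by simp
qed

lemma linear_basis_expansion:
  fixes F :: "'a::euclidean_space \<Rightarrow> 'b::real_vector"
  assumes "linear F" shows "F x = (\<Sum>e\<in>Basis. (x \<bullet> e) *\<^sub>R F e)"
proof -
  have "F x = F (\<Sum>e\<in>Basis. (x \<bullet> e) *\<^sub>R e)" by (simp add: euclidean_representation)
  then show ?thesis using assms by (simp add: linear_sum linear_scale)
qed

lemma has_derivative_apply_linear:
  fixes B :: "'a::euclidean_space \<Rightarrow> 'c::euclidean_space \<Rightarrow> 'd::euclidean_space"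
  assumes S: "open S" "p \<in> S" and lin: "\<And>q. q \<in> S \<Longrightarrow> linear (B q)"
    and dB: "\<And>e. (\<lambda>q. B q e) differentiable (at p)" and dW: "W differentiable (at p)"
  shows "((\<lambda>q. B q (W q)) has_derivative (\<lambda>x. B p (D W p x) + D (\<lambda>q. B q (W p)) p x)) (at p)"
proof -
  have "((\<lambda>q. \<Sum>e\<in>Basis. (W q \<bullet> e) *\<^sub>R B q e) has_derivative
     (\<lambda>x. \<Sum>e\<in>Basis. (W p \<bullet> e) *\<^sub>R D (\<lambda>q. B q e) p x + (D W p x \<bullet> e) *\<^sub>R B p e)) (at p)"
    by (intro derivative_intros has_derivative_D dB dW)
  then have "((\<lambda>q. B q (W q)) has_derivative
     (\<lambda>x. \<Sum>e\<in>Basis. (W p \<bullet> e) *\<^sub>R D (\<lambda>q. B q e) p x + (D W p x \<bullet> e) *\<^sub>R B p e)) (at p)"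
    by (rule has_derivative_transform_within_open[OF _ S]) (rule linear_basis_expansion[OF lin, symmetric])
  moreover have "((\<lambda>q. \<Sum>e\<in>Basis. (W p \<bullet> e) *\<^sub>R B q e) has_derivative
     (\<lambda>x. \<Sum>e\<in>Basis. (W p \<bullet> e) *\<^sub>R D (\<lambda>q. B q e) p x)) (at p)"
    by (intro derivative_intros has_derivative_D dB)
  then have "((\<lambda>q. B q (W p)) has_derivative
     (\<lambda>x. \<Sum>e\<in>Basis. (W p \<bullet> e) *\<^sub>R D (\<lambda>q. B q e) p x)) (at p)"
    by (rule has_derivative_transform_within_open[OF _ S]) (rule linear_basis_expansion[OF lin, symmetric])
  then have "D (\<lambda>q. B q (W p)) p = (\<lambda>x. \<Sum>e\<in>Basis. (W p \<bullet> e) *\<^sub>R D (\<lambda>q. B q e) p x)"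
    by (rule D_eqI)
  moreover have "B p (D W p x) = (\<Sum>e\<in>Basis. (D W p x \<bullet> e) *\<^sub>R B p e)" for x
    using linear_basis_expansion[OF lin] S by blast
  ultimately show ?thesis by (simp add: sum.distrib add.commute)
qed

text \<open>
  A product is differentiable at a zero of one factor as soon as the other factor is continuous
  there.
\<close>

lemma has_derivative_vanishing_mult:
  fixes a :: "'a::real_normed_vector \<Rightarrow> 'b::real_normed_vector" and b :: "'a \<Rightarrow> real"
  assumes a: "(a has_derivative a') (at p)" "a p = 0" and b: "isCont b p"
  shows "((\<lambda>q. b q *\<^sub>R a q) has_derivative (\<lambda>x. b p *\<^sub>R a' x)) (at p)"
proof -
  have "((\<lambda>q. (1 / norm (q - p)) *\<^sub>R (a q - (a p + a' (q - p)))) \<longlongrightarrow> 0) (at p)"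
    and bl: "bounded_linear a'"
    using a(1) unfolding has_derivative_within by auto
  then have t1: "((\<lambda>q. b q *\<^sub>R ((1 / norm (q - p)) *\<^sub>R (a q - a' (q - p)))) \<longlongrightarrow> b p *\<^sub>R 0) (at p)"
    using b unfolding isCont_def a(2) by (intro tendsto_scaleR) auto
  obtain K where K: "\<And>x. norm (a' x) \<le> norm x * K" using bounded_linear.bounded[OF bl] by blast
  have "((\<lambda>q. (b q - b p) *\<^sub>R ((1 / norm (q - p)) *\<^sub>R a' (q - p))) \<longlongrightarrow> 0) (at p)"
  proof (rule Lim_null_comparison[where g="\<lambda>q. \<bar>b q - b p\<bar> * K"])
    show "eventually (\<lambda>q. norm ((b q - b p) *\<^sub>R ((1 / norm (q - p)) *\<^sub>R a' (q - p))) \<le> \<bar>b q - b p\<bar> * K) (at p)"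
      unfolding eventually_at_filter
    proof (rule always_eventually, intro allI impI)
      fix q assume "q \<noteq> p"
      then have "norm ((1 / norm (q - p)) *\<^sub>R a' (q - p)) \<le> K" using K[of "q - p"] by (simp add: field_simps)
      then show "norm ((b q - b p) *\<^sub>R ((1 / norm (q - p)) *\<^sub>R a' (q - p))) \<le> \<bar>b q - b p\<bar> * K"
        by (metis abs_ge_zero mult_left_mono norm_scaleR real_norm_def)
    qed
    have "((\<lambda>q. \<bar>b q - b p\<bar> * K) \<longlongrightarrow> \<bar>b p - b p\<bar> * K) (at p)"
      using b unfolding isCont_def by (intro tendsto_intros) auto
    then show "((\<lambda>q. \<bar>b q - b p\<bar> * K) \<longlongrightarrow> 0) (at p)" by simp
  qed
  from tendsto_add[OF t1 this]
  have "((\<lambda>q. b q *\<^sub>R ((1 / norm (q - p)) *\<^sub>R (a q - a' (q - p))) +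
      (b q - b p) *\<^sub>R ((1 / norm (q - p)) *\<^sub>R a' (q - p))) \<longlongrightarrow> 0) (at p)" by simp
  moreover have "b q *\<^sub>R ((1 / norm (q - p)) *\<^sub>R (a q - a' (q - p))) +
      (b q - b p) *\<^sub>R ((1 / norm (q - p)) *\<^sub>R a' (q - p))
      = (1 / norm (q - p)) *\<^sub>R (b q *\<^sub>R a q - (b p *\<^sub>R a p + b p *\<^sub>R a' (q - p)))" for q
    by (simp add: a(2) algebra_simps diff_divide_distrib)
  ultimately have "((\<lambda>q. (1 / norm (q - p)) *\<^sub>R (b q *\<^sub>R a q - (b p *\<^sub>R a p + b p *\<^sub>R a' (q - p)))) \<longlongrightarrow> 0) (at p)"
    by simp
  moreover have "bounded_linear (\<lambda>x. b p *\<^sub>R a' x)"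
    using bl by (rule bounded_linear_const_scaleR)
  ultimately show ?thesis unfolding has_derivative_within by simp
qed

text \<open>
  The solution of a linear equation is as differentiable as its coefficients.  With \<open>K\<close> a left
  inverse of \<open>B p\<close> the equation becomes \<open>W q = K (c q) - K ((B q - B p) (W q))\<close>; this bounds \<open>W\<close>
  near \<open>p\<close>, so \<open>W\<close> is continuous at \<open>p\<close>, and a continuous factor times coefficients that are
  differentiable and vanish at \<open>p\<close> is differentiable at \<open>p\<close>.
\<close>

lemma differentiable_linear_solution:
  fixes B :: "'a::euclidean_space \<Rightarrow> 'c::euclidean_space \<Rightarrow> 'd::euclidean_space"
  assumes S: "open S" "p \<in> S" and lin: "\<And>q. q \<in> S \<Longrightarrow> linear (B q)" and inj: "inj (B p)"
    and dB: "\<And>e. (\<lambda>q. B q e) differentiable (at p)" and dc: "c differentiable (at p)"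
    and eq: "\<And>q. q \<in> S \<Longrightarrow> B q (W q) = c q"
  shows "W differentiable (at p)"
proof -
  obtain K where K: "linear K" "K \<circ> B p = id"
    using linear_injective_left_inverse[OF lin[OF S(2)] inj] by blast
  then have blK: "bounded_linear K" by (simp add: linear_conv_bounded_linear)
  have KB: "K (B p x) = x" for x using K(2) by (metis comp_apply id_apply)
  obtain k where k: "k > 0" "\<And>x. norm (K x) \<le> norm x * k"
    using bounded_linear.pos_bounded[OF blK] by metis
  define E where "E q e = B q e - B p e" for q e
  have BE: "B q w - B p w = (\<Sum>e\<in>Basis. (w \<bullet> e) *\<^sub>R E q e)" if "q \<in> S" for q w
    using linear_basis_expansion[OF lin[OF that], of w] linear_basis_expansion[OF lin[OF S(2)], of w]
    by (simp add: E_def scaleR_diff_right sum_subtractf)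
  have W: "W q = K (c q) - K (\<Sum>e\<in>Basis. (W q \<bullet> e) *\<^sub>R E q e)" if "q \<in> S" for q
  proof -
    have "K (c q) - K (\<Sum>e\<in>Basis. (W q \<bullet> e) *\<^sub>R E q e) = K (c q - (\<Sum>e\<in>Basis. (W q \<bullet> e) *\<^sub>R E q e))"
      by (simp add: linear_diff[OF K(1)])
    also have "\<dots> = K (B p (W q))" using BE[OF that, of "W q"] eq[OF that] by (simp add: algebra_simps)
    finally show ?thesis using KB by simp
  qed
  define \<epsilon> where "\<epsilon> q = (\<Sum>e\<in>Basis. norm (E q e))" for q
  have contE: "isCont (\<lambda>q. E q e) p" for e
    unfolding E_def by (intro continuous_intros differentiable_imp_continuous_within dB)
  have epslim: "(\<epsilon> \<longlongrightarrow> 0) (at p)"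
  proof -
    have "(\<epsilon> \<longlongrightarrow> (\<Sum>e\<in>(Basis::'c set). norm (E p e))) (at p)"
      unfolding \<epsilon>_def[abs_def] using contE unfolding isCont_def by (intro tendsto_intros) auto
    then show ?thesis by (simp add: E_def)
  qed
  have ES: "norm (\<Sum>e\<in>Basis. (w \<bullet> e) *\<^sub>R E q e) \<le> norm w * \<epsilon> q" for q w
    unfolding \<epsilon>_def sum_distrib_left
    by (rule order_trans[OF norm_sum]) (auto intro!: sum_mono mult_right_mono Basis_le_norm)
  have inS: "eventually (\<lambda>q. q \<in> S) (at p)"
    using S by (auto simp: eventually_at_topological)
  have Wb: "eventually (\<lambda>q. norm (W q) \<le> 2 * k * norm (c q)) (at p)"
  proof -
    have "eventually (\<lambda>q. \<epsilon> q < 1 / (2 * k)) (at p)"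
      using epslim k by (intro order_tendstoD) auto
    then show ?thesis using inS
    proof eventually_elim
      case (elim q)
      have "norm (W q) \<le> norm (K (c q)) + norm (K (\<Sum>e\<in>Basis. (W q \<bullet> e) *\<^sub>R E q e))"
        using W[OF elim(2)] norm_triangle_ineq4 by metis
      also have "\<dots> \<le> norm (c q) * k + (norm (W q) * \<epsilon> q) * k"
        using k(1) ES by (intro add_mono order_trans[OF k(2)] mult_right_mono) auto
      also have "(norm (W q) * \<epsilon> q) * k \<le> norm (W q) * (1/2)"
      proof -
        have "\<epsilon> q * k \<le> 1/2" using elim(1) k by (simp add: field_simps)
        then show ?thesis by (metis mult.assoc mult_left_mono norm_ge_zero)
      qed
      finally have "norm (W q) \<le> 2 * (norm (c q) * k)" by simp
      also have "\<dots> = 2 * k * norm (c q)" by simp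
      finally show ?case .
    qed
  qed
  have "isCont c p" using dc differentiable_imp_continuous_within by blast
  then have clim: "(c \<longlongrightarrow> c p) (at p)" by (simp add: isCont_def)
  have "((\<lambda>q. \<Sum>e\<in>Basis. (W q \<bullet> e) *\<^sub>R E q e) \<longlongrightarrow> 0) (at p)"
  proof (rule Lim_null_comparison[where g="\<lambda>q. 2 * k * norm (c q) * \<epsilon> q"])
    show "eventually (\<lambda>q. norm (\<Sum>e\<in>Basis. (W q \<bullet> e) *\<^sub>R E q e) \<le> 2 * k * norm (c q) * \<epsilon> q) (at p)"
      using Wb
    proof eventually_elim
      case (elim q)
      have "0 \<le> \<epsilon> q" by (simp add: \<epsilon>_def sum_nonneg)
      then show ?case using ES[of "W q" q] mult_right_mono[OF elim] by fastforce
    qed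
    have "((\<lambda>q. 2 * k * norm (c q) * \<epsilon> q) \<longlongrightarrow> 2 * k * norm (c p) * 0) (at p)"
      by (intro tendsto_intros clim epslim)
    then show "((\<lambda>q. 2 * k * norm (c q) * \<epsilon> q) \<longlongrightarrow> 0) (at p)" by simp
  qed
  then have "((\<lambda>q. K (c q) - K (\<Sum>e\<in>Basis. (W q \<bullet> e) *\<^sub>R E q e)) \<longlongrightarrow> K (c p) - K 0) (at p)"
    by (intro tendsto_diff bounded_linear.tendsto[OF blK] clim)
  moreover have "K (c p) - K 0 = W p"
    using W[OF S(2)] by (simp add: E_def)
  ultimately have "((\<lambda>q. K (c q) - K (\<Sum>e\<in>Basis. (W q \<bullet> e) *\<^sub>R E q e)) \<longlongrightarrow> W p) (at p)" by simp
  then have contW: "isCont W p" unfolding isCont_def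
    by (rule Lim_transform_eventually) (use inS in eventually_elim, rule W[symmetric])
  have "((\<lambda>q. (W q \<bullet> e) *\<^sub>R E q e) has_derivative (\<lambda>x. (W p \<bullet> e) *\<^sub>R D (\<lambda>q. B q e) p x)) (at p)" for e
  proof (rule has_derivative_vanishing_mult)
    show "((\<lambda>q. E q e) has_derivative D (\<lambda>q. B q e) p) (at p)"
      unfolding E_def by (auto intro!: derivative_eq_intros has_derivative_D dB)
    show "E p e = 0" by (simp add: E_def)
    show "isCont (\<lambda>q. W q \<bullet> e) p" by (intro continuous_intros contW)
  qed
  then have "((\<lambda>q. K (c q) - K (\<Sum>e\<in>Basis. (W q \<bullet> e) *\<^sub>R E q e)) has_derivative
     (\<lambda>x. K (D c p x) - K (\<Sum>e\<in>Basis. (W p \<bullet> e) *\<^sub>R D (\<lambda>q. B q e) p x))) (at p)"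
    by (intro has_derivative_diff bounded_linear.has_derivative[OF blK]
      has_derivative_D dc has_derivative_sum) auto
  then have "(W has_derivative
     (\<lambda>x. K (D c p x) - K (\<Sum>e\<in>Basis. (W p \<bullet> e) *\<^sub>R D (\<lambda>q. B q e) p x))) (at p)"
    by (rule has_derivative_transform_within_open[OF _ S]) (rule W[symmetric])
  then show ?thesis unfolding differentiable_def by blast
qed

lemma gronwall_zero:
  fixes s :: "real \<Rightarrow> real"
  assumes der: "\<And>t. 0 \<le> t \<Longrightarrow> t \<le> 1 \<Longrightarrow> (s has_real_derivative s' t) (at t)"
    and le: "\<And>t. 0 \<le> t \<Longrightarrow> t \<le> 1 \<Longrightarrow> s' t \<le> C * s t" and s0: "s 0 = 0"
  shows "s 1 \<le> 0"
proof -
  have "s 1 * exp (- C * 1) \<le> s 0 * exp (- C * 0)"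
  proof (rule DERIV_nonpos_imp_nonincreasing[where f="\<lambda>t. s t * exp (- C * t)"])
    fix t :: real assume t: "0 \<le> t" "t \<le> 1"
    have "((\<lambda>t. s t * exp (- C * t)) has_real_derivative (s' t - C * s t) * exp (- C * t)) (at t)"
      by (rule derivative_eq_intros der t refl | simp add: algebra_simps)+
    moreover have "(s' t - C * s t) * exp (- C * t) \<le> 0"
      using le[OF t] by (simp add: mult_nonpos_nonneg)
    ultimately show "\<exists>y. ((\<lambda>t. s t * exp (- C * t)) has_real_derivative y) (at t) \<and> y \<le> 0" by blast
  qed simp
  then show ?thesis using s0 by (simp add: mult_le_0_iff)
qed

text \<open>
  Along a segment the sum of the squares of the unknowns satisfies \<open>s' \<le> C s\<close>, so by Gronwall's
  inequality it stays zero once it is zero; the zero set is therefore open, as well as closed.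
\<close>

lemma linear_system_vanishes:
  fixes F :: "'i \<Rightarrow> 'a::euclidean_space \<Rightarrow> 'b::euclidean_space"
  assumes M: "open M" "connected M" "p0 \<in> M" and I: "finite I"
    and lin: "\<And>i j q. i \<in> I \<Longrightarrow> j \<in> I \<Longrightarrow> q \<in> M \<Longrightarrow> linear (c i j q)"
    and cont: "\<And>i j e. i \<in> I \<Longrightarrow> j \<in> I \<Longrightarrow> continuous_on M (\<lambda>q. c i j q e)"
    and der: "\<And>i q. i \<in> I \<Longrightarrow> q \<in> M \<Longrightarrow>
               (F i has_derivative (\<lambda>x. \<Sum>j\<in>I. c i j q x *\<^sub>R F j q)) (at q)"
    and zero: "\<And>i. i \<in> I \<Longrightarrow> F i p0 = 0" and i: "i \<in> I" and q: "q \<in> M"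
  shows "F i q = 0"
proof -
  define Z where "Z = {q \<in> M. \<forall>i\<in>I. F i q = 0}"
  have local: "\<exists>r>0. ball q0 r \<subseteq> Z" if q0: "q0 \<in> Z" for q0
  proof -
    obtain r where r: "r > 0" "cball q0 r \<subseteq> M"
      using M(1) q0 open_contains_cball unfolding Z_def by blast
    define b where "b i j q = (\<Sum>e\<in>Basis. \<bar>c i j q e\<bar>)" for i j q
    have "\<exists>B. \<forall>q\<in>cball q0 r. b i j q \<le> B" if "i \<in> I" "j \<in> I" for i j
    proof -
      have "continuous_on (cball q0 r) (b i j)"
        unfolding b_def[abs_def] using continuous_on_subset[OF cont[OF that] r(2)]
        by (intro continuous_intros)
      then have "compact (b i j ` cball q0 r)" by (simp add: compact_continuous_image)
      then have "bdd_above (b i j ` cball q0 r)" by (simp add: compact_imp_bounded bounded_imp_bdd_above)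
      then show ?thesis unfolding bdd_above_def by blast
    qed
    then obtain B where B: "\<And>i j q. i \<in> I \<Longrightarrow> j \<in> I \<Longrightarrow> q \<in> cball q0 r \<Longrightarrow> b i j q \<le> B i j"
      by metis
    define K where "K = (\<Sum>i\<in>I. \<Sum>j\<in>I. \<bar>B i j\<bar>)"
    have cK: "\<bar>c i j q x\<bar> \<le> K * norm x" if ij: "i \<in> I" "j \<in> I" and q: "q \<in> cball q0 r" for i j q x
    proof -
      have "\<bar>c i j q x\<bar> = \<bar>\<Sum>e\<in>Basis. (x \<bullet> e) *\<^sub>R c i j q e\<bar>"
        using linear_basis_expansion[OF lin[OF ij]] q r(2) by (metis subsetD)
      also have "\<dots> \<le> (\<Sum>e\<in>Basis. norm x * \<bar>c i j q e\<bar>)"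
        by (rule order_trans[OF sum_abs]) (auto simp: abs_mult intro!: sum_mono mult_right_mono Basis_le_norm)
      also have "\<dots> = b i j q * norm x" by (simp add: b_def sum_distrib_left mult.commute)
      also have "\<dots> \<le> K * norm x"
      proof (rule mult_right_mono)
        have "b i j q \<le> \<bar>B i j\<bar>" using B[OF ij q] by linarith
        also have "\<dots> \<le> (\<Sum>j\<in>I. \<bar>B i j\<bar>)" using I ij by (intro member_le_sum) auto
        also have "\<dots> \<le> K" unfolding K_def using I ij
          by (intro member_le_sum[where f="\<lambda>i. \<Sum>j\<in>I. \<bar>B i j\<bar>"]) (auto intro: sum_nonneg)
        finally show "b i j q \<le> K" .
      qed simp
      finally show ?thesis .
    qed
    have "ball q0 r \<subseteq> Z"
    proof
      fix q assume q: "q \<in> ball q0 r"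
      define v where "v = q - q0"
      have v: "norm v < r" using q by (simp add: v_def dist_norm norm_minus_commute)
      have inb: "q0 + t *\<^sub>R v \<in> cball q0 r" if "0 \<le> t" "t \<le> 1" for t
      proof -
        have "norm (t *\<^sub>R v) \<le> norm v" using that by (simp add: mult_left_le_one_le)
        then show ?thesis using v by (simp add: dist_norm)
      qed
      define s where "s t = (\<Sum>i\<in>I. F i (q0 + t *\<^sub>R v) \<bullet> F i (q0 + t *\<^sub>R v))" for t
      define s' where "s' t = (\<Sum>i\<in>I. 2 * (F i (q0 + t *\<^sub>R v) \<bullet>
          (\<Sum>j\<in>I. c i j (q0 + t *\<^sub>R v) v *\<^sub>R F j (q0 + t *\<^sub>R v))))" for t
      have "s 1 \<le> 0"
      proof (rule gronwall_zero)
        fix t :: real assume t: "0 \<le> t" "t \<le> 1"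
        let ?q = "q0 + t *\<^sub>R v"
        have qM: "?q \<in> M" using inb[OF t] r by blast
        have Fd: "((\<lambda>t. F i (q0 + t *\<^sub>R v)) has_derivative
           (\<lambda>h. \<Sum>j\<in>I. c i j ?q (h *\<^sub>R v) *\<^sub>R F j ?q)) (at t)" if "i \<in> I" for i
          by (rule has_derivative_compose[where f="\<lambda>t. q0 + t *\<^sub>R v" and g="F i", OF _ der[OF that qM]])
             (auto intro!: derivative_eq_intros)
        have eq: "F i ?q \<bullet> (\<Sum>j\<in>I. c i j ?q (h *\<^sub>R v) *\<^sub>R F j ?q) + (\<Sum>j\<in>I. c i j ?q (h *\<^sub>R v) *\<^sub>R F j ?q) \<bullet> F i ?q
           = h * (2 * (F i ?q \<bullet> (\<Sum>j\<in>I. c i j ?q v *\<^sub>R F j ?q)))" if "i \<in> I" for i h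
        proof -
          have "(\<Sum>j\<in>I. c i j ?q (h *\<^sub>R v) *\<^sub>R F j ?q) = h *\<^sub>R (\<Sum>j\<in>I. c i j ?q v *\<^sub>R F j ?q)"
            using that qM by (simp add: linear_scale[OF lin] scaleR_sum_right)
          then show ?thesis by (simp add: inner_commute)
        qed
        have "(s has_derivative (\<lambda>h. \<Sum>i\<in>I. F i ?q \<bullet> (\<Sum>j\<in>I. c i j ?q (h *\<^sub>R v) *\<^sub>R F j ?q)
             + (\<Sum>j\<in>I. c i j ?q (h *\<^sub>R v) *\<^sub>R F j ?q) \<bullet> F i ?q)) (at t)"
          unfolding s_def[abs_def] by (intro has_derivative_sum has_derivative_inner Fd)
        then have "(s has_derivative (\<lambda>h. h * s' t)) (at t)"
          using eq by (simp add: s'_def sum_distrib_left)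
        then show "(s has_real_derivative s' t) (at t)"
          unfolding has_field_derivative_def by (simp add: mult.commute[of "s' t"] fun_eq_iff mult_commute_abs)
        define f where "f i = norm (F i ?q)" for i
        have "s' t \<le> (\<Sum>i\<in>I. \<Sum>j\<in>I. K * norm v * (f i ^ 2 + f j ^ 2))"
          unfolding s'_def inner_sum_right sum_distrib_left
        proof (intro sum_mono)
          fix i j assume ij: "i \<in> I" "j \<in> I"
          have K0: "0 \<le> K * norm v" using cK[OF ij inb[OF t], of v] by linarith
          have "2 * (F i ?q \<bullet> (c i j ?q v *\<^sub>R F j ?q)) \<le> 2 * (\<bar>c i j ?q v\<bar> * \<bar>F i ?q \<bullet> F j ?q\<bar>)"
            by (simp add: abs_mult[symmetric])
          also have "\<dots> \<le> 2 * ((K * norm v) * (f i * f j))"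
            unfolding f_def using cK[OF ij inb[OF t], of v] K0
            by (intro mult_left_mono mult_mono Cauchy_Schwarz_ineq2) auto
          also have "\<dots> = K * norm v * (2 * f i * f j)" by simp
          also have "\<dots> \<le> K * norm v * (f i ^ 2 + f j ^ 2)"
            using K0 by (intro mult_left_mono sum_squares_bound)
          finally show "2 * (F i ?q \<bullet> (c i j ?q v *\<^sub>R F j ?q)) \<le> K * norm v * (f i ^ 2 + f j ^ 2)" .
        qed
        also have "\<dots> = (K * norm v * 2 * card I) * s t"
          unfolding s_def f_def
          by (simp add: sum.distrib sum_distrib_left[symmetric] power2_norm_eq_inner algebra_simps)
        finally show "s' t \<le> (K * norm v * 2 * card I) * s t" .
      next
        show "s 0 = 0" using q0 by (simp add: s_def Z_def)
      qed
      then have "(\<Sum>i\<in>I. F i q \<bullet> F i q) \<le> 0" by (simp add: s_def v_def)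
      moreover have "0 \<le> (\<Sum>i\<in>I. F i q \<bullet> F i q)" by (simp add: sum_nonneg)
      ultimately have "(\<Sum>i\<in>I. F i q \<bullet> F i q) = 0" by simp
      then have "\<forall>i\<in>I. F i q = 0" using I by (simp add: sum_nonneg_eq_0_iff)
      moreover have "q \<in> M" using q r(2) ball_subset_cball by blast
      ultimately show "q \<in> Z" by (simp add: Z_def)
    qed
    then show ?thesis using r by blast
  qed
  have "open Z" unfolding open_contains_ball using local by blast
  moreover have "open (M - Z)"
  proof -
    have "continuous_on M (F i)" if "i \<in> I" for i
      using der[OF that] has_derivative_continuous continuous_at_imp_continuous_on by blast
    then have "open (M \<inter> F i -` (- {0}))" if "i \<in> I" for i
      using that M(1) by (intro continuous_open_preimage) auto
    then have "open (\<Union>i\<in>I. M \<inter> F i -` (- {0}))" by blast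
    moreover have "M - Z = (\<Union>i\<in>I. M \<inter> F i -` (- {0}))" by (auto simp: Z_def)
    ultimately show ?thesis by simp
  qed
  ultimately have "Z \<inter> M = {} \<or> (M - Z) \<inter> M = {}"
    using connectedD[OF M(2), of Z "M - Z"] by blast
  moreover have "p0 \<in> Z \<inter> M" using M zero by (simp add: Z_def)
  ultimately show ?thesis using q i unfolding Z_def by blast
qed

lemma smooth_on_differentiable: "smooth_on F S \<Longrightarrow> p \<in> S \<Longrightarrow> F differentiable (at p)"
  unfolding smooth_on_def using Ck_on.simps(2) by blast

lemma smooth_on_D: "smooth_on F S \<Longrightarrow> smooth_on (\<lambda>p. D F p v) S"
  unfolding smooth_on_def using Ck_on.simps(2) by blast

lemma D_cong:
  assumes "open U" "p \<in> U" and eq: "\<And>q. q \<in> U \<Longrightarrow> F q = H q"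
  shows "D F p = D H p"
proof -
  have "(F has_derivative L) (at p) \<longleftrightarrow> (H has_derivative L) (at p)" for L
    using has_derivative_transform_within_open[of F L p UNIV U H]
      has_derivative_transform_within_open[of H L p UNIV U F] assms by auto
  then show ?thesis by (simp add: frechet_derivative_def)
qed

lemma differentiable_transform_open:
  assumes "H differentiable (at p)" "open U" "p \<in> U" and eq: "\<And>q. q \<in> U \<Longrightarrow> F q = H q"
  shows "F differentiable (at p)"
proof -
  have "(F has_derivative D H p) (at p)"
    by (rule has_derivative_transform_within_open[OF has_derivative_D[OF assms(1)] assms(2,3)]) (simp add: eq)
  then show ?thesis unfolding differentiable_def by blast
qed

lemma differentiable_apply_linear:
  fixes B :: "'a::euclidean_space \<Rightarrow> 'c::euclidean_space \<Rightarrow> 'd::euclidean_space"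
  assumes "open S" "p \<in> S" "\<And>q. q \<in> S \<Longrightarrow> linear (B q)"
    and "\<And>e. (\<lambda>q. B q e) differentiable (at p)" "W differentiable (at p)"
  shows "(\<lambda>q. B q (W q)) differentiable (at p)"
  using has_derivative_apply_linear[OF assms] unfolding differentiable_def by blast

lemma differentiable_apply_bilinear:
  fixes B :: "'a::euclidean_space \<Rightarrow> 'c::euclidean_space \<Rightarrow> 'c \<Rightarrow> 'd::euclidean_space"
  assumes S: "open S" "p \<in> S" and B: "\<And>q. q \<in> S \<Longrightarrow> bilinear (B q)"
    and dB: "\<And>v w. (\<lambda>q. B q v w) differentiable (at p)"
    and V: "V differentiable (at p)" and W: "W differentiable (at p)"
  shows "(\<lambda>q. B q (V q) (W q)) differentiable (at p)"
proof (rule differentiable_apply_linear[where B="\<lambda>q v. B q v (W q)", OF S _ _ V])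
  show "linear (\<lambda>v. B q v (W q))" if "q \<in> S" for q using B[OF that] by (simp add: bilinear_def)
  show "(\<lambda>q. B q v (W q)) differentiable (at p)" for v
    by (rule differentiable_apply_linear[where B="\<lambda>q. B q v", OF S _ dB W])
       (use B in \<open>simp add: bilinear_def\<close>)
qed

section \<open>The Gauss formula in a chart\<close>

lemma riemannian_product_cancel:
  assumes B: "riemannian_product B" and eq: "\<And>Z. B V Z = B W Z"
  shows "V = W"
proof (rule ccontr)
  assume "V \<noteq> W"
  then have "B (V - W) (V - W) > 0" using B by (simp add: riemannian_product_def)
  then show False using B eq[of "V - W"]
    by (simp add: riemannian_product_def symmetric_form_def bilinear_lsub)
qed

lemma riemannian_product_injective:
  assumes B: "riemannian_product B"
  shows "linear (\<lambda>W. \<Sum>e\<in>Basis. B W e *\<^sub>R e)" "inj (\<lambda>W. \<Sum>e\<in>Basis. B W e *\<^sub>R e)"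
proof -
  have bil: "bilinear B" using B by (simp add: riemannian_product_def symmetric_form_def)
  then show lin: "linear (\<lambda>W. \<Sum>e\<in>Basis. B W e *\<^sub>R e)"
    by (intro linearI) (simp_all add: bilinear_ladd bilinear_lmul sum.distrib algebra_simps scaleR_sum_right)
  have "W = 0" if W: "(\<Sum>e\<in>Basis. B W e *\<^sub>R e) = 0" for W
  proof (rule riemannian_product_cancel[OF B])
    fix Z
    have l: "linear (B W)" using bil by (simp add: bilinear_def)
    have "B W e = 0" if "e \<in> Basis" for e
      using arg_cong[OF W, of "\<lambda>v. v \<bullet> e"] that by simp
    then show "B W Z = B 0 Z"
      using linear_basis_expansion[OF l, of Z] bil by (simp add: bilinear_lzero)
  qed
  then show "inj (\<lambda>W. \<Sum>e\<in>Basis. B W e *\<^sub>R e)" using linear_injective_0[OF lin] by blast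
qed

lemma riesz_representation:
  assumes B: "riemannian_product B" and c: "linear c"
  shows "\<exists>W. \<forall>Z. B W Z = c Z"
proof -
  have bil: "bilinear B" using B by (simp add: riemannian_product_def symmetric_form_def)
  have "surj (\<lambda>W. \<Sum>e\<in>Basis. B W e *\<^sub>R e)"
    using riemannian_product_injective[OF B] by (rule linear_inj_imp_surj)
  then have "(\<Sum>e\<in>Basis. c e *\<^sub>R e) \<in> range (\<lambda>W. \<Sum>e\<in>Basis. B W e *\<^sub>R e)" by simp
  then obtain W where W: "(\<Sum>e\<in>Basis. c e *\<^sub>R e) = (\<Sum>e\<in>Basis. B W e *\<^sub>R e)" by (rule rangeE)
  have "B W Z = c Z" for Z
  proof -
    have l: "linear (B W)" using bil by (simp add: bilinear_def)
    have "B W e = c e" if "e \<in> Basis" for e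
      using arg_cong[OF W, of "\<lambda>v. v \<bullet> e"] that by simp
    then show ?thesis using linear_basis_expansion[OF l, of Z] linear_basis_expansion[OF c, of Z] by simp
  qed
  then show ?thesis by blast
qed

abbreviation DD :: "('a::real_normed_vector \<Rightarrow> 'b::real_normed_vector) \<Rightarrow> 'a \<Rightarrow> 'a \<Rightarrow> 'a \<Rightarrow> 'b" where
  "DD F p v w \<equiv> D (\<lambda>q. D F q w) p v"

locale metric_chart =
  fixes M :: "'a::euclidean_space set" and m :: "'a \<Rightarrow> 'a form"
  assumes open_M: "open M" and metric: "riemannian_metric M m"
begin

lemma m_riemannian: "p \<in> M \<Longrightarrow> riemannian_product (m p)"
  using metric by (simp add: riemannian_metric_def)

lemma m_bilinear: "p \<in> M \<Longrightarrow> bilinear (m p)"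
  using m_riemannian by (simp add: riemannian_product_def symmetric_form_def)

lemma m_positive: "p \<in> M \<Longrightarrow> v \<noteq> 0 \<Longrightarrow> m p v v > 0"
  using m_riemannian unfolding riemannian_product_def by blast

lemma m_zero: "p \<in> M \<Longrightarrow> m p v v = 0 \<Longrightarrow> v = 0"
  using m_positive by force

lemma m_cancel: "p \<in> M \<Longrightarrow> (\<And>Z. m p V Z = m p W Z) \<Longrightarrow> V = W"
  using riemannian_product_cancel m_riemannian by blast

lemma m_differentiable: "p \<in> M \<Longrightarrow> (\<lambda>q. m q v w) differentiable (at p)"
  using metric smooth_on_differentiable unfolding riemannian_metric_def by blast

text \<open>
  Vector fields given by their products with all vectors, such as the Levi-Civita derivatives of
  constant fields, are differentiable because they solve a linear system with the Gram matrix.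
\<close>

lemma metric_dual_differentiable:
  assumes p: "p \<in> M" and c: "\<And>Z. (\<lambda>q. c q Z) differentiable (at p)"
    and eq: "\<And>q Z. q \<in> M \<Longrightarrow> m q (W q) Z = c q Z"
  shows "W differentiable (at p)"
proof (rule differentiable_linear_solution[OF open_M p])
  show "linear (\<lambda>W. \<Sum>e\<in>Basis. m q W e *\<^sub>R e)" if "q \<in> M" for q
    using riemannian_product_injective m_riemannian[OF that] by blast
  show "inj (\<lambda>W. \<Sum>e\<in>Basis. m p W e *\<^sub>R e)"
    using riemannian_product_injective m_riemannian[OF p] by blast
  show "(\<lambda>q. \<Sum>e\<in>Basis. m q x e *\<^sub>R e) differentiable (at p)" for x
    by (intro differentiable_sum ballI differentiable_scaleR m_differentiable p) auto
  show "(\<lambda>q. \<Sum>e\<in>Basis. c q e *\<^sub>R e) differentiable (at p)"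
    by (intro differentiable_sum ballI differentiable_scaleR c) auto
  show "(\<Sum>e\<in>Basis. m q (W q) e *\<^sub>R e) = (\<Sum>e\<in>Basis. c q e *\<^sub>R e)" if "q \<in> M" for q
    using eq that by simp
qed

end

locale isometric_chart = metric_chart M m
  for M :: "'a::euclidean_space set" and m :: "'a \<Rightarrow> 'a form" +
  fixes h :: "'w::euclidean_space form" and g :: "'a \<Rightarrow> 'w"
  assumes isometric: "isometric_immersion M m h g"
    and h_bilinear: "bounded_bilinear h" and h_commute: "h v w = h w v"
begin

lemmas h_simps =
  bounded_bilinear.add_left[OF h_bilinear] bounded_bilinear.add_right[OF h_bilinear]
  bounded_bilinear.diff_left[OF h_bilinear] bounded_bilinear.diff_right[OF h_bilinear]
  bounded_bilinear.minus_left[OF h_bilinear] bounded_bilinear.minus_right[OF h_bilinear]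
  bounded_bilinear.zero_left[OF h_bilinear] bounded_bilinear.zero_right[OF h_bilinear]
  bounded_bilinear.scaleR_left[OF h_bilinear] bounded_bilinear.scaleR_right[OF h_bilinear]
  bounded_bilinear.sum_left[OF h_bilinear] bounded_bilinear.sum_right[OF h_bilinear]

lemma g_smooth: "smooth_on g M"
  using isometric by (simp add: isometric_immersion_def immersion_on_def)

lemma g_differentiable: "p \<in> M \<Longrightarrow> g differentiable (at p)"
  using g_smooth smooth_on_differentiable by blast

lemma Dg_differentiable: "p \<in> M \<Longrightarrow> (\<lambda>q. D g q v) differentiable (at p)"
  using g_smooth smooth_on_D smooth_on_differentiable by blast

lemma DDg_differentiable: "p \<in> M \<Longrightarrow> (\<lambda>q. DD g q v w) differentiable (at p)"
  using g_smooth smooth_on_D smooth_on_differentiable by blast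

lemma Dg_linear: "p \<in> M \<Longrightarrow> linear (D g p)"
  using g_differentiable linear_frechet_derivative by blast

lemma Dg_inj: "p \<in> M \<Longrightarrow> inj (D g p)"
  using isometric by (simp add: isometric_immersion_def immersion_on_def)

lemma Dg_inject: "p \<in> M \<Longrightarrow> D g p v = D g p w \<longleftrightarrow> v = w"
  using Dg_inj by (meson injD)

lemma m_eq: "p \<in> M \<Longrightarrow> m p v w = h (D g p v) (D g p w)"
  using isometric by (simp add: isometric_immersion_def pullback_def)

lemma DDg_commute: "p \<in> M \<Longrightarrow> DD g p v w = DD g p w v"
  using second_derivative_symmetric[OF open_M _ g_differentiable Dg_differentiable] by blast

lemma DDg_bilinear: "p \<in> M \<Longrightarrow> bilinear (DD g p)"
  using second_derivative_bilinear[OF open_M _ g_differentiable Dg_differentiable] by blast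

lemma h_has_derivative:
  assumes "V differentiable (at p)" "W differentiable (at p)"
  shows "((\<lambda>q. h (V q) (W q)) has_derivative (\<lambda>x. h (V p) (D W p x) + h (D V p x) (W p))) (at p)"
  using bounded_bilinear.FDERIV[OF h_bilinear] has_derivative_D assms by blast

lemma h_differentiable:
  "V differentiable (at p) \<Longrightarrow> W differentiable (at p) \<Longrightarrow> (\<lambda>q. h (V q) (W q)) differentiable (at p)"
  using h_has_derivative differentiable_def by blast

lemma D_metric:
  assumes p: "p \<in> M"
  shows "D (\<lambda>q. m q v w) p x = h (D g p v) (DD g p x w) + h (DD g p x v) (D g p w)"
proof -
  have "((\<lambda>q. h (D g q v) (D g q w)) has_derivative
      (\<lambda>x. h (D g p v) (DD g p x w) + h (DD g p x v) (D g p w))) (at p)"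
    by (rule h_has_derivative[OF Dg_differentiable[OF p] Dg_differentiable[OF p]])
  then have "((\<lambda>q. m q v w) has_derivative
      (\<lambda>x. h (D g p v) (DD g p x w) + h (DD g p x v) (D g p w))) (at p)"
    by (rule has_derivative_transform_within_open[OF _ open_M p]) (simp add: m_eq)
  then show ?thesis using D_eqI by fastforce
qed

lemma linear_h_Dg: "p \<in> M \<Longrightarrow> linear (\<lambda>Z. h v (D g p Z))"
  by (intro linearI) (simp_all add: linear_add[OF Dg_linear] linear_scale[OF Dg_linear] h_simps)

text \<open>
  Koszul's formula expands into six products of first and second derivatives of \<open>g\<close>; by the
  symmetry of the latter four of them cancel and the other two are equal.
\<close>

lemma christoffel_pairing:
  assumes p: "p \<in> M"
  shows "m p (christoffel m p v w) Z = h (DD g p v w) (D g p Z)"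
proof -
  have koszul: "D (\<lambda>q. m q w Z) p v + D (\<lambda>q. m q v Z) p w - D (\<lambda>q. m q v w) p Z
      = 2 * h (DD g p v w) (D g p Z)" for Z
    using p by (simp add: D_metric DDg_commute[of p w v] DDg_commute[of p Z] h_commute[of "D g p _"])
  obtain W where W: "\<And>Z. m p W Z = h (DD g p v w) (D g p Z)"
    using riesz_representation[OF m_riemannian[OF p] linear_h_Dg[OF p]] by blast
  have "christoffel m p v w = W"
    unfolding christoffel_def koszul
    by (rule the_equality) (use W in \<open>auto intro!: m_cancel[OF p]\<close>)
  then show ?thesis using W by simp
qed

lemma normal_part_add_tangent:
  assumes p: "p \<in> M" and n: "\<And>Z. h n (D g p Z) = 0"
  shows "normal_part h g p (D g p x + n) = n"
  unfolding normal_part_def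
proof (rule the_equality)
  show "(\<forall>Z. h n (D g p Z) = 0) \<and> D g p x + n - n \<in> range (D g p)" using n by simp
  fix n' assume n': "(\<forall>Z. h n' (D g p Z) = 0) \<and> D g p x + n - n' \<in> range (D g p)"
  then obtain y where y: "D g p x + n - n' = D g p y" by blast
  have e: "D g p (x - y) = n' - n" by (simp add: linear_diff[OF Dg_linear[OF p]] y[symmetric])
  have "m p (x - y) (x - y) = h (D g p (x - y)) (D g p (x - y))" by (rule m_eq[OF p])
  also have "\<dots> = h (n' - n) (D g p (x - y))" by (simp only: e)
  also have "\<dots> = 0" using n n' by (simp add: h_simps)
  finally have "m p (x - y) (x - y) = 0" .
  then have "x - y = 0" using m_zero p by blast
  then show "n' = n" using e linear_0[OF Dg_linear[OF p]] by simp
qed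

lemma tangent_normal_decomposition:
  assumes p: "p \<in> M"
  shows "\<exists>x. v = D g p x + normal_part h g p v \<and> (\<forall>Z. h (normal_part h g p v) (D g p Z) = 0) \<and>
    (\<forall>Z. m p x Z = h v (D g p Z))"
proof -
  obtain x where x: "\<And>Z. m p x Z = h v (D g p Z)"
    using riesz_representation[OF m_riemannian[OF p] linear_h_Dg[OF p]] by blast
  have n: "h (v - D g p x) (D g p Z) = 0" for Z using x[of Z] m_eq[OF p] by (simp add: h_simps)
  have "normal_part h g p (D g p x + (v - D g p x)) = v - D g p x"
    by (rule normal_part_add_tangent[OF p n])
  then have "normal_part h g p v = v - D g p x" by simp
  then show ?thesis using n x by (intro exI[of _ x]) simp
qed

lemma normal_part_normal: "p \<in> M \<Longrightarrow> h (normal_part h g p v) (D g p Z) = 0"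
  using tangent_normal_decomposition by blast

lemma normal_part_tangent: "p \<in> M \<Longrightarrow> normal_part h g p (D g p x) = 0"
  using normal_part_add_tangent[of p 0 x] by (simp add: h_simps)

lemma normal_part_id: "p \<in> M \<Longrightarrow> (\<And>Z. h n (D g p Z) = 0) \<Longrightarrow> normal_part h g p n = n"
  using normal_part_add_tangent[of p n 0] linear_0[OF Dg_linear] by simp

lemma normal_part_linear:
  assumes p: "p \<in> M" shows "linear (normal_part h g p)"
proof (intro linearI)
  fix v w
  define n where "n = normal_part h g p v"
  define k where "k = normal_part h g p w"
  obtain x where x: "v = D g p x + n" "\<And>Z. h n (D g p Z) = 0"
    using tangent_normal_decomposition[OF p, of v] unfolding n_def by blast
  obtain y where y: "w = D g p y + k" "\<And>Z. h k (D g p Z) = 0"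
    using tangent_normal_decomposition[OF p, of w] unfolding k_def by blast
  have "v + w = D g p (x + y) + (n + k)"
    by (simp add: x(1) y(1) linear_add[OF Dg_linear[OF p]])
  moreover have "normal_part h g p (D g p (x + y) + (n + k)) = n + k"
    by (rule normal_part_add_tangent[OF p]) (simp add: x(2) y(2) h_simps)
  ultimately have "normal_part h g p (v + w) = n + k" by metis
  then show "normal_part h g p (v + w) = normal_part h g p v + normal_part h g p w"
    by (simp only: n_def k_def)
next
  fix c v
  define n where "n = normal_part h g p v"
  obtain x where x: "v = D g p x + n" "\<And>Z. h n (D g p Z) = 0"
    using tangent_normal_decomposition[OF p, of v] unfolding n_def by blast
  have "c *\<^sub>R v = D g p (c *\<^sub>R x) + c *\<^sub>R n"
    by (simp add: x(1) linear_scale[OF Dg_linear[OF p]] scaleR_add_right)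
  moreover have "normal_part h g p (D g p (c *\<^sub>R x) + c *\<^sub>R n) = c *\<^sub>R n"
    by (rule normal_part_add_tangent[OF p]) (simp add: x(2) h_simps)
  ultimately have "normal_part h g p (c *\<^sub>R v) = c *\<^sub>R n" by metis
  then show "normal_part h g p (c *\<^sub>R v) = c *\<^sub>R normal_part h g p v"
    by (simp only: n_def)
qed

text \<open>
  The tangential part depends only on the metric, hence is common to all isometric immersions.
\<close>

lemma gauss_formula:
  assumes p: "p \<in> M"
  shows "DD g p v w = D g p (christoffel m p v w) + second_ff h g p v w"
proof -
  obtain x where x: "DD g p v w = D g p x + normal_part h g p (DD g p v w)"
      "\<And>Z. m p x Z = h (DD g p v w) (D g p Z)"
    using tangent_normal_decomposition[OF p] by blast
  have xc: "christoffel m p v w = x" by (rule m_cancel[OF p]) (simp add: x(2) christoffel_pairing[OF p])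
  show ?thesis unfolding second_ff_def xc by (rule x(1))
qed

lemma second_ff_normal: "p \<in> M \<Longrightarrow> h (second_ff h g p v w) (D g p Z) = 0"
  unfolding second_ff_def by (rule normal_part_normal)

lemma second_ff_commute: "p \<in> M \<Longrightarrow> second_ff h g p v w = second_ff h g p w v"
  unfolding second_ff_def using DDg_commute by metis

lemma second_ff_bilinear: assumes p: "p \<in> M" shows "bilinear (second_ff h g p)"
  using DDg_bilinear[OF p] linear_compose[OF _ normal_part_linear[OF p]]
  unfolding second_ff_def bilinear_def o_def by blast

lemma christoffel_bilinear: assumes p: "p \<in> M" shows "bilinear (christoffel m p)"
proof -
  note l = bilinear_ladd[OF DDg_bilinear[OF p]] bilinear_lmul[OF DDg_bilinear[OF p]]
    bilinear_radd[OF DDg_bilinear[OF p]] bilinear_rmul[OF DDg_bilinear[OF p]]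
    bilinear_ladd[OF m_bilinear[OF p]] bilinear_lmul[OF m_bilinear[OF p]]
  have "linear (christoffel m p v)" for v
    by (intro linearI m_cancel[OF p]) (simp_all add: christoffel_pairing[OF p] l h_simps)
  moreover have "linear (\<lambda>v. christoffel m p v w)" for w
    by (intro linearI m_cancel[OF p]) (simp_all add: christoffel_pairing[OF p] l h_simps)
  ultimately show ?thesis by (simp add: bilinear_def)
qed

lemma christoffel_differentiable:
  "p \<in> M \<Longrightarrow> (\<lambda>q. christoffel m q v w) differentiable (at p)"
  by (rule metric_dual_differentiable[where c="\<lambda>q Z. h (DD g q v w) (D g q Z)"])
     (auto simp: christoffel_pairing intro: h_differentiable DDg_differentiable Dg_differentiable)

lemma D_pushforward:
  assumes p: "p \<in> M" and Y: "Y differentiable (at p)"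
  shows "((\<lambda>q. D g q (Y q)) has_derivative
     (\<lambda>x. D g p (nabla m x Y p) + second_ff h g p x (Y p))) (at p)"
    and "D (\<lambda>q. D g q (Y q)) p x = D g p (nabla m x Y p) + second_ff h g p x (Y p)"
proof -
  have "((\<lambda>q. D g q (Y q)) has_derivative (\<lambda>x. D g p (D Y p x) + DD g p x (Y p))) (at p)"
    by (rule has_derivative_apply_linear[OF open_M p Dg_linear Dg_differentiable[OF p] Y])
  then show *: "((\<lambda>q. D g q (Y q)) has_derivative
     (\<lambda>x. D g p (nabla m x Y p) + second_ff h g p x (Y p))) (at p)"
    by (simp add: gauss_formula[OF p] nabla_def linear_add[OF Dg_linear[OF p]] add.assoc)
  show "D (\<lambda>q. D g q (Y q)) p x = D g p (nabla m x Y p) + second_ff h g p x (Y p)"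
    using D_eqI[OF *] by metis
qed

end

section \<open>The leaf frame and the eigenvalues of the splitting tensor\<close>

text \<open>
  The similarity \<open>P C P\<^sup>-\<^sup>1 = diag c\<close> is applied to the characteristic matrix over the polynomial
  ring, where \<open>P\<close> is regarded as a matrix of constants.
\<close>

lemma char_poly_of_diagonalizable:
  fixes C P Q :: "real^3^3"
  assumes PQ: "P ** Q = mat 1" and PC: "\<And>i j. (P ** C) $ i $ j = c i * P $ i $ j"
  shows "char_poly_of C = (\<Prod>i\<in>UNIV. [:- complex_of_real (c i), 1:])"
proof -
  let ?h = "\<lambda>r. [:complex_of_real r:]" and ?x = "[:0, 1:] :: complex poly"
  define P' Q' :: "complex poly^3^3" where "P' = (\<chi> i j. ?h (P $ i $ j))" and "Q' = (\<chi> i j. ?h (Q $ i $ j))"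
  define A where "A = (\<chi> i j. (if i = j then ?x else 0) - ?h (C $ i $ j) :: complex poly^3^3)"
  define L where "L = (\<chi> i j. if i = j then [:- complex_of_real (c i), 1:] else 0 :: complex poly^3^3)"
  have h: "?h (a + b) = ?h a + ?h b" "?h (a * b) = ?h a * ?h b" for a b by simp_all
  have "P' ** Q' = mat 1"
  proof -
    have "(P' ** Q') $ i $ j = ?h ((P ** Q) $ i $ j)" for i j
      by (simp add: matrix_matrix_mult_def P'_def Q'_def sum_3)
    then show ?thesis unfolding PQ by (simp add: vec_eq_iff mat_def one_pCons)
  qed
  then have "det P' * det Q' = 1" by (metis det_I det_mul)
  then have d: "det P' \<noteq> 0" by auto
  have delta: "(\<Sum>k\<in>UNIV. (if i = k then a else 0) * f k) = a * f i"
    for a :: "complex poly" and f :: "3 \<Rightarrow> complex poly" and i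
    by (simp add: if_distrib[of "\<lambda>y. y * _"] cong: if_cong)
  have PA: "P' ** A = L ** P'"
  proof -
    have "(P' ** A) $ i $ j = (L ** P') $ i $ j" for i j
    proof -
      have "(P' ** A) $ i $ j = (\<Sum>k\<in>UNIV. ?h (P $ i $ k) * (if k = j then ?x else 0))
          - (\<Sum>k\<in>UNIV. ?h (P $ i $ k) * ?h (C $ k $ j))"
        by (simp add: matrix_matrix_mult_def P'_def A_def right_diff_distrib sum_subtractf)
      also have "(\<Sum>k\<in>UNIV. ?h (P $ i $ k) * (if k = j then ?x else 0)) = ?h (P $ i $ j) * ?x"
        by (simp add: if_distrib[of "\<lambda>y. _ * y"] cong: if_cong)
      also have "(\<Sum>k\<in>UNIV. ?h (P $ i $ k) * ?h (C $ k $ j)) = ?h ((P ** C) $ i $ j)"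
        by (simp add: matrix_matrix_mult_def sum_3)
      also have "?h (P $ i $ j) * ?x - ?h ((P ** C) $ i $ j) = [:- complex_of_real (c i), 1:] * ?h (P $ i $ j)"
        unfolding PC by simp
      also have "\<dots> = (\<Sum>k\<in>UNIV. (if i = k then [:- complex_of_real (c i), 1:] else 0) * ?h (P $ k $ j))"
        by (rule delta[symmetric])
      also have "\<dots> = (L ** P') $ i $ j" by (simp add: matrix_matrix_mult_def P'_def L_def)
      finally show ?thesis .
    qed
    then show ?thesis by (simp add: vec_eq_iff)
  qed
  have "det P' * det A = det L * det P'" using PA by (metis det_mul)
  then have "det A = det L" using d by simp
  also have "det L = (\<Prod>i\<in>UNIV. L $ i $ i)" by (rule det_diagonal) (simp add: L_def)
  finally show ?thesis by (simp add: char_poly_of_def A_def L_def)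
qed

lemma rsquarefree_prod_roots_inj:
  fixes c :: "'i::finite \<Rightarrow> real"
  assumes "rsquarefree (\<Prod>i\<in>UNIV. [:- complex_of_real (c i), 1:])"
  shows "inj c"
proof (rule injI, rule ccontr)
  fix i j assume eq: "c i = c j" and ij: "i \<noteq> j"
  let ?l = "\<lambda>i. [:- complex_of_real (c i), 1:]"
  have "prod ?l UNIV = ?l i * prod ?l (UNIV - {i})" by (rule prod.remove) auto
  also have "prod ?l (UNIV - {i}) = ?l j * prod ?l (UNIV - {i} - {j})"
    using ij by (intro prod.remove) auto
  finally have *: "prod ?l UNIV = ?l i * (?l j * prod ?l (UNIV - {i} - {j}))" .
  have "(?l i) ^ 2 dvd prod ?l UNIV"
    by (rule dvdI[of _ _ "prod ?l (UNIV - {i} - {j})"]) (simp only: * eq power2_eq_square mult.assoc)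
  then have "prod ?l UNIV = 0 \<or> 2 \<le> order (of_real (c i)) (prod ?l UNIV)" by (simp only: order_divides)
  moreover have "prod ?l UNIV \<noteq> 0" by simp
  ultimately have "2 \<le> order (of_real (c i)) (prod ?l UNIV)" by blast
  moreover have "order (of_real (c i)) (prod ?l UNIV) = 0 \<or> order (of_real (c i)) (prod ?l UNIV) = 1"
    using assms unfolding rsquarefree_def by blast
  ultimately show False by linarith
qed

locale leaf_frame = metric_chart M m
  for M :: "'a::euclidean_space set" and m :: "'a \<Rightarrow> 'a form" +
  fixes u :: "'a \<Rightarrow> real^3" and X :: "3 \<Rightarrow> 'a \<Rightarrow> 'a"
  assumes leaf: "leaf_chart M m u" and frame: "conjugate_frame M m u X"
    and generic: "generic_nullity M m"
begin

abbreviation du :: "'a \<Rightarrow> 'a \<Rightarrow> 3 \<Rightarrow> real" where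
  "du p v k \<equiv> D u p v $ k"

lemma u_smooth: "smooth_on u M"
  using leaf by (simp add: leaf_chart_def)

lemma u_differentiable: "p \<in> M \<Longrightarrow> u differentiable (at p)"
  by (rule smooth_on_differentiable[OF u_smooth])

lemma Du_differentiable: "p \<in> M \<Longrightarrow> (\<lambda>q. D u q v) differentiable (at p)"
  by (rule smooth_on_differentiable[OF smooth_on_D[OF u_smooth]])

lemma DDu_differentiable: "p \<in> M \<Longrightarrow> (\<lambda>q. DD u q v w) differentiable (at p)"
  by (rule smooth_on_differentiable[OF smooth_on_D[OF smooth_on_D[OF u_smooth]]])

lemma Du_linear: "p \<in> M \<Longrightarrow> linear (D u p)"
  using u_differentiable linear_frechet_derivative by blast

lemmas Du_simps = linear_add[OF Du_linear] linear_scale[OF Du_linear] linear_diff[OF Du_linear]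
  linear_sum[OF Du_linear] linear_0[OF Du_linear]

lemma DDu_commute: "p \<in> M \<Longrightarrow> DD u p v w = DD u p w v"
  using second_derivative_symmetric[OF open_M _ u_differentiable Du_differentiable] by blast

lemma DDu_bilinear: "p \<in> M \<Longrightarrow> bilinear (DD u p)"
  using second_derivative_bilinear[OF open_M _ u_differentiable Du_differentiable] by blast

lemma X_differentiable: "p \<in> M \<Longrightarrow> X i differentiable (at p)"
  using frame smooth_on_differentiable unfolding conjugate_frame_def by blast

lemma Du_X: "p \<in> M \<Longrightarrow> D u p (X i p) = axis i 1"
  using frame unfolding conjugate_frame_def by blast

lemma du_X: "p \<in> M \<Longrightarrow> du p (X i p) k = (if k = i then 1 else 0)"
  by (simp add: Du_X axis_def)

lemma X_conullity: "p \<in> M \<Longrightarrow> X i p \<in> conullity m p"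
  using frame unfolding conjugate_frame_def by blast

lemma nullity_iff: "p \<in> M \<Longrightarrow> v \<in> nullity m p \<longleftrightarrow> D u p v = 0"
  using leaf unfolding leaf_chart_def by blast

lemma conullity_combination: "p \<in> M \<Longrightarrow> (\<Sum>k\<in>UNIV. c k *\<^sub>R X k p) \<in> conullity m p"
  using X_conullity
  by (simp add: conullity_def bilinear_ladd[OF m_bilinear] bilinear_lmul[OF m_bilinear] sum_3)

lemma Du_combination: "p \<in> M \<Longrightarrow> D u p (\<Sum>k\<in>UNIV. c k *\<^sub>R X k p) = (\<chi> k. c k)"
  by (simp add: Du_simps du_X vec_eq_iff if_distrib[of "\<lambda>y. _ * y"] cong: if_cong)

lemma frame_decomposition:
  "p \<in> M \<Longrightarrow> v - (\<Sum>k\<in>UNIV. du p v k *\<^sub>R X k p) \<in> nullity m p"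
  by (simp add: nullity_iff linear_diff[OF Du_linear] Du_combination vec_eq_iff)

lemma conullity_expansion:
  assumes p: "p \<in> M" and v: "v \<in> conullity m p"
  shows "v = (\<Sum>k\<in>UNIV. du p v k *\<^sub>R X k p)"
proof -
  let ?w = "\<Sum>k\<in>UNIV. du p v k *\<^sub>R X k p"
  have "m p (v - ?w) (v - ?w) = m p v (v - ?w) - m p ?w (v - ?w)"
    by (rule bilinear_lsub[OF m_bilinear[OF p]])
  also have "\<dots> = 0" using v conullity_combination[OF p] frame_decomposition[OF p, of v]
    by (simp add: conullity_def)
  finally show ?thesis using m_zero[OF p] by force
qed

lemma conullity_part_eq:
  assumes p: "p \<in> M"
  shows "conullity_part m p v = (\<Sum>k\<in>UNIV. du p v k *\<^sub>R X k p)"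
  unfolding conullity_part_def
proof (rule the_equality)
  show "(\<Sum>k\<in>UNIV. du p v k *\<^sub>R X k p) \<in> conullity m p \<and>
      v - (\<Sum>k\<in>UNIV. du p v k *\<^sub>R X k p) \<in> nullity m p"
    using conullity_combination[OF p] frame_decomposition[OF p] by blast
  fix w assume w: "w \<in> conullity m p \<and> v - w \<in> nullity m p"
  then have "D u p w = D u p v" using nullity_iff[OF p] linear_diff[OF Du_linear[OF p]] by simp
  then show "w = (\<Sum>k\<in>UNIV. du p v k *\<^sub>R X k p)" using conullity_expansion[OF p] w by metis
qed

end

text \<open>
  As the nullity is the kernel of \<open>D u\<close>, the second fundamental form of such an immersion is a form
  on the tangent spaces of the leaf space.  The hypersurface belongs to this class because its
  Gauss map is constant along the leaves.
\<close>

locale null_immersion = leaf_frame M m u X + isometric_chart M m h g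
  for M :: "'a::euclidean_space set" and m u X and h :: "'w::euclidean_space form" and g +
  assumes second_ff_nullity: "p \<in> M \<Longrightarrow> T \<in> nullity m p \<Longrightarrow> second_ff h g p v T = 0"
begin

lemma second_ff_frame:
  assumes p: "p \<in> M"
  shows "second_ff h g p v w = (\<Sum>k\<in>UNIV. du p w k *\<^sub>R second_ff h g p v (X k p))"
proof -
  let ?w = "\<Sum>k\<in>UNIV. du p w k *\<^sub>R X k p"
  have l: "linear (second_ff h g p v)" using second_ff_bilinear[OF p] by (simp add: bilinear_def)
  have "second_ff h g p v (w - ?w) = 0"
    by (rule second_ff_nullity[OF p frame_decomposition[OF p]])
  then have "second_ff h g p v w = second_ff h g p v ?w" by (simp add: linear_diff[OF l])
  then show ?thesis by (simp add: linear_sum[OF l] linear_scale[OF l])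
qed

text \<open>
  For a section \<open>T\<close> of the nullity the field \<open>g\<^sub>* T\<close> has tangent derivatives, namely the images
  of the \<open>\<nabla>\<^sub>y T\<close>.  The identity below is the normal part of the symmetry of its second derivative.
\<close>

lemma splitting_symmetric:
  assumes U: "open U" "p \<in> U" "U \<subseteq> M" and T: "nullity_section m U T"
  shows "second_ff h g p x (nabla m y T p) = second_ff h g p y (nabla m x T p)"
proof -
  have p: "p \<in> M" using U by blast
  have Td: "T differentiable (at q)" "(\<lambda>q. D T q v) differentiable (at q)" if "q \<in> U" for q v
    using T that smooth_on_differentiable smooth_on_D unfolding nullity_section_def by blast+
  have nd: "(\<lambda>q. nabla m y T q) differentiable (at p)" for y
  proof -
    have "(\<lambda>q. christoffel m q y (T q)) differentiable (at p)"
      by (rule differentiable_apply_linear[where B="\<lambda>q. christoffel m q y", OF open_M p _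
            christoffel_differentiable[OF p] Td(1)[OF U(2)]])
         (use christoffel_bilinear in \<open>simp add: bilinear_def\<close>)
    then show ?thesis unfolding nabla_def by (intro differentiable_add Td(2)[OF U(2)])
  qed
  define V where "V q = D g q (T q)" for q
  have Vd: "(V has_derivative (\<lambda>x. D g q (nabla m x T q))) (at q)" if q: "q \<in> U" for q
  proof -
    have "q \<in> M" "T q \<in> nullity m q" using q U T by (auto simp: nullity_section_def)
    then show ?thesis using D_pushforward(1)[of q T] Td(1)[OF q] second_ff_nullity unfolding V_def by simp
  qed
  then have DV: "D V q y = D g q (nabla m y T q)" if "q \<in> U" for q y
    using D_eqI[OF Vd[OF that]] by simp
  have DDV: "DD V p x y = D g p (nabla m x (nabla m y T) p) + second_ff h g p x (nabla m y T p)" for x y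
  proof -
    have "DD V p x y = D (\<lambda>q. D g q (nabla m y T q)) p x"
      using D_cong[OF U(1,2), of "\<lambda>q. D V q y" "\<lambda>q. D g q (nabla m y T q)"] DV by simp
    then show ?thesis using D_pushforward(2)[OF p nd] by simp
  qed
  have "DD V p x y = DD V p y x"
  proof (rule second_derivative_symmetric[OF U(1,2)])
    show "V differentiable (at q)" if "q \<in> U" for q using Vd[OF that] differentiable_def by blast
    show "(\<lambda>q. D V q v) differentiable (at p)" for v
      by (rule differentiable_transform_open[OF _ U(1,2) DV])
         (rule differentiable_apply_linear[OF open_M p Dg_linear Dg_differentiable[OF p] nd])
  qed
  then have "normal_part h g p (DD V p x y) = normal_part h g p (DD V p y x)" by simp
  then show ?thesis unfolding DDV using normal_part_add_tangent[OF p second_ff_normal[OF p]] by simp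
qed

text \<open>
  By \<open>splitting_symmetric\<close> a splitting tensor is self-adjoint for the second fundamental form, so its
  eigenvectors for different eigenvalues are conjugate; generic nullity provides, at each point, one
  with three different eigenvalues.
\<close>

lemma frame_conjugate:
  assumes p: "p \<in> M" and ij: "i \<noteq> j"
  shows "second_ff h g p (X i p) (X j p) = 0"
proof -
  obtain U T c where U: "open U" "p \<in> U" "U \<subseteq> M" and T: "nullity_section m U T"
    and c: "is_char_poly (conullity m p) (splitting m T p) c" "rsquarefree c"
    using bspec[OF generic[unfolded generic_nullity_def] p] by blast
  have "\<exists>c. splitting m T p (X i p) = c *\<^sub>R X i p" for i
    using frame p U T unfolding conjugate_frame_def by blast
  then obtain e where e: "\<And>i. splitting m T p (X i p) = e i *\<^sub>R X i p" by metis
  have spl: "splitting m T p x = - (\<Sum>k\<in>UNIV. du p (nabla m x T p) k *\<^sub>R X k p)" for x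
    by (simp add: splitting_def conullity_part_eq[OF p])
  have Dspl: "D u p (splitting m T p x) = - D u p (nabla m x T p)" for x
    unfolding spl linear_neg[OF Du_linear[OF p]] Du_combination[OF p] by (simp add: vec_eq_iff)
  have linN: "linear (\<lambda>x. nabla m x T p)"
  proof -
    have "T differentiable (at p)"
      using T U(2) smooth_on_differentiable unfolding nullity_section_def by blast
    then show ?thesis unfolding nabla_def using christoffel_bilinear[OF p]
      by (intro linear_compose_add linear_frechet_derivative) (auto simp: bilinear_def)
  qed
  have eig: "du p (nabla m (X i p) T p) k = (if k = i then - e i else 0)" for i k
  proof -
    have "- D u p (nabla m (X i p) T p) = e i *\<^sub>R axis i 1"
      using Dspl[of "X i p"] unfolding e by (simp add: linear_scale[OF Du_linear[OF p]] Du_X[OF p])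
    from arg_cong[OF this, of "\<lambda>v. v $ k"]
    have "- du p (nabla m (X i p) T p) k = (e i *\<^sub>R axis i 1) $ k" by (simp only: vector_uminus_component)
    then show ?thesis by (auto simp: axis_def)
  qed
  obtain b C where b: "basis_of b (conullity m p)"
    and C: "\<And>j. splitting m T p (b j) = (\<Sum>i\<in>UNIV. C $ i $ j *\<^sub>R b i)" and cC: "c = char_poly_of C"
    using c(1) unfolding is_char_poly_def by blast
  have bc: "b j \<in> conullity m p" for j
    using b span_base[of "b j" "range b"] unfolding basis_of_def by auto
  define P :: "real^3^3" where "P = (\<chi> k j. du p (b j) k)"
  have "\<exists>q. X k p = (\<Sum>j\<in>UNIV. q j *\<^sub>R b j)" for k
  proof -
    have "X k p \<in> span (range b)" using X_conullity[OF p] b by (simp add: basis_of_def)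
    then obtain r where "X k p = (\<Sum>v\<in>range b. r v *\<^sub>R v)"
      by (auto simp: span_finite)
    also have "\<dots> = (\<Sum>j\<in>UNIV. r (b j) *\<^sub>R b j)"
      using b by (simp add: basis_of_def sum.reindex)
    finally show ?thesis by (rule exI[of _ "\<lambda>j. r (b j)"])
  qed
  then obtain q where q: "\<And>k. X k p = (\<Sum>j\<in>UNIV. q k j *\<^sub>R b j)" by metis
  have "P ** (\<chi> j k. q k j) = mat 1"
  proof -
    have "(P ** (\<chi> j k. q k j)) $ i $ k = du p (\<Sum>j\<in>UNIV. q k j *\<^sub>R b j) i" for i k
      by (simp add: matrix_matrix_mult_def P_def linear_sum[OF Du_linear[OF p]] linear_scale[OF Du_linear[OF p]] mult.commute)
    then show ?thesis unfolding q[symmetric] du_X[OF p] by (simp add: vec_eq_iff mat_def)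
  qed
  moreover have "(P ** C) $ k $ j = e k * P $ k $ j" for k j
  proof -
    have "(P ** C) $ k $ j = du p (splitting m T p (b j)) k"
      unfolding C by (simp add: matrix_matrix_mult_def P_def linear_sum[OF Du_linear[OF p]] linear_scale[OF Du_linear[OF p]] mult.commute)
    also have "\<dots> = - du p (nabla m (b j) T p) k" unfolding Dspl by simp
    also have "nabla m (b j) T p = (\<Sum>i\<in>UNIV. P $ i $ j *\<^sub>R nabla m (X i p) T p)"
    proof -
      have "nabla m (b j) T p = nabla m (\<Sum>i\<in>UNIV. du p (b j) i *\<^sub>R X i p) T p"
        using conullity_expansion[OF p bc] by metis
      then show ?thesis by (simp add: linear_sum[OF linN] linear_scale[OF linN] P_def)
    qed
    also have "- du p (\<Sum>i\<in>UNIV. P $ i $ j *\<^sub>R nabla m (X i p) T p) k = e k * P $ k $ j"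
      by (simp add: linear_sum[OF Du_linear[OF p]] linear_scale[OF Du_linear[OF p]] eig
            if_distrib[of "\<lambda>y. _ * y"] cong: if_cong)
    finally show ?thesis .
  qed
  ultimately have "char_poly_of C = (\<Prod>i\<in>UNIV. [:- complex_of_real (e i), 1:])"
    by (rule char_poly_of_diagonalizable)
  then have "inj e" using c(2) cC rsquarefree_prod_roots_inj by metis
  then have eij: "e i \<noteq> e j" using ij by (auto dest: injD)
  have val: "second_ff h g p v (nabla m (X i p) T p) = - e i *\<^sub>R second_ff h g p v (X i p)" for v i
    by (subst second_ff_frame[OF p]) (simp add: eig if_distrib[of "\<lambda>y. y *\<^sub>R _"] cong: if_cong)
  have "e j *\<^sub>R second_ff h g p (X i p) (X j p) = e i *\<^sub>R second_ff h g p (X i p) (X j p)"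
    using splitting_symmetric[OF U T, of "X i p" "X j p"]
    unfolding val second_ff_commute[OF p, of "X j p" "X i p"] by simp
  then show ?thesis using eij by simp
qed

definition beta :: "3 \<Rightarrow> 'a \<Rightarrow> 'w" where
  "beta k q = second_ff h g q (X k q) (X k q)"

lemma second_ff_diagonal:
  assumes p: "p \<in> M"
  shows "second_ff h g p v w = (\<Sum>k\<in>UNIV. (du p v k * du p w k) *\<^sub>R beta k p)"
proof -
  have "second_ff h g p v (X k p) = du p v k *\<^sub>R beta k p" for k
  proof -
    have "second_ff h g p v (X k p) = (\<Sum>j\<in>UNIV. du p v j *\<^sub>R second_ff h g p (X k p) (X j p))"
      using second_ff_frame[OF p, of "X k p" v] second_ff_commute[OF p] by simp
    also have "\<dots> = (\<Sum>j\<in>UNIV. if j = k then du p v k *\<^sub>R beta k p else 0)"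
      by (rule sum.cong) (auto simp: frame_conjugate[OF p] beta_def)
    finally show ?thesis by simp
  qed
  then show ?thesis by (subst second_ff_frame[OF p]) (simp add: mult.commute)
qed

lemma beta_normal: "p \<in> M \<Longrightarrow> h (beta k p) (D g p Z) = 0"
  unfolding beta_def by (rule second_ff_normal)

lemma beta_differentiable: assumes p: "p \<in> M" shows "beta k differentiable (at p)"
proof (rule differentiable_transform_open[OF _ open_M p])
  show "beta k q = DD g q (X k q) (X k q) - D g q (christoffel m q (X k q) (X k q))" if "q \<in> M" for q
    using gauss_formula[OF that] by (simp add: beta_def)
  have "(\<lambda>q. DD g q (X k q) (X k q)) differentiable (at p)"
    by (rule differentiable_apply_bilinear[where B="DD g", OF open_M p DDg_bilinear
          DDg_differentiable[OF p] X_differentiable[OF p] X_differentiable[OF p]])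
  moreover have *: "(\<lambda>q. christoffel m q (X k q) (X k q)) differentiable (at p)"
    by (rule differentiable_apply_bilinear[where B="christoffel m", OF open_M p christoffel_bilinear
          christoffel_differentiable[OF p] X_differentiable[OF p] X_differentiable[OF p]])
  have "(\<lambda>q. D g q (christoffel m q (X k q) (X k q))) differentiable (at p)"
    by (rule differentiable_apply_linear[where B="D g", OF open_M p Dg_linear Dg_differentiable[OF p] *])
  ultimately show "(\<lambda>q. DD g q (X k q) (X k q) - D g q (christoffel m q (X k q) (X k q))) differentiable (at p)"
    by simp
qed

end

section \<open>The Codazzi equation\<close>

context leaf_frame
begin

text \<open>The Hessian of the \<open>k\<close>-th leaf coordinate.\<close>

definition hess :: "3 \<Rightarrow> 'a \<Rightarrow> 'a \<Rightarrow> 'a \<Rightarrow> real" where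
  "hess k p x w = (DD u p x w - D u p (christoffel m p x w)) $ k"

end

context null_immersion
begin

lemma hess_bilinear: assumes p: "p \<in> M" shows "bilinear (hess k p)"
proof -
  note l = bilinear_ladd[OF DDu_bilinear[OF p]] bilinear_lmul[OF DDu_bilinear[OF p]]
    bilinear_radd[OF DDu_bilinear[OF p]] bilinear_rmul[OF DDu_bilinear[OF p]]
    bilinear_ladd[OF christoffel_bilinear[OF p]] bilinear_lmul[OF christoffel_bilinear[OF p]]
    bilinear_radd[OF christoffel_bilinear[OF p]] bilinear_rmul[OF christoffel_bilinear[OF p]]
  show ?thesis unfolding bilinear_def hess_def
    by (auto intro!: linearI simp: l linear_add[OF Du_linear[OF p]] linear_scale[OF Du_linear[OF p]] algebra_simps)
qed

lemma hess_differentiable: assumes p: "p \<in> M" shows "(\<lambda>q. hess k q x w) differentiable (at p)"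
proof -
  have "(\<lambda>q. D u q (christoffel m q x w)) differentiable (at p)"
    by (rule differentiable_apply_linear[where B="D u", OF open_M p Du_linear Du_differentiable[OF p]
          christoffel_differentiable[OF p]])
  then have "(\<lambda>q. DD u q x w - D u q (christoffel m q x w)) differentiable (at p)"
    using DDu_differentiable[OF p] by simp
  then have "(\<lambda>q. (DD u q x w - D u q (christoffel m q x w)) \<bullet> axis k 1) differentiable (at p)"
    by (intro differentiable_inner) auto
  then show ?thesis by (simp add: hess_def cart_eq_inner_axis)
qed

lemma D_second_ff:
  assumes p: "p \<in> M"
  shows "((\<lambda>q. second_ff h g q v w) has_derivative (\<lambda>x. \<Sum>k\<in>UNIV.
     (DD u p x v $ k * du p w k + du p v k * DD u p x w $ k) *\<^sub>R beta k p
       + (du p v k * du p w k) *\<^sub>R D (beta k) p x)) (at p)"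
proof -
  have dk: "((\<lambda>q. du q v k) has_derivative (\<lambda>x. DD u p x v $ k)) (at p)" for v k
    by (rule bounded_linear.has_derivative[OF bounded_linear_vec_nth has_derivative_D[OF Du_differentiable[OF p]]])
  have "((\<lambda>q. \<Sum>k\<in>UNIV. (du q v k * du q w k) *\<^sub>R beta k q) has_derivative (\<lambda>x. \<Sum>k\<in>UNIV.
     (du p v k * du p w k) *\<^sub>R D (beta k) p x
     + (du p v k * DD u p x w $ k + DD u p x v $ k * du p w k) *\<^sub>R beta k p)) (at p)"
    by (intro has_derivative_sum has_derivative_scaleR has_derivative_mult dk has_derivative_D beta_differentiable[OF p])
  then have "((\<lambda>q. second_ff h g q v w) has_derivative (\<lambda>x. \<Sum>k\<in>UNIV.
     (du p v k * du p w k) *\<^sub>R D (beta k) p x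
     + (du p v k * DD u p x w $ k + DD u p x v $ k * du p w k) *\<^sub>R beta k p)) (at p)"
    by (rule has_derivative_transform_within_open[OF _ open_M p]) (simp add: second_ff_diagonal)
  then show ?thesis by (simp add: add.commute)
qed

text \<open>
  The Codazzi equation is the normal part of the symmetry in \<open>x\<close> and \<open>v\<close> of the third derivative
  of \<open>g\<close>.  Since the second fundamental form is diagonal in the differentials of the leaf
  coordinates, the Christoffel terms combine with the second derivatives of the coordinates
  to their Hessians.
\<close>

lemma codazzi:
  assumes p: "p \<in> M"
  shows "(\<Sum>k\<in>UNIV. du p v k *\<^sub>R (hess k p x w *\<^sub>R beta k p + du p w k *\<^sub>R normal_part h g p (D (beta k) p x)))
       = (\<Sum>k\<in>UNIV. du p x k *\<^sub>R (hess k p v w *\<^sub>R beta k p + du p w k *\<^sub>R normal_part h g p (D (beta k) p v)))"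
proof -
  note nl = normal_part_linear[OF p]
  define T where "T x v = (\<Sum>k\<in>UNIV. du p v k *\<^sub>R (hess k p x w *\<^sub>R beta k p
      + du p w k *\<^sub>R normal_part h g p (D (beta k) p x)))" for x v
  define R where "R x v = (\<Sum>k\<in>UNIV. (du p x k * D u p (christoffel m p v w) $ k + DD u p x v $ k * du p w k
      + du p v k * D u p (christoffel m p x w) $ k) *\<^sub>R beta k p)" for x v
  have normal: "normal_part h g p (D (\<lambda>q. DD g q v w) p x) = T x v + R x v" for x v
  proof -
    have "((\<lambda>q. D g q (christoffel m q v w) + second_ff h g q v w) has_derivative
       (\<lambda>x. (D g p (nabla m x (\<lambda>q. christoffel m q v w) p) + second_ff h g p x (christoffel m p v w))
        + (\<Sum>k\<in>UNIV. (DD u p x v $ k * du p w k + du p v k * DD u p x w $ k) *\<^sub>R beta k p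
            + (du p v k * du p w k) *\<^sub>R D (beta k) p x))) (at p)"
      by (intro has_derivative_add D_pushforward(1)[OF p christoffel_differentiable[OF p]] D_second_ff[OF p])
    then have "((\<lambda>q. DD g q v w) has_derivative
       (\<lambda>x. (D g p (nabla m x (\<lambda>q. christoffel m q v w) p) + second_ff h g p x (christoffel m p v w))
        + (\<Sum>k\<in>UNIV. (DD u p x v $ k * du p w k + du p v k * DD u p x w $ k) *\<^sub>R beta k p
            + (du p v k * du p w k) *\<^sub>R D (beta k) p x))) (at p)"
      by (rule has_derivative_transform_within_open[OF _ open_M p]) (simp add: gauss_formula)
    from D_eqI[OF this] have "D (\<lambda>q. DD g q v w) p x
      = (D g p (nabla m x (\<lambda>q. christoffel m q v w) p) + second_ff h g p x (christoffel m p v w))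
        + (\<Sum>k\<in>UNIV. (DD u p x v $ k * du p w k + du p v k * DD u p x w $ k) *\<^sub>R beta k p
            + (du p v k * du p w k) *\<^sub>R D (beta k) p x)" by simp
    then have "normal_part h g p (D (\<lambda>q. DD g q v w) p x)
      = (\<Sum>k\<in>UNIV. (du p x k * D u p (christoffel m p v w) $ k) *\<^sub>R beta k p)
        + (\<Sum>k\<in>UNIV. (DD u p x v $ k * du p w k + du p v k * DD u p x w $ k) *\<^sub>R beta k p
            + (du p v k * du p w k) *\<^sub>R normal_part h g p (D (beta k) p x))"
      by (simp add: linear_add[OF nl] linear_sum[OF nl] linear_scale[OF nl] normal_part_tangent[OF p]
            normal_part_id[OF p second_ff_normal[OF p]] normal_part_id[OF p beta_normal[OF p]]
            second_ff_diagonal[OF p, of x])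
    also have "\<dots> = T x v + R x v"
      unfolding T_def R_def sum.distrib[symmetric]
      by (rule sum.cong) (simp_all add: hess_def algebra_simps)
    finally show ?thesis .
  qed
  have "D (\<lambda>q. DD g q v w) p x = D (\<lambda>q. DD g q x w) p v"
    by (rule second_derivative_symmetric[OF open_M p Dg_differentiable DDg_differentiable[OF p]])
  then have "T x v + R x v = T v x + R v x" using normal by metis
  moreover have "R x v = R v x"
    unfolding R_def by (rule sum.cong) (simp_all add: DDu_commute[OF p, of x v] algebra_simps)
  ultimately show ?thesis by (simp add: T_def)
qed

end

section \<open>The hypersurface and its Gauss map\<close>

locale hypersurface = leaf_frame M m u X + f: isometric_chart M m inner f
  for M :: "'a::euclidean_space set" and m u X and f :: "'a \<Rightarrow> 'a \<times> real" +
  fixes N :: "'a \<Rightarrow> 'a \<times> real" and \<nu> :: "real^3 \<Rightarrow> 'a \<times> real"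
  assumes gauss: "gauss_map M f N" and descended: "descended_gauss_map M u N \<nu>"
begin

lemma N_smooth: "smooth_on N M" and N_normal: "p \<in> M \<Longrightarrow> N p \<bullet> D f p Z = 0"
  and N_unit: "p \<in> M \<Longrightarrow> N p \<bullet> N p = 1"
  using gauss by (auto simp: gauss_map_def norm_eq_1)

lemma N_differentiable: "p \<in> M \<Longrightarrow> N differentiable (at p)"
  by (rule smooth_on_differentiable[OF N_smooth])

lemma DN_differentiable: "p \<in> M \<Longrightarrow> (\<lambda>q. D N q v) differentiable (at p)"
  by (rule smooth_on_differentiable[OF smooth_on_D[OF N_smooth]])

lemma nu_differentiable: "p \<in> M \<Longrightarrow> \<nu> differentiable (at (u p))"
  and Dnu_differentiable: "p \<in> M \<Longrightarrow> (\<lambda>y. D \<nu> y v) differentiable (at (u p))"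
  and Dnu_inj: "p \<in> M \<Longrightarrow> inj (D \<nu> (u p))"
proof -
  have nu: "smooth_on \<nu> (u ` M)" "\<And>y. y \<in> u ` M \<Longrightarrow> inj (D \<nu> y)"
    using descended by (auto simp: descended_gauss_map_def immersion_on_def)
  show "p \<in> M \<Longrightarrow> \<nu> differentiable (at (u p))" by (rule smooth_on_differentiable[OF nu(1)]) simp
  show "p \<in> M \<Longrightarrow> (\<lambda>y. D \<nu> y v) differentiable (at (u p))"
    by (rule smooth_on_differentiable[OF smooth_on_D[OF nu(1)]]) simp
  show "p \<in> M \<Longrightarrow> inj (D \<nu> (u p))" using nu(2) by simp
qed

lemma Dnu_linear: "p \<in> M \<Longrightarrow> linear (D \<nu> (u p))"
  using nu_differentiable linear_frechet_derivative by blast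

lemma tangent_plus_normal:
  assumes p: "p \<in> M"
  shows "\<exists>x c. v = D f p x + c *\<^sub>R N p"
proof -
  define P where "P z = D f p (fst z) + snd z *\<^sub>R N p" for z :: "'a \<times> real"
  have lin: "linear P" unfolding P_def
    by (intro linearI) (simp_all add: linear_add[OF f.Dg_linear[OF p]] linear_scale[OF f.Dg_linear[OF p]] algebra_simps)
  have "z = 0" if z: "P z = 0" for z
  proof -
    have "N p \<bullet> P z = snd z" by (simp add: P_def inner_add_right N_normal[OF p] N_unit[OF p])
    then have s: "snd z = 0" using z by simp
    then have "D f p (fst z) = D f p 0" using z linear_0[OF f.Dg_linear[OF p]] by (simp add: P_def)
    then have "fst z = 0" using f.Dg_inject[OF p] by blast
    then show ?thesis using s by (simp add: prod_eq_iff)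
  qed
  then have "inj P" using linear_injective_0[OF lin] by blast
  then have "surj P" using lin linear_inj_imp_surj by blast
  then obtain z where "v = P z" unfolding surj_def by blast
  then show ?thesis unfolding P_def by blast
qed

lemma DN_orthogonal_N:
  assumes p: "p \<in> M" shows "N p \<bullet> D N p x = 0"
proof -
  have "((\<lambda>q. N q \<bullet> N q) has_derivative (\<lambda>x. N p \<bullet> D N p x + D N p x \<bullet> N p)) (at p)"
    by (rule f.h_has_derivative[OF N_differentiable[OF p] N_differentiable[OF p]])
  then have "((\<lambda>q. 1) has_derivative (\<lambda>x. N p \<bullet> D N p x + D N p x \<bullet> N p)) (at p)"
    by (rule has_derivative_transform_within_open[OF _ open_M p]) (simp add: N_unit)
  from D_eqI[OF this] have "(\<lambda>x. N p \<bullet> D N p x + D N p x \<bullet> N p) = (\<lambda>x. 0)" by simp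
  from fun_cong[OF this, of x] show ?thesis by (simp add: inner_commute)
qed

lemma shape_operator:
  assumes p: "p \<in> M" shows "D f p (shape_operator f N p x) = - D N p x"
proof -
  obtain w c where w: "- D N p x = D f p w + c *\<^sub>R N p" using tangent_plus_normal[OF p] by blast
  have "N p \<bullet> (- D N p x) = c" unfolding w by (simp add: inner_add_right N_normal[OF p] N_unit[OF p])
  then have "c = 0" using DN_orthogonal_N[OF p] by simp
  then have w: "D f p w = - D N p x" using w by simp
  have "shape_operator f N p x = w" unfolding shape_operator_def
  proof (rule the_equality)
    show "D f p w = - D N p x" by (rule w)
    show "w' = w" if "D f p w' = - D N p x" for w' using that w f.Dg_inject[OF p] by metis
  qed
  then show ?thesis using w by simp
qed

lemma DN_orthogonal_normal:
  "p \<in> M \<Longrightarrow> (\<And>Z. n \<bullet> D f p Z = 0) \<Longrightarrow> D N p x \<bullet> n = 0"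
  using shape_operator[of p x] by (metis inner_commute inner_minus_left neg_equal_0_iff_equal)

lemma weingarten:
  assumes p: "p \<in> M" shows "N p \<bullet> second_ff inner f p x w = - (D N p x \<bullet> D f p w)"
proof -
  have "((\<lambda>q. N q \<bullet> D f q w) has_derivative (\<lambda>x. N p \<bullet> DD f p x w + D N p x \<bullet> D f p w)) (at p)"
    by (rule f.h_has_derivative[OF N_differentiable[OF p] f.Dg_differentiable[OF p]])
  then have "((\<lambda>q. 0) has_derivative (\<lambda>x. N p \<bullet> DD f p x w + D N p x \<bullet> D f p w)) (at p)"
    by (rule has_derivative_transform_within_open[OF _ open_M p]) (simp add: N_normal)
  from D_eqI[OF this] have "(\<lambda>x. N p \<bullet> DD f p x w + D N p x \<bullet> D f p w) = (\<lambda>x. 0)" by simp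
  from fun_cong[OF this, of x] show ?thesis
    unfolding f.gauss_formula[OF p] by (simp add: inner_add_right N_normal[OF p])
qed

lemma DN_eq: assumes p: "p \<in> M" shows "D N p x = D \<nu> (u p) (D u p x)"
proof -
  have "D N p = D (\<lambda>q. \<nu> (u q)) p"
    by (rule D_cong[OF open_M p]) (use descended in \<open>simp add: descended_gauss_map_def\<close>)
  also have "\<dots> = (\<lambda>x. D \<nu> (u p) (D u p x))"
    by (rule D_eqI[OF has_derivative_compose[OF has_derivative_D[OF u_differentiable[OF p]]
          has_derivative_D[OF nu_differentiable[OF p]]]])
  finally show ?thesis by simp
qed

lemma second_ff_nullity:
  assumes p: "p \<in> M" and T: "T \<in> nullity m p"
  shows "second_ff inner f p v T = 0"
proof -
  let ?s = "second_ff inner f p v T"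
  have "D N p T = 0"
    using T nullity_iff[OF p] by (simp add: DN_eq[OF p] linear_0[OF Dnu_linear[OF p]])
  then have N: "N p \<bullet> ?s = 0"
    using weingarten[OF p, of T v] f.second_ff_commute[OF p, of v T] by simp
  obtain x c where xc: "?s = D f p x + c *\<^sub>R N p" using tangent_plus_normal[OF p] by blast
  have "?s \<bullet> ?s = ?s \<bullet> (D f p x + c *\<^sub>R N p)" using xc by (rule arg_cong)
  also have "\<dots> = 0" using f.second_ff_normal[OF p] N by (simp add: inner_add_right inner_commute)
  finally show ?thesis by simp
qed

end

sublocale hypersurface \<subseteq> f: null_immersion M m u X inner f
  by unfold_locales (rule second_ff_nullity)

context hypersurface
begin

abbreviation a :: "3 \<Rightarrow> 'a \<Rightarrow> real" where
  "a \<equiv> shape_coeff m f N X"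

lemma a_eq: assumes p: "p \<in> M" shows "a k p = N p \<bullet> f.beta k p"
  unfolding shape_coeff_def f.m_eq[OF p] shape_operator[OF p] f.beta_def weingarten[OF p] by simp

lemma a_differentiable: assumes p: "p \<in> M" shows "a k differentiable (at p)"
  by (rule differentiable_transform_open[OF f.h_differentiable[OF N_differentiable[OF p]
        f.beta_differentiable[OF p]] open_M p a_eq])

lemma DN_pairing:
  assumes p: "p \<in> M" shows "D N p x \<bullet> D f p w = - (\<Sum>k\<in>UNIV. du p x k * du p w k * a k p)"
  using weingarten[OF p, of x w]
  by (simp add: f.second_ff_diagonal[OF p] a_eq[OF p] inner_sum_right)

text \<open>
  If \<open>a\<^sub>k\<close> vanished, then so would the derivative of the Gauss map along \<open>X\<^sub>k\<close>, although it descends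
  to an immersion.
\<close>

lemma a_nonzero: assumes p: "p \<in> M" shows "a k p \<noteq> 0"
proof
  assume a0: "a k p = 0"
  have z: "D N p (X k p) \<bullet> D f p w = 0" for w
    unfolding DN_pairing[OF p] by (auto simp: du_X[OF p] a0 intro: sum.neutral)
  have "D f p (- shape_operator f N p (X k p)) = D N p (X k p)"
    by (simp add: linear_neg[OF f.Dg_linear[OF p]] shape_operator[OF p])
  then have "D N p (X k p) \<bullet> D N p (X k p) = 0" using z[of "- shape_operator f N p (X k p)"] by simp
  then have "D N p (X k p) = 0" by simp
  then have "D \<nu> (u p) (axis k 1) = D \<nu> (u p) 0"
    by (simp add: DN_eq[OF p] Du_X[OF p] linear_0[OF Dnu_linear[OF p]])
  then have "axis k (1::real) = (0 :: real^3)" by (rule injD[OF Dnu_inj[OF p]])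
  then show False by (simp add: axis_eq_0_iff)
qed

lemma D_a:
  assumes p: "p \<in> M" shows "D (a k) p x = N p \<bullet> normal_part inner f p (D (f.beta k) p x)"
proof -
  have "D (a k) p x = D (\<lambda>q. N q \<bullet> f.beta k q) p x"
    by (rule fun_cong[OF D_cong[OF open_M p a_eq]])
  also have "\<dots> = N p \<bullet> D (f.beta k) p x + D N p x \<bullet> f.beta k p"
    by (rule fun_cong[OF D_eqI[OF f.h_has_derivative[OF N_differentiable[OF p] f.beta_differentiable[OF p]]]])
  also have "D N p x \<bullet> f.beta k p = 0"
    by (rule DN_orthogonal_normal[OF p f.beta_normal[OF p]])
  also have "N p \<bullet> D (f.beta k) p x = N p \<bullet> normal_part inner f p (D (f.beta k) p x)"
  proof -
    obtain y where "D (f.beta k) p x = D f p y + normal_part inner f p (D (f.beta k) p x)"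
      using f.tangent_normal_decomposition[OF p] by blast
    then have "N p \<bullet> D (f.beta k) p x = N p \<bullet> (D f p y + normal_part inner f p (D (f.beta k) p x))"
      by (rule arg_cong)
    then show ?thesis by (simp add: inner_add_right N_normal[OF p])
  qed
  finally show ?thesis by simp
qed

text \<open>The Codazzi equation of \<open>f\<close>, contracted with \<open>N\<close>.\<close>

lemma codazzi_scalar:
  assumes p: "p \<in> M"
  shows "(\<Sum>k\<in>UNIV. du p v k * (hess k p x w * a k p + du p w k * D (a k) p x))
       = (\<Sum>k\<in>UNIV. du p x k * (hess k p v w * a k p + du p w k * D (a k) p v))"
proof -
  have "N p \<bullet> (\<Sum>k\<in>UNIV. du p v k *\<^sub>R (hess k p x w *\<^sub>R f.beta k p
          + du p w k *\<^sub>R normal_part inner f p (D (f.beta k) p x)))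
      = N p \<bullet> (\<Sum>k\<in>UNIV. du p x k *\<^sub>R (hess k p v w *\<^sub>R f.beta k p
          + du p w k *\<^sub>R normal_part inner f p (D (f.beta k) p v)))"
    by (rule arg_cong[OF f.codazzi[OF p]])
  then show ?thesis by (simp add: inner_sum_right inner_add_right a_eq[OF p] D_a[OF p])
qed

text \<open>
  These are the Christoffel symbols \<open>\<Gamma>\<^sub>k\<^sub>i\<^sup>i\<close> of the leaf space for \<open>k \<noteq> i\<close>, by
  \<open>christoffel_symbol_eq_gam\<close>.
\<close>

definition gam :: "3 \<Rightarrow> 3 \<Rightarrow> 'a \<Rightarrow> real" where
  "gam k i p = hess k p (X i p) (X i p) * a k p / a i p"

lemma gam_differentiable: assumes p: "p \<in> M" shows "gam k i differentiable (at p)"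
proof -
  have "(\<lambda>q. hess k q (X i q) (X i q)) differentiable (at p)"
    by (rule differentiable_apply_bilinear[where B="hess k", OF open_M p f.hess_bilinear
          f.hess_differentiable[OF p] X_differentiable[OF p] X_differentiable[OF p]])
  then show ?thesis unfolding gam_def[abs_def]
    using a_differentiable[OF p] a_nonzero[OF p] by (intro differentiable_divide differentiable_mult) auto
qed

text \<open>
  The Codazzi equation with two of its arguments equal to \<open>X\<^sub>i\<close>; the Codazzi equation of \<open>g\<close> is
  compared with it in this form.
\<close>

lemma shape_tangential_hessian:
  assumes p: "p \<in> M"
  shows "hess i p x (X i p) * a i p + D (a i) p x
     = (\<Sum>k\<in>UNIV. du p x k * (hess k p (X i p) (X i p) * a k p)) + du p x i * D (a i) p (X i p)"
proof -
  have d: "(\<Sum>k\<in>UNIV. (if k = i then 1 else 0) * F k) = F i" for F :: "3 \<Rightarrow> real"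
    by (simp add: if_distrib[of "\<lambda>y. y * _"] cong: if_cong)
  show ?thesis
    using codazzi_scalar[OF p, of "X i p" x "X i p"]
    by (simp add: du_X[OF p] d distrib_left sum.distrib)
       (simp add: if_distrib if_distribR sum.delta cong: if_cong)
qed


lemma DDN_pairing:
  assumes p: "p \<in> M"
  shows "(DD N p x v - D \<nu> (u p) (DD u p x v)) \<bullet> D f p w
     = - (\<Sum>k\<in>UNIV. du p v k * (hess k p x w * a k p + du p w k * D (a k) p x))"
proof -
  have dk: "((\<lambda>q. du q v k) has_derivative (\<lambda>x. DD u p x v $ k)) (at p)" for v k
    by (rule bounded_linear.has_derivative[OF bounded_linear_vec_nth has_derivative_D[OF Du_differentiable[OF p]]])
  have 1: "((\<lambda>q. D N q v \<bullet> D f q w) has_derivative (\<lambda>x. D N p v \<bullet> DD f p x w + DD N p x v \<bullet> D f p w)) (at p)"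
    by (rule f.h_has_derivative[OF DN_differentiable[OF p] f.Dg_differentiable[OF p]])
  have "((\<lambda>q. - (\<Sum>k\<in>UNIV. du q v k * du q w k * a k q)) has_derivative
     (\<lambda>x. - (\<Sum>k\<in>UNIV. du p v k * du p w k * D (a k) p x
        + (du p v k * DD u p x w $ k + DD u p x v $ k * du p w k) * a k p))) (at p)"
    by (intro has_derivative_minus has_derivative_sum has_derivative_mult dk has_derivative_D a_differentiable[OF p])
  then have 2: "((\<lambda>q. D N q v \<bullet> D f q w) has_derivative
     (\<lambda>x. - (\<Sum>k\<in>UNIV. du p v k * du p w k * D (a k) p x
        + (du p v k * DD u p x w $ k + DD u p x v $ k * du p w k) * a k p))) (at p)"
    by (rule has_derivative_transform_within_open[OF _ open_M p]) (simp add: DN_pairing)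
  have "D N p v \<bullet> DD f p x w + DD N p x v \<bullet> D f p w
     = - (\<Sum>k\<in>UNIV. du p v k * du p w k * D (a k) p x
        + (du p v k * DD u p x w $ k + DD u p x v $ k * du p w k) * a k p)"
    using fun_cong[OF has_derivative_unique[OF 1 2]] .
  moreover have "D N p v \<bullet> DD f p x w = - (\<Sum>k\<in>UNIV. du p v k * D u p (christoffel m p x w) $ k * a k p)"
  proof -
    have "D N p v \<bullet> second_ff inner f p x w = 0"
      by (rule DN_orthogonal_normal[OF p f.second_ff_normal[OF p]])
    then show ?thesis unfolding f.gauss_formula[OF p] by (simp add: inner_add_right DN_pairing[OF p])
  qed
  moreover have "D \<nu> (u p) (DD u p x v) \<bullet> D f p w = - (\<Sum>k\<in>UNIV. DD u p x v $ k * du p w k * a k p)"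
  proof -
    have "D \<nu> (u p) (DD u p x v) = D N p (\<Sum>k\<in>UNIV. DD u p x v $ k *\<^sub>R X k p)"
      by (simp add: DN_eq[OF p] Du_combination[OF p])
    then show ?thesis by (simp only: DN_pairing[OF p] Du_combination[OF p] vec_lambda_beta)
  qed
  ultimately show ?thesis
    by (simp add: inner_diff_left hess_def sum_3 algebra_simps)
qed

lemma DDnu_eq:
  assumes p: "p \<in> M"
  shows "DD \<nu> (u p) (D u p x) (D u p v) = DD N p x v - D \<nu> (u p) (DD u p x v)"
proof -
  have uM: "\<And>q. q \<in> M \<Longrightarrow> linear (D \<nu> (u q))" by (rule Dnu_linear)
  have c: "((\<lambda>q. D \<nu> (u q) e) has_derivative (\<lambda>x. DD \<nu> (u p) (D u p x) e)) (at p)" for e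
    by (rule has_derivative_compose[OF has_derivative_D[OF u_differentiable[OF p]]
          has_derivative_D[OF Dnu_differentiable[OF p]]])
  then have d: "(\<lambda>q. D \<nu> (u q) e) differentiable (at p)" for e unfolding differentiable_def by blast
  have "((\<lambda>q. D \<nu> (u q) (D u q v)) has_derivative
      (\<lambda>x. D \<nu> (u p) (DD u p x v) + D (\<lambda>q. D \<nu> (u q) (D u p v)) p x)) (at p)"
    by (rule has_derivative_apply_linear[where B="\<lambda>q. D \<nu> (u q)", OF open_M p uM d Du_differentiable[OF p]])
  then have "((\<lambda>q. D N q v) has_derivative
      (\<lambda>x. D \<nu> (u p) (DD u p x v) + D (\<lambda>q. D \<nu> (u q) (D u p v)) p x)) (at p)"
    by (rule has_derivative_transform_within_open[OF _ open_M p]) (simp add: DN_eq)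
  from fun_cong[OF D_eqI[OF this]] fun_cong[OF D_eqI[OF c]]
  show ?thesis by simp
qed

text \<open>
  The symmetry descends from the Gauss map on \<open>M\<close>, because \<open>D u\<close> is onto.
\<close>

lemma DDnu_commute:
  assumes p: "p \<in> M" shows "DD \<nu> (u p) y z = DD \<nu> (u p) z y"
proof -
  have "surj (D u p)" using leaf p by (simp add: leaf_chart_def)
  then obtain x v where "y = D u p x" "z = D u p v" by (metis surjD)
  moreover have "DD N p x v = DD N p v x"
    by (rule second_derivative_symmetric[OF open_M p N_differentiable DN_differentiable[OF p]])
  ultimately show ?thesis using DDnu_eq[OF p] DDu_commute[OF p] by simp
qed

lemma christoffel_pullback:
  assumes p: "p \<in> M"
  shows "D \<nu> (u p) (christoffel (pullback inner \<nu>) (u p) y z) \<bullet> D \<nu> (u p) Z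
     = DD \<nu> (u p) y z \<bullet> D \<nu> (u p) Z"
proof -
  let ?P = "pullback inner \<nu> (u p)"
  have lin: "linear (D \<nu> (u p))" by (rule Dnu_linear[OF p])
  have Dm: "D (\<lambda>y. pullback inner \<nu> y v w) (u p) x
      = D \<nu> (u p) v \<bullet> DD \<nu> (u p) x w + DD \<nu> (u p) x v \<bullet> D \<nu> (u p) w" for v w x
    unfolding pullback_def
    by (rule fun_cong[OF D_eqI[OF has_derivative_inner[OF
          has_derivative_D[OF Dnu_differentiable[OF p]] has_derivative_D[OF Dnu_differentiable[OF p]]]]])
  have koszul: "D (\<lambda>x. pullback inner \<nu> x z Z) (u p) y + D (\<lambda>x. pullback inner \<nu> x y Z) (u p) z
       - D (\<lambda>x. pullback inner \<nu> x y z) (u p) Z = 2 * (DD \<nu> (u p) y z \<bullet> D \<nu> (u p) Z)" for Z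
    by (simp add: Dm DDnu_commute[OF p, of z y] DDnu_commute[OF p, of Z] inner_commute[of "D \<nu> (u p) _"])
  have riem: "riemannian_product ?P"
    unfolding riemannian_product_def symmetric_form_def
  proof (intro conjI allI impI)
    show "bilinear ?P" unfolding bilinear_def pullback_def
      by (auto intro!: linearI simp: linear_add[OF lin] linear_scale[OF lin] inner_simps)
    show "?P v w = ?P w v" for v w by (simp add: pullback_def inner_commute)
    show "0 < ?P v v" if "v \<noteq> 0" for v
    proof -
      have "D \<nu> (u p) v \<noteq> 0" using that linear_injective_0[OF lin] Dnu_inj[OF p] by blast
      then show ?thesis by (simp add: pullback_def)
    qed
  qed
  have "linear (\<lambda>Z. DD \<nu> (u p) y z \<bullet> D \<nu> (u p) Z)"
    by (intro linearI) (simp_all add: linear_add[OF lin] linear_scale[OF lin] inner_simps)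
  then obtain W where W: "\<And>Z. ?P W Z = DD \<nu> (u p) y z \<bullet> D \<nu> (u p) Z"
    using riesz_representation[OF riem] by blast
  have "christoffel (pullback inner \<nu>) (u p) y z = W"
    unfolding christoffel_def koszul
    by (rule the_equality) (use W in \<open>auto intro!: riemannian_product_cancel[OF riem]\<close>)
  then show ?thesis using W by (simp add: pullback_def)
qed

text \<open>
  The shape operator restricts to an automorphism of the conullity, and up to sign \<open>f\<^sub>*\<close> turns its
  values into derivatives of the Gauss map.
\<close>

lemma Df_X_in_range_Dnu:
  assumes p: "p \<in> M" shows "\<exists>y. D f p (X k p) = D \<nu> (u p) y"
proof -
  define A where "A = shape_operator f N p"
  have linA: "linear A"
  proof -
    have lN: "linear (D N p)" using N_differentiable[OF p] by (rule linear_frechet_derivative)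
    show ?thesis
    proof (intro linearI)
      fix x y c
      have "D f p (A (x + y)) = D f p (A x + A y)"
        by (simp add: A_def shape_operator[OF p] linear_add[OF f.Dg_linear[OF p]] linear_add[OF lN])
      then show "A (x + y) = A x + A y" using f.Dg_inject[OF p] by blast
      have "D f p (A (c *\<^sub>R x)) = D f p (c *\<^sub>R A x)"
        by (simp add: A_def shape_operator[OF p] linear_scale[OF f.Dg_linear[OF p]] linear_scale[OF lN])
      then show "A (c *\<^sub>R x) = c *\<^sub>R A x" using f.Dg_inject[OF p] by blast
    qed
  qed
  have A_con: "A x \<in> conullity m p" for x
    unfolding conullity_def
    by (auto simp: A_def f.m_eq[OF p] shape_operator[OF p] DN_pairing[OF p] nullity_iff[OF p])
  define C where "C y = (\<Sum>k\<in>UNIV. y $ k *\<^sub>R X k p)" for y :: "real^3"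
  have linC: "linear C" unfolding C_def
    by (intro linearI) (simp_all add: algebra_simps sum.distrib scaleR_sum_right)
  have DuC: "D u p (C y) = y" for y unfolding C_def Du_combination[OF p] by simp
  have AC: "D f p (A (C y)) = - D \<nu> (u p) y" for y
    by (simp add: A_def shape_operator[OF p] DN_eq[OF p] DuC)
  define F where "F y = D u p (A (C y))" for y
  have linF: "linear F"
    using linear_compose[OF linear_compose[OF linC linA] Du_linear[OF p]] by (simp add: F_def[abs_def] o_def)
  have "y = 0" if "F y = 0" for y
  proof -
    have "A (C y) = 0" using conullity_expansion[OF p A_con, of "C y"] that by (simp add: F_def)
    then have "D \<nu> (u p) y = 0" using AC[of y] linear_0[OF f.Dg_linear[OF p]] by simp
    then show ?thesis using Dnu_inj[OF p] linear_injective_0[OF Dnu_linear[OF p]] by blast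
  qed
  then have "inj F" using linear_injective_0[OF linF] by blast
  then have "surj F" using linF linear_inj_imp_surj by blast
  then obtain y where y: "F y = axis k 1" by (metis surjD)
  have "A (C y) = X k p"
    using conullity_expansion[OF p A_con, of "C y"] conullity_expansion[OF p X_conullity[OF p], of k] y
    by (simp add: F_def Du_X[OF p])
  then have "D f p (X k p) = D \<nu> (u p) (- y)"
    using AC[of y] by (simp add: linear_neg[OF Dnu_linear[OF p]])
  then show ?thesis by blast
qed

text \<open>
  The metric of the leaf space is the third fundamental form, so its Christoffel symbols are read
  off from the second derivatives of the Gauss map paired with the conjugate frame.
\<close>

lemma christoffel_symbol_eq_gam:
  assumes p: "p \<in> M" and ij: "i \<noteq> j"
  shows "christoffel_symbol \<nu> j i i (u p) = gam j i p"
proof -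
  let ?W = "christoffel (pullback inner \<nu>) (u p) (axis j 1) (axis i 1)"
  obtain y where y: "D f p (X i p) = D \<nu> (u p) y" using Df_X_in_range_Dnu[OF p] by blast
  have "D \<nu> (u p) ?W \<bullet> D f p (X i p) = DD \<nu> (u p) (axis j 1) (axis i 1) \<bullet> D f p (X i p)"
    unfolding y by (rule christoffel_pullback[OF p])
  also have "DD \<nu> (u p) (axis j 1) (axis i 1) = DD N p (X j p) (X i p) - D \<nu> (u p) (DD u p (X j p) (X i p))"
    unfolding DDnu_eq[OF p, symmetric] Du_X[OF p] ..
  also have "\<dots> \<bullet> D f p (X i p)
     = - (\<Sum>k\<in>UNIV. du p (X i p) k * (hess k p (X j p) (X i p) * a k p + du p (X i p) k * D (a k) p (X j p)))"
    by (rule DDN_pairing[OF p])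
  also have "\<dots> = - (\<Sum>k\<in>UNIV. du p (X j p) k * (hess k p (X i p) (X i p) * a k p + du p (X i p) k * D (a k) p (X i p)))"
    by (simp only: codazzi_scalar[OF p])
  also have "\<dots> = - (hess j p (X i p) (X i p) * a j p)"
    using ij by (simp add: du_X[OF p] if_distrib[of "\<lambda>y. y * _"] cong: if_cong)
  finally have "D \<nu> (u p) ?W \<bullet> D f p (X i p) = - (hess j p (X i p) (X i p) * a j p)" .
  moreover have "D \<nu> (u p) ?W \<bullet> D f p (X i p) = - (?W $ i * a i p)"
  proof -
    have "D \<nu> (u p) ?W = D N p (\<Sum>k\<in>UNIV. ?W $ k *\<^sub>R X k p)"
      by (simp add: DN_eq[OF p] Du_combination[OF p])
    then show ?thesis
      by (simp add: DN_pairing[OF p] Du_combination[OF p] du_X[OF p] if_distrib[of "\<lambda>y. y * _"]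
           if_distrib[of "\<lambda>y. _ * y"] cong: if_cong)
  qed
  ultimately have "?W $ i * a i p = hess j p (X i p) (X i p) * a j p" by simp
  then show ?thesis using a_nonzero[OF p, of i]
    by (simp add: christoffel_symbol_def gam_def field_simps)
qed

end

section \<open>Immersions of codimension two\<close>

context hypersurface
begin

text \<open>
  The shape operator in the direction \<open>\<eta>\<^sub>i\<close> of an immersion with \<open>\<phi>\<^sub>i = r\<close> at the point; it is defined
  without reference to the immersion, as it must be shared by \<open>g\<close> and \<open>g'\<close>.
\<close>

definition normal_shape :: "real \<Rightarrow> 3 \<Rightarrow> 'a \<Rightarrow> 'a \<Rightarrow> 'a" where
  "normal_shape r i p x = (THE W. \<forall>Z. m p W Z =
     (\<Sum>k\<in>UNIV. du p x k * du p Z k * a k p * (1 + (if i = k then 1 / r else 0))))"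

lemma normal_shape:
  assumes p: "p \<in> M"
  shows "m p (normal_shape r i p x) Z =
     (\<Sum>k\<in>UNIV. du p x k * du p Z k * a k p * (1 + (if i = k then 1 / r else 0)))"
proof -
  have "linear (\<lambda>Z. \<Sum>k\<in>UNIV. du p x k * du p Z k * a k p * (1 + (if i = k then 1 / r else 0)))"
    by (intro linearI) (simp_all add: linear_add[OF Du_linear[OF p]] linear_scale[OF Du_linear[OF p]] sum_3 algebra_simps)
  then obtain W where W: "\<And>Z. m p W Z =
      (\<Sum>k\<in>UNIV. du p x k * du p Z k * a k p * (1 + (if i = k then 1 / r else 0)))"
    using riesz_representation[OF m_riemannian[OF p]] by blast
  have "normal_shape r i p x = W"
    unfolding normal_shape_def by (rule the_equality) (use W in \<open>auto intro!: m_cancel[OF p]\<close>)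
  then show ?thesis using W by simp
qed

lemma normal_shape_linear: assumes p: "p \<in> M" shows "linear (normal_shape r i p)"
  by (intro linearI m_cancel[OF p])
     (simp_all add: normal_shape[OF p] bilinear_ladd[OF m_bilinear[OF p]] bilinear_lmul[OF m_bilinear[OF p]]
        linear_add[OF Du_linear[OF p]] linear_scale[OF Du_linear[OF p]] sum_3 algebra_simps)

lemma du_differentiable: assumes p: "p \<in> M" shows "(\<lambda>q. du q v k) differentiable (at p)"
  using bounded_linear.has_derivative[OF bounded_linear_vec_nth has_derivative_D[OF Du_differentiable[OF p]]]
  unfolding differentiable_def by blast

lemma normal_shape_differentiable:
  assumes p: "p \<in> M" and r: "r differentiable (at p)" "r p \<noteq> 0"
  shows "(\<lambda>q. normal_shape (r q) i q x) differentiable (at p)"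
proof (rule metric_dual_differentiable[OF p _ normal_shape])
  fix Z
  have "(\<lambda>q. 1 + (if i = k then 1 / r q else 0)) differentiable (at p)" for k
    using r by (cases "i = k") (auto intro!: differentiable_divide)
  then show "(\<lambda>q. \<Sum>k\<in>UNIV. du q x k * du q Z k * a k q * (1 + (if i = k then 1 / r q else 0)))
      differentiable (at p)"
    by (intro differentiable_sum ballI differentiable_mult du_differentiable a_differentiable p) auto
qed

text \<open>
  The coefficient of \<open>\<eta>\<^sub>k - \<eta>\<^sub>i\<close> in \<open>\<nabla>\<^sup>\<bottom>\<^sub>x \<eta>\<^sub>i\<close>; see \<open>perp_eta\<close>.
\<close>

definition conn :: "(3 \<Rightarrow> 'a \<Rightarrow> real) \<Rightarrow> 3 \<Rightarrow> 3 \<Rightarrow> 'a \<Rightarrow> 'a \<Rightarrow> real" where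
  "conn \<phi> i k p x = du p x k * gam k i p - du p x i * gam i k p * \<phi> k p / \<phi> i p"

end

locale codim2_immersion = hypersurface M m u X f N \<nu> + g: null_immersion M m u X h g
  for M :: "'a::euclidean_space set" and m u X f N \<nu> and h :: "'w::euclidean_space form" and g +
  fixes \<phi> :: "3 \<Rightarrow> 'a \<Rightarrow> real"
  assumes codim: "DIM('w) = DIM('a) + 2"
    and assoc: "associated_functions M m f N X h g \<phi>"
begin

abbreviation \<eta> :: "3 \<Rightarrow> 'a \<Rightarrow> 'w" where
  "\<eta> \<equiv> eta m f N X h g"

abbreviation perp :: "('a \<Rightarrow> 'w) \<Rightarrow> 'a \<Rightarrow> 'a \<Rightarrow> 'w" where
  "perp \<xi> p x \<equiv> normal_part h g p (D \<xi> p x)"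

lemma phi_nonzero: "p \<in> M \<Longrightarrow> \<phi> i p \<noteq> 0"
  and h_eta: "p \<in> M \<Longrightarrow> h (\<eta> i p) (\<eta> j p) = 1 + (if i = j then 1 / \<phi> i p else 0)"
  using assoc unfolding associated_functions_def by blast+

lemma beta_eq: "p \<in> M \<Longrightarrow> g.beta i p = a i p *\<^sub>R \<eta> i p"
  using a_nonzero by (simp add: eta_def g.beta_def)

lemma eta_eq: "p \<in> M \<Longrightarrow> \<eta> i p = (1 / a i p) *\<^sub>R g.beta i p"
  by (simp add: eta_def g.beta_def divide_inverse)

lemma eta_normal: "p \<in> M \<Longrightarrow> h (\<eta> i p) (D g p Z) = 0"
  by (simp add: eta_eq g.beta_normal g.h_simps)

lemma eta_differentiable: assumes p: "p \<in> M" shows "\<eta> i differentiable (at p)"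
proof (rule differentiable_transform_open[OF _ open_M p eta_eq])
  show "(\<lambda>q. (1 / a i q) *\<^sub>R g.beta i q) differentiable (at p)"
    using a_differentiable[OF p] a_nonzero[OF p] g.beta_differentiable[OF p]
    by (intro differentiable_scaleR differentiable_divide) auto
qed

lemma phi_eq: "p \<in> M \<Longrightarrow> \<phi> i p = 1 / (h (\<eta> i p) (\<eta> i p) - 1)"
  by (simp add: h_eta)

lemma phi_differentiable: assumes p: "p \<in> M" shows "\<phi> i differentiable (at p)"
proof (rule differentiable_transform_open[OF _ open_M p phi_eq])
  show "(\<lambda>q. 1 / (h (\<eta> i q) (\<eta> i q) - 1)) differentiable (at p)"
    using g.h_differentiable[OF eta_differentiable[OF p] eta_differentiable[OF p]] phi_nonzero[OF p]
    by (intro differentiable_divide differentiable_diff) (auto simp: h_eta[OF p])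
qed

lemma h_combination:
  "p \<in> M \<Longrightarrow> h (\<Sum>i\<in>UNIV. c i *\<^sub>R \<eta> i p) (\<eta> j p) = (\<Sum>i\<in>UNIV. c i) + c j / \<phi> j p"
  by (simp add: g.h_simps h_eta distrib_left sum.distrib if_distrib[of "\<lambda>y. _ * y"] cong: if_cong)

lemma tangent_plus_combination_zero:
  assumes p: "p \<in> M" and z: "D g p v + (\<Sum>i\<in>UNIV. c i *\<^sub>R \<eta> i p) = 0"
  shows "v = 0" "(\<Sum>i\<in>UNIV. c i *\<^sub>R \<eta> i p) = 0"
proof -
  have "m p v v = h (D g p v + (\<Sum>i\<in>UNIV. c i *\<^sub>R \<eta> i p)) (D g p v)"
    by (simp add: g.m_eq[OF p] g.h_simps eta_normal[OF p])
  then have "m p v v = 0" using z by (simp add: g.h_simps)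
  then show v: "v = 0" by (rule m_zero[OF p])
  then show "(\<Sum>i\<in>UNIV. c i *\<^sub>R \<eta> i p) = 0" using z linear_0[OF g.Dg_linear[OF p]] by simp
qed

text \<open>
  Three vectors in a normal plane are dependent, and pairing a linear relation with the \<open>\<eta>\<^sub>j\<close>
  shows that its coefficients are proportional to the \<open>\<phi>\<^sub>j\<close>.
\<close>

lemma phi_relation:
  assumes p: "p \<in> M"
  shows "(\<Sum>i\<in>UNIV. \<phi> i p) = -1" "(\<Sum>i\<in>UNIV. \<phi> i p *\<^sub>R \<eta> i p) = 0"
proof -
  define P where "P z = D g p (fst z) + (\<Sum>i\<in>UNIV. (snd z $ i) *\<^sub>R \<eta> i p)" for z :: "'a \<times> (real^3)"
  have lin: "linear P" unfolding P_def
    by (intro linearI) (simp_all add: linear_add[OF g.Dg_linear[OF p]] linear_scale[OF g.Dg_linear[OF p]]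
        algebra_simps sum.distrib scaleR_sum_right)
  have "\<not> inj P"
  proof
    assume "inj P"
    then have "dim (P ` UNIV) = dim (UNIV :: ('a \<times> (real^3)) set)" using lin by (intro dim_image_eq) auto
    then show False using dim_subset_UNIV[of "P ` UNIV"] codim by simp
  qed
  then obtain z where z: "P z = 0" "z \<noteq> 0" using linear_injective_0[OF lin] by blast
  define c where "c i = snd z $ i" for i
  have z0: "D g p (fst z) + (\<Sum>i\<in>UNIV. c i *\<^sub>R \<eta> i p) = 0" using z(1) by (simp add: P_def c_def)
  note rel = tangent_plus_combination_zero[OF p z0]
  define s where "s = (\<Sum>i\<in>UNIV. c i)"
  have c: "c j = - s * \<phi> j p" for j
  proof -
    have "s + c j / \<phi> j p = 0"
      using h_combination[OF p, of c j] rel(2) by (simp add: g.h_simps s_def)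
    then show ?thesis using phi_nonzero[OF p, of j] by (simp add: field_simps eq_neg_iff_add_eq_0)
  qed
  have s: "s \<noteq> 0"
  proof
    assume "s = 0"
    then have "snd z = 0" using c by (simp add: vec_eq_iff c_def)
    then show False using z(2) rel(1) by (simp add: prod_eq_iff)
  qed
  have "s = - s * (\<Sum>i\<in>UNIV. \<phi> i p)" by (subst s_def) (simp add: c sum_distrib_left sum_negf)
  then have "s * (1 + (\<Sum>i\<in>UNIV. \<phi> i p)) = 0" by (simp add: algebra_simps)
  then show "(\<Sum>i\<in>UNIV. \<phi> i p) = -1" using s by simp
  have "(- s) *\<^sub>R (\<Sum>i\<in>UNIV. \<phi> i p *\<^sub>R \<eta> i p) = 0"
    using rel(2) by (simp add: c scaleR_sum_right del: scaleR_minus_left)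
  then show "(\<Sum>i\<in>UNIV. \<phi> i p *\<^sub>R \<eta> i p) = 0" using s by simp
qed

lemma perp_beta:
  assumes p: "p \<in> M"
  shows "perp (g.beta i) p x = D (a i) p x *\<^sub>R \<eta> i p + a i p *\<^sub>R perp (\<eta> i) p x"
proof -
  have "((\<lambda>q. a i q *\<^sub>R \<eta> i q) has_derivative (\<lambda>x. a i p *\<^sub>R D (\<eta> i) p x + D (a i) p x *\<^sub>R \<eta> i p)) (at p)"
    by (intro has_derivative_scaleR has_derivative_D a_differentiable[OF p] eta_differentiable[OF p])
  then have "(g.beta i has_derivative (\<lambda>x. a i p *\<^sub>R D (\<eta> i) p x + D (a i) p x *\<^sub>R \<eta> i p)) (at p)"
    by (rule has_derivative_transform_within_open[OF _ open_M p]) (simp add: beta_eq)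
  from D_eqI[OF this] show ?thesis
    by (simp add: linear_add[OF g.normal_part_linear[OF p]] linear_scale[OF g.normal_part_linear[OF p]]
         g.normal_part_id[OF p eta_normal[OF p]])
qed

lemma sum_delta_frame:
  fixes F :: "3 \<Rightarrow> 'w" shows "(\<Sum>k\<in>UNIV. (if k = i then 1 else 0) *\<^sub>R F k) = F i"
  by (simp add: if_distrib[of "\<lambda>y. y *\<^sub>R _"] cong: if_cong)

text \<open>
  The Codazzi equation for \<open>g\<close> minus \<open>\<eta>\<^sub>i\<close> times that for \<open>f\<close>.  It leaves open only the
  derivative of \<open>\<eta>\<^sub>i\<close> along \<open>X\<^sub>i\<close>.
\<close>

lemma perp_eta_mod:
  assumes p: "p \<in> M"
  shows "perp (\<eta> i) p x = (\<Sum>k\<in>UNIV. (du p x k * gam k i p) *\<^sub>R (\<eta> k p - \<eta> i p))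
     + du p x i *\<^sub>R perp (\<eta> i) p (X i p)"
proof -
  define H where "H k = hess k p (X i p) (X i p) * a k p" for k
  have "hess i p x (X i p) *\<^sub>R g.beta i p + perp (g.beta i) p x
     = (\<Sum>k\<in>UNIV. du p x k *\<^sub>R (hess k p (X i p) (X i p) *\<^sub>R g.beta k p
          + (if k = i then 1 else 0) *\<^sub>R perp (g.beta k) p (X i p)))"
    using g.codazzi[OF p, of "X i p" x "X i p"] by (simp only: du_X[OF p] sum_delta_frame) simp
  also have "\<dots> = (\<Sum>k\<in>UNIV. du p x k *\<^sub>R (H k *\<^sub>R \<eta> k p)) + du p x i *\<^sub>R perp (g.beta i) p (X i p)"
    by (simp add: scaleR_add_right sum.distrib beta_eq[OF p] H_def
         if_distrib[of "\<lambda>y. y *\<^sub>R _"] if_distrib[of "\<lambda>y. _ *\<^sub>R y"] cong: if_cong)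
  finally have eq: "(hess i p x (X i p) * a i p + D (a i) p x) *\<^sub>R \<eta> i p + a i p *\<^sub>R perp (\<eta> i) p x
     = (\<Sum>k\<in>UNIV. du p x k *\<^sub>R (H k *\<^sub>R \<eta> k p))
       + (du p x i * D (a i) p (X i p)) *\<^sub>R \<eta> i p + (a i p * du p x i) *\<^sub>R perp (\<eta> i) p (X i p)"
    by (simp add: perp_beta[OF p] beta_eq[OF p] algebra_simps)
  have "a i p *\<^sub>R perp (\<eta> i) p x = (\<Sum>k\<in>UNIV. (du p x k * H k) *\<^sub>R (\<eta> k p - \<eta> i p))
       + (a i p * du p x i) *\<^sub>R perp (\<eta> i) p (X i p)"
    using eq unfolding shape_tangential_hessian[OF p] H_def[symmetric]
    by (simp add: algebra_simps sum_subtractf scaleR_sum_left)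
  also have "\<dots> = a i p *\<^sub>R ((\<Sum>k\<in>UNIV. (du p x k * gam k i p) *\<^sub>R (\<eta> k p - \<eta> i p))
     + du p x i *\<^sub>R perp (\<eta> i) p (X i p))"
    using a_nonzero[OF p, of i]
    by (simp add: scaleR_add_right scaleR_sum_right gam_def H_def)
  finally show ?thesis using a_nonzero[OF p, of i] by simp
qed

lemma h_perp: assumes p: "p \<in> M" shows "h (\<eta> i p) (D V p x) = h (\<eta> i p) (perp V p x)"
proof -
  obtain y where "D V p x = D g p y + perp V p x" using g.tangent_normal_decomposition[OF p] by blast
  then have "h (\<eta> i p) (D V p x) = h (\<eta> i p) (D g p y + perp V p x)" by (rule arg_cong)
  then show ?thesis by (simp add: g.h_simps eta_normal[OF p])
qed

lemma D_phi_perp: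
  assumes p: "p \<in> M"
  shows "D (\<phi> i) p x = - 2 * \<phi> i p ^ 2 * h (\<eta> i p) (perp (\<eta> i) p x)"
proof -
  have "((\<lambda>q. h (\<eta> i q) (\<eta> i q)) has_derivative (\<lambda>x. h (\<eta> i p) (D (\<eta> i) p x) + h (D (\<eta> i) p x) (\<eta> i p))) (at p)"
    by (rule g.h_has_derivative[OF eta_differentiable[OF p] eta_differentiable[OF p]])
  then have 1: "((\<lambda>q. 1 + 1 / \<phi> i q) has_derivative (\<lambda>x. h (\<eta> i p) (D (\<eta> i) p x) + h (D (\<eta> i) p x) (\<eta> i p))) (at p)"
    by (rule has_derivative_transform_within_open[OF _ open_M p]) (simp add: h_eta)
  have 2: "((\<lambda>q. 1 + 1 / \<phi> i q) has_derivative (\<lambda>x. - D (\<phi> i) p x / (\<phi> i p)^2)) (at p)"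
    using phi_nonzero[OF p, of i]
    by (auto intro!: derivative_eq_intros has_derivative_D[OF phi_differentiable[OF p]] simp: power2_eq_square divide_inverse)
  have "- D (\<phi> i) p x / (\<phi> i p)^2 = h (\<eta> i p) (D (\<eta> i) p x) + h (D (\<eta> i) p x) (\<eta> i p)"
    using fun_cong[OF has_derivative_unique[OF 2 1]] .
  also have "\<dots> = 2 * h (\<eta> i p) (perp (\<eta> i) p x)"
    using h_perp[OF p] g.h_commute[of "D (\<eta> i) p x"] by simp
  finally show ?thesis using phi_nonzero[OF p, of i] by (simp add: field_simps)
qed

text \<open>
  Differentiating \<open>\<langle>\<eta>\<^sub>i, \<eta>\<^sub>i\<rangle> = 1 + 1/\<phi>\<^sub>i\<close> gives all derivatives of \<open>\<phi>\<^sub>i\<close> except that along \<open>X\<^sub>i\<close>, which is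
  obtained below from the relation \<open>\<Sum>\<^sub>i \<phi>\<^sub>i = -1\<close>.
\<close>

lemma D_phi_mod:
  assumes p: "p \<in> M"
  shows "D (\<phi> i) p x = 2 * \<phi> i p * (\<Sum>k\<in>UNIV - {i}. du p x k * gam k i p) + du p x i * D (\<phi> i) p (X i p)"
proof -
  have "h (\<eta> i p) (perp (\<eta> i) p x) = (\<Sum>k\<in>UNIV. du p x k * gam k i p * (h (\<eta> i p) (\<eta> k p) - h (\<eta> i p) (\<eta> i p)))
     + du p x i * h (\<eta> i p) (perp (\<eta> i) p (X i p))"
    by (subst perp_eta_mod[OF p]) (simp add: g.h_simps)
  also have "(\<Sum>k\<in>UNIV. du p x k * gam k i p * (h (\<eta> i p) (\<eta> k p) - h (\<eta> i p) (\<eta> i p)))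
     = (\<Sum>k\<in>UNIV - {i}. du p x k * gam k i p * (- 1 / \<phi> i p))"
    by (rule sum.mono_neutral_cong_right) (auto simp: h_eta[OF p])
  also have "\<dots> = (\<Sum>k\<in>UNIV - {i}. du p x k * gam k i p) * (- 1 / \<phi> i p)"
    by (rule sum_distrib_right[symmetric])
  finally have e: "h (\<eta> i p) (perp (\<eta> i) p x) = (\<Sum>k\<in>UNIV - {i}. du p x k * gam k i p) * (- 1 / \<phi> i p)
     + du p x i * h (\<eta> i p) (perp (\<eta> i) p (X i p))" .
  show ?thesis unfolding D_phi_perp[OF p, of i x] D_phi_perp[OF p, of i "X i p"] e using phi_nonzero[OF p, of i]
    by (simp add: field_simps power2_eq_square)
qed

lemma D_phi_frame:
  assumes p: "p \<in> M"
  shows "i \<noteq> j \<Longrightarrow> D (\<phi> j) p (X i p) = 2 * \<phi> j p * gam i j p"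
    and "D (\<phi> i) p (X i p) = - (\<Sum>j\<in>UNIV - {i}. 2 * \<phi> j p * gam i j p)"
proof -
  show off: "D (\<phi> j) p (X i p) = 2 * \<phi> j p * gam i j p" if "i \<noteq> j" for i j
  proof -
    have "(\<Sum>k\<in>UNIV - {j}. du p (X i p) k * gam k j p) = (\<Sum>k\<in>UNIV - {j}. if k = i then gam i j p else 0)"
      by (rule sum.cong) (auto simp: du_X[OF p])
    also have "\<dots> = gam i j p" using that by simp
    finally show ?thesis using that by (subst D_phi_mod[OF p]) (simp add: du_X[OF p])
  qed
  have "((\<lambda>q. \<Sum>j\<in>UNIV. \<phi> j q) has_derivative (\<lambda>x. \<Sum>j\<in>UNIV. D (\<phi> j) p x)) (at p)"
    by (intro has_derivative_sum has_derivative_D phi_differentiable[OF p])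
  then have "((\<lambda>q. -1) has_derivative (\<lambda>x. \<Sum>j\<in>UNIV. D (\<phi> j) p x)) (at p)"
    by (rule has_derivative_transform_within_open[OF _ open_M p]) (simp add: phi_relation)
  from D_eqI[OF this] have "(\<lambda>x. \<Sum>j\<in>UNIV. D (\<phi> j) p x) = (\<lambda>x. 0)" by simp
  from fun_cong[OF this, of "X i p"]
  have "D (\<phi> i) p (X i p) + (\<Sum>j\<in>UNIV - {i}. D (\<phi> j) p (X i p)) = 0"
    by (subst (asm) sum.remove[of UNIV i]) auto
  moreover have "(\<Sum>j\<in>UNIV - {i}. D (\<phi> j) p (X i p)) = (\<Sum>j\<in>UNIV - {i}. 2 * \<phi> j p * gam i j p)"
    by (rule sum.cong) (auto simp: off)
  ultimately show "D (\<phi> i) p (X i p) = - (\<Sum>j\<in>UNIV - {i}. 2 * \<phi> j p * gam i j p)" by simp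
qed

lemma D_phi:
  assumes p: "p \<in> M"
  shows "D (\<phi> i) p x = (\<Sum>k\<in>UNIV. 2 * (du p x k * gam k i p * \<phi> i p - du p x i * gam i k p * \<phi> k p))"
proof -
  have "(\<Sum>k\<in>UNIV. 2 * (du p x k * gam k i p * \<phi> i p - du p x i * gam i k p * \<phi> k p))
     = (\<Sum>k\<in>UNIV - {i}. 2 * (du p x k * gam k i p * \<phi> i p - du p x i * gam i k p * \<phi> k p))"
    by (subst sum.remove[of UNIV i]) auto
  also have "\<dots> = D (\<phi> i) p x"
    by (subst D_phi_mod[OF p])
       (simp add: D_phi_frame(2)[OF p] sum_distrib_left sum_subtractf algebra_simps)
  finally show ?thesis by simp
qed

text \<open>
  The normal part of the derivative along \<open>X\<^sub>i\<close> of the relation \<open>\<Sum>\<^sub>k \<phi>\<^sub>k \<eta>\<^sub>k = 0\<close>, in which all terms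
  but the one with \<open>\<nabla>\<^sup>\<bottom>\<eta>\<^sub>i\<close> are known.
\<close>

lemma perp_eta_self:
  assumes p: "p \<in> M"
  shows "\<phi> i p *\<^sub>R perp (\<eta> i) p (X i p) = (\<Sum>k\<in>UNIV. (gam i k p * \<phi> k p) *\<^sub>R (\<eta> i p - \<eta> k p))"
proof -
  have alg: "s *\<^sub>R (t *\<^sub>R (v - w)) + (2 * s * t) *\<^sub>R w = (t * s) *\<^sub>R (v + w)" for s t and v w :: 'w
  proof -
    have "(2 * s * t) *\<^sub>R w = (t * s) *\<^sub>R w + (t * s) *\<^sub>R w"
      by (subst scaleR_add_left[symmetric]) simp
    then show ?thesis by (simp add: scaleR_diff_right scaleR_add_right mult.commute)
  qed
  have "((\<lambda>q. \<Sum>k\<in>UNIV. \<phi> k q *\<^sub>R \<eta> k q) has_derivative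
     (\<lambda>x. \<Sum>k\<in>UNIV. \<phi> k p *\<^sub>R D (\<eta> k) p x + D (\<phi> k) p x *\<^sub>R \<eta> k p)) (at p)"
    by (intro has_derivative_sum has_derivative_scaleR has_derivative_D phi_differentiable[OF p] eta_differentiable[OF p])
  then have "((\<lambda>q. 0) has_derivative
     (\<lambda>x. \<Sum>k\<in>UNIV. \<phi> k p *\<^sub>R D (\<eta> k) p x + D (\<phi> k) p x *\<^sub>R \<eta> k p)) (at p)"
    by (rule has_derivative_transform_within_open[OF _ open_M p]) (simp add: phi_relation)
  from D_eqI[OF this] have "(\<lambda>x. \<Sum>k\<in>UNIV. \<phi> k p *\<^sub>R D (\<eta> k) p x + D (\<phi> k) p x *\<^sub>R \<eta> k p) = (\<lambda>x. 0)" by simp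
  from arg_cong[OF fun_cong[OF this, of "X i p"], of "normal_part h g p"]
  have "(\<Sum>k\<in>UNIV. \<phi> k p *\<^sub>R perp (\<eta> k) p (X i p) + D (\<phi> k) p (X i p) *\<^sub>R \<eta> k p) = 0"
    by (simp add: linear_sum[OF g.normal_part_linear[OF p]] linear_add[OF g.normal_part_linear[OF p]]
         linear_scale[OF g.normal_part_linear[OF p]] linear_0[OF g.normal_part_linear[OF p]]
         g.normal_part_id[OF p eta_normal[OF p]])
  then have "\<phi> i p *\<^sub>R perp (\<eta> i) p (X i p) + D (\<phi> i) p (X i p) *\<^sub>R \<eta> i p
     + (\<Sum>k\<in>UNIV - {i}. \<phi> k p *\<^sub>R perp (\<eta> k) p (X i p) + D (\<phi> k) p (X i p) *\<^sub>R \<eta> k p) = 0"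
    by (subst (asm) sum.remove[of UNIV i]) auto
  moreover have "(\<Sum>k\<in>UNIV - {i}. \<phi> k p *\<^sub>R perp (\<eta> k) p (X i p) + D (\<phi> k) p (X i p) *\<^sub>R \<eta> k p)
      = (\<Sum>k\<in>UNIV - {i}. (gam i k p * \<phi> k p) *\<^sub>R (\<eta> i p + \<eta> k p))"
  proof (rule sum.cong)
    fix k assume "k \<in> UNIV - {i}"
    then have ik: "i \<noteq> k" by blast
    have "(\<Sum>j\<in>UNIV. (du p (X i p) j * gam j k p) *\<^sub>R (\<eta> j p - \<eta> k p)) = gam i k p *\<^sub>R (\<eta> i p - \<eta> k p)"
    proof -
      have "(\<Sum>j\<in>UNIV. (du p (X i p) j * gam j k p) *\<^sub>R (\<eta> j p - \<eta> k p))
        = (\<Sum>j\<in>UNIV. if j = i then gam i k p *\<^sub>R (\<eta> i p - \<eta> k p) else 0)"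
        by (rule sum.cong) (auto simp: du_X[OF p])
      then show ?thesis by simp
    qed
    then have e: "perp (\<eta> k) p (X i p) = gam i k p *\<^sub>R (\<eta> i p - \<eta> k p)"
      using ik by (subst perp_eta_mod[OF p]) (simp add: du_X[OF p])
    show "\<phi> k p *\<^sub>R perp (\<eta> k) p (X i p) + D (\<phi> k) p (X i p) *\<^sub>R \<eta> k p
       = (gam i k p * \<phi> k p) *\<^sub>R (\<eta> i p + \<eta> k p)"
      unfolding e D_phi_frame(1)[OF p ik] by (rule alg)
  qed simp
  ultimately have "\<phi> i p *\<^sub>R perp (\<eta> i) p (X i p)
     = (\<Sum>j\<in>UNIV - {i}. 2 * \<phi> j p * gam i j p) *\<^sub>R \<eta> i p - (\<Sum>k\<in>UNIV - {i}. (gam i k p * \<phi> k p) *\<^sub>R (\<eta> i p + \<eta> k p))"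
    unfolding D_phi_frame(2)[OF p] by (simp add: algebra_simps add_eq_0_iff)
  also have "\<dots> = (\<Sum>k\<in>UNIV - {i}. (gam i k p * \<phi> k p) *\<^sub>R (\<eta> i p - \<eta> k p))"
    unfolding scaleR_sum_left sum_subtractf[symmetric]
    by (rule sum.cong) (simp_all add: algebra_simps scaleR_2[symmetric])
  also have "\<dots> = (\<Sum>k\<in>UNIV. (gam i k p * \<phi> k p) *\<^sub>R (\<eta> i p - \<eta> k p))"
    by (rule sum.mono_neutral_left) auto
  finally show ?thesis .
qed

lemma perp_eta:
  assumes p: "p \<in> M"
  shows "perp (\<eta> i) p x = (\<Sum>k\<in>UNIV. conn \<phi> i k p x *\<^sub>R (\<eta> k p - \<eta> i p))"
proof -
  have "perp (\<eta> i) p (X i p) = (1 / \<phi> i p) *\<^sub>R (\<phi> i p *\<^sub>R perp (\<eta> i) p (X i p))"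
    using phi_nonzero[OF p] by simp
  then have s: "perp (\<eta> i) p (X i p) = (1 / \<phi> i p) *\<^sub>R (\<Sum>k\<in>UNIV. (gam i k p * \<phi> k p) *\<^sub>R (\<eta> i p - \<eta> k p))"
    unfolding perp_eta_self[OF p] .
  show ?thesis
    unfolding perp_eta_mod[OF p, of i x] s scaleR_sum_right sum.distrib[symmetric]
    by (rule sum.cong) (simp_all add: conn_def algebra_simps)
qed

text \<open>
  The frame of the \<open>g\<^sub>* v\<close> and the \<open>\<eta>\<^sub>i\<close> satisfies a linear system whose coefficients depend
  only on \<open>f\<close> and \<open>\<phi>\<close>.
\<close>

lemma D_eta:
  assumes p: "p \<in> M"
  shows "D (\<eta> i) p x = - D g p (normal_shape (\<phi> i p) i p x)
     + (\<Sum>k\<in>UNIV. conn \<phi> i k p x *\<^sub>R (\<eta> k p - \<eta> i p))"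
proof -
  obtain y where y: "D (\<eta> i) p x = D g p y + perp (\<eta> i) p x" "\<And>Z. m p y Z = h (D (\<eta> i) p x) (D g p Z)"
    using g.tangent_normal_decomposition[OF p] by blast
  have "y = - normal_shape (\<phi> i p) i p x"
  proof (rule m_cancel[OF p])
    fix Z
    have "((\<lambda>q. h (\<eta> i q) (D g q Z)) has_derivative (\<lambda>x. h (\<eta> i p) (DD g p x Z) + h (D (\<eta> i) p x) (D g p Z))) (at p)"
      by (rule g.h_has_derivative[OF eta_differentiable[OF p] g.Dg_differentiable[OF p]])
    then have "((\<lambda>q. 0) has_derivative (\<lambda>x. h (\<eta> i p) (DD g p x Z) + h (D (\<eta> i) p x) (D g p Z))) (at p)"
      by (rule has_derivative_transform_within_open[OF _ open_M p]) (simp add: eta_normal)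
    from D_eqI[OF this] have "(\<lambda>x. h (\<eta> i p) (DD g p x Z) + h (D (\<eta> i) p x) (D g p Z)) = (\<lambda>x. 0)" by simp
    from fun_cong[OF this, of x] have "h (D (\<eta> i) p x) (D g p Z) = - h (\<eta> i p) (DD g p x Z)" by simp
    also have "\<dots> = - (\<Sum>k\<in>UNIV. du p x k * du p Z k * a k p * (1 + (if i = k then 1 / \<phi> i p else 0)))"
      unfolding g.gauss_formula[OF p] g.second_ff_diagonal[OF p] beta_eq[OF p]
      by (simp add: g.h_simps eta_normal[OF p] h_eta[OF p] mult.assoc)
    finally show "m p y Z = m p (- normal_shape (\<phi> i p) i p x) Z"
      by (simp add: y(2) bilinear_lneg[OF m_bilinear[OF p]] normal_shape[OF p])
  qed
  then show ?thesis using y(1) unfolding perp_eta[OF p]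
    by (simp add: linear_neg[OF g.Dg_linear[OF p]])
qed

end

section \<open>Rigidity\<close>

lemma index_3: "(3::3) = 0" "(0::3) \<noteq> 1" "(0::3) \<noteq> 2" "(1::3) \<noteq> 2"
  by simp_all

lemma UNIV_index: "(UNIV :: 3 set) = {0, 1, 2}"
  using UNIV_3 by auto

lemma sum_index: "(\<Sum>k\<in>UNIV. F k) = F 0 + F 1 + F (2::3)" for F :: "3 \<Rightarrow> 'b::comm_monoid_add"
  unfolding UNIV_index by (simp add: index_3 add.assoc)

lemma continuous_on_differentiable:
  "(\<And>q. q \<in> M \<Longrightarrow> F differentiable (at q)) \<Longrightarrow> continuous_on M F"
  by (simp add: continuous_at_imp_continuous_on differentiable_imp_continuous_within)

context hypersurface
begin

lemma conn_linear: "p \<in> M \<Longrightarrow> linear (conn \<phi> i k p)"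
  unfolding conn_def
  by (intro linearI) (simp_all add: linear_add[OF Du_linear] linear_scale[OF Du_linear] algebra_simps add_divide_distrib diff_divide_distrib)

lemma conn_differentiable:
  assumes p: "p \<in> M" and "\<And>i. \<phi> i differentiable (at p)" "\<And>i. \<phi> i p \<noteq> 0"
  shows "(\<lambda>q. conn \<phi> i k q x) differentiable (at p)"
  unfolding conn_def
  by (intro differentiable_diff differentiable_mult differentiable_divide du_differentiable gam_differentiable assms)

end

locale codim2_pair = hypersurface M m u X f N \<nu>
    + g: codim2_immersion M m u X f N \<nu> h g \<phi> + g': codim2_immersion M m u X f N \<nu> h g' \<phi>'
  for M :: "'a::euclidean_space set" and m u X f N \<nu> and h :: "'w::euclidean_space form" and g \<phi> g' \<phi>' +
  assumes connected: "connected M"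
begin

text \<open>
  The differences \<open>\<phi>\<^sub>i - \<phi>'\<^sub>i\<close> satisfy a homogeneous linear system, since \<open>D_phi\<close> is linear in the
  \<open>\<phi>\<^sub>i\<close> with coefficients that depend only on the hypersurface.
\<close>

lemma phi_agree:
  assumes p: "p \<in> M" and eq: "\<And>i. \<phi> i p = \<phi>' i p" and q: "q \<in> M"
  shows "\<phi> i q = \<phi>' i q"
proof -
  define c where "c i j q x = (if i = j then \<Sum>k\<in>UNIV. 2 * (du q x k * gam k i q) else 0)
      - 2 * (du q x i * gam i j q)" for i j q x
  have "\<phi> i q - \<phi>' i q = 0"
  proof (rule linear_system_vanishes[where F="\<lambda>i q. \<phi> i q - \<phi>' i q" and c=c and I=UNIV, OF open_M connected p])
    show "linear (c i j q)" if "q \<in> M" for i j q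
      unfolding c_def using that
      by (intro linearI) (simp_all add: linear_add[OF Du_linear] linear_scale[OF Du_linear] sum_3 algebra_simps)
    show "continuous_on M (\<lambda>q. c i j q x)" for i j x
    proof (rule continuous_on_differentiable)
      fix q assume q: "q \<in> M"
      have "(\<lambda>q. \<Sum>k\<in>UNIV. 2 * (du q x k * gam k i q)) differentiable (at q)"
        by (intro differentiable_sum ballI differentiable_mult du_differentiable[OF q] gam_differentiable[OF q]) auto
      moreover have "(\<lambda>q. 2 * (du q x i * gam i j q)) differentiable (at q)"
        by (intro differentiable_mult du_differentiable[OF q] gam_differentiable[OF q]) auto
      ultimately show "(\<lambda>q. c i j q x) differentiable (at q)"
        unfolding c_def by (cases "i = j") auto
    qed
    show "((\<lambda>q. \<phi> i q - \<phi>' i q) has_derivative (\<lambda>x. \<Sum>j\<in>UNIV. c i j q x *\<^sub>R (\<phi> j q - \<phi>' j q))) (at q)"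
      if q: "q \<in> M" for i q
    proof -
      have "((\<lambda>q. \<phi> i q - \<phi>' i q) has_derivative (\<lambda>x. D (\<phi> i) q x - D (\<phi>' i) q x)) (at q)"
        by (intro has_derivative_diff has_derivative_D g.phi_differentiable[OF q] g'.phi_differentiable[OF q])
      moreover have "D (\<phi> i) q x - D (\<phi>' i) q x = (\<Sum>j\<in>UNIV. c i j q x *\<^sub>R (\<phi> j q - \<phi>' j q))" for x
      proof -
        have "(\<Sum>j\<in>UNIV. c i j q x *\<^sub>R (\<phi> j q - \<phi>' j q))
          = (\<Sum>j\<in>UNIV. if i = j then (\<Sum>k\<in>UNIV. 2 * (du q x k * gam k i q)) * (\<phi> i q - \<phi>' i q) else 0)
            - (\<Sum>j\<in>UNIV. 2 * (du q x i * gam i j q) * (\<phi> j q - \<phi>' j q))"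
          unfolding sum_subtractf[symmetric] by (rule sum.cong) (auto simp: c_def left_diff_distrib)
        also have "(\<Sum>j\<in>UNIV. if i = j then (\<Sum>k\<in>UNIV. 2 * (du q x k * gam k i q)) * (\<phi> i q - \<phi>' i q) else 0)
          = (\<Sum>k\<in>UNIV. 2 * (du q x k * gam k i q) * (\<phi> i q - \<phi>' i q))"
          by (simp add: sum_distrib_right)
        finally show ?thesis
          unfolding g.D_phi[OF q] g'.D_phi[OF q] sum_subtractf[symmetric]
          by (simp only:) (rule sum.cong, simp_all add: algebra_simps)
      qed
      ultimately show ?thesis by simp
    qed
  qed (use eq q in auto)
  then show ?thesis by simp
qed

text \<open>
  Both immersions carry a frame, \<open>g\<^sub>* v\<close> and \<open>\<eta>\<^sub>1, \<eta>\<^sub>2\<close>, with the same inner products; the linear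
  isometry \<open>L\<close> matching the two frames at one point matches them everywhere, because the
  differences satisfy a homogeneous linear system.
\<close>

lemma rigidity:
  assumes x0: "x0 \<in> M" and eq: "\<And>i p. p \<in> M \<Longrightarrow> \<phi> i p = \<phi>' i p"
  shows "same_germ h x0 g g'"
proof -
  let ?e = "eta m f N X h g" and ?e' = "eta m f N X h g'"
  define P where "P z = D g x0 (fst z) + fst (snd z) *\<^sub>R ?e 1 x0 + snd (snd z) *\<^sub>R ?e 2 x0" for z :: "'a \<times> real \<times> real"
  define P' where "P' z = D g' x0 (fst z) + fst (snd z) *\<^sub>R ?e' 1 x0 + snd (snd z) *\<^sub>R ?e' 2 x0" for z :: "'a \<times> real \<times> real"
  have linP: "linear P" unfolding P_def
    by (intro linearI) (simp_all add: linear_add[OF g.g.Dg_linear[OF x0]] linear_scale[OF g.g.Dg_linear[OF x0]] algebra_simps)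
  have linP': "linear P'" unfolding P'_def
    by (intro linearI) (simp_all add: linear_add[OF g'.g.Dg_linear[OF x0]] linear_scale[OF g'.g.Dg_linear[OF x0]] algebra_simps)
  have "z = 0" if z: "P z = 0" for z
  proof -
    define c :: "3 \<Rightarrow> real" where "c i = (if i = 1 then fst (snd z) else if i = 2 then snd (snd z) else 0)" for i
    have s: "(\<Sum>i\<in>UNIV. c i *\<^sub>R ?e i x0) = fst (snd z) *\<^sub>R ?e 1 x0 + snd (snd z) *\<^sub>R ?e 2 x0"
      by (simp add: sum_index c_def index_3)
    have "D g x0 (fst z) + (\<Sum>i\<in>UNIV. c i *\<^sub>R ?e i x0) = 0" using z unfolding s P_def by (simp add: add.assoc)
    note rel = g.tangent_plus_combination_zero[OF x0 this]
    have k: "(\<Sum>i\<in>UNIV. c i) + c j / \<phi> j x0 = 0" for j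
      using g.h_combination[OF x0, of c j] rel(2) by (simp add: g.g.h_simps)
    \<comment> \<open>The relation does not contain \<open>\<eta>\<^sub>0\<close>, so pairing it with \<open>\<eta>\<^sub>0\<close> gives the sum of its coefficients.\<close>
    have "(\<Sum>i\<in>UNIV. c i) = 0" using k[of 0] by (simp add: c_def index_3)
    then have "c j = 0" for j using k[of j] g.phi_nonzero[OF x0, of j] by simp
    from this[of 1] this[of 2] rel(1) show ?thesis by (simp add: c_def index_3 prod_eq_iff)
  qed
  then have inj: "inj P" using linear_injective_0[OF linP] by blast
  have surj: "surj P" by (rule linear_injective_imp_surjective[OF linP inj]) (simp add: g.codim)
  obtain K where K: "linear K" "K \<circ> P = id" using linear_injective_left_inverse[OF linP inj] by blast
  define L where "L = P' \<circ> K"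
  have linL: "linear L" unfolding L_def by (rule linear_compose[OF K(1) linP'])
  have LP: "L (P z) = P' z" for z using K(2) unfolding L_def by (metis comp_apply id_apply)
  have hP: "h (P z) (P w) = h (P' z) (P' w)" for z w
    unfolding P_def P'_def
    by (simp add: g.g.h_simps g.eta_normal[OF x0] g'.eta_normal[OF x0] g.g.h_commute[of "D g x0 _" "?e _ x0"]
        g.g.h_commute[of "D g' x0 _" "?e' _ x0"] g.g.m_eq[OF x0, symmetric] g'.g.m_eq[OF x0, symmetric]
        g.h_eta[OF x0] g'.h_eta[OF x0] eq[OF x0])
  have hL: "h (L v) (L w) = h v w" for v w
  proof -
    obtain y z where "v = P y" "w = P z" using surj unfolding surj_def by blast
    then show ?thesis by (simp add: LP hP)
  qed
  have Lg: "L (D g x0 v) = D g' x0 v" for v using LP[of "(v, 0, 0)"] by (simp add: P_def P'_def)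
  have L12: "L (?e 1 x0) = ?e' 1 x0" "L (?e 2 x0) = ?e' 2 x0"
    using LP[of "(0, 1, 0)"] LP[of "(0, 0, 1)"]
    by (simp_all add: P_def P'_def linear_0[OF g.g.Dg_linear[OF x0]] linear_0[OF g'.g.Dg_linear[OF x0]])
  have L0: "L (?e 0 x0) = ?e' 0 x0"
  proof -
    have "\<phi> 0 x0 *\<^sub>R ?e 0 x0 + \<phi> 1 x0 *\<^sub>R ?e 1 x0 + \<phi> 2 x0 *\<^sub>R ?e 2 x0 = 0"
      using g.phi_relation(2)[OF x0] by (simp add: sum_index)
    from arg_cong[OF this, of L]
    have "\<phi> 0 x0 *\<^sub>R L (?e 0 x0) + \<phi> 1 x0 *\<^sub>R ?e' 1 x0 + \<phi> 2 x0 *\<^sub>R ?e' 2 x0 = 0"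
      by (simp add: linear_add[OF linL] linear_scale[OF linL] linear_0[OF linL] L12)
    moreover have "\<phi> 0 x0 *\<^sub>R ?e' 0 x0 + \<phi> 1 x0 *\<^sub>R ?e' 1 x0 + \<phi> 2 x0 *\<^sub>R ?e' 2 x0 = 0"
      using g'.phi_relation(2)[OF x0] by (simp add: sum_index eq[OF x0])
    ultimately have "\<phi> 0 x0 *\<^sub>R L (?e 0 x0) = \<phi> 0 x0 *\<^sub>R ?e' 0 x0" by (metis add_right_cancel)
    then show ?thesis using g.phi_nonzero[OF x0] by simp
  qed
  have Le: "L (?e i x0) = ?e' i x0" for i
  proof -
    have "i \<in> {0, 1, 2}" using UNIV_index by blast
    then show ?thesis using L0 L12 by auto
  qed
  \<comment> \<open>The unknowns of the system are indexed by the frame: \<open>Inl b\<close> stands for the image of the basis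
      vector \<open>b\<close>, and \<open>Inr k\<close> for \<open>\<eta>\<^sub>k\<close>.\<close>
  define F :: "'a + 3 \<Rightarrow> 'a \<Rightarrow> 'w" where
    "F i q = (case i of Inl b \<Rightarrow> D g' q b - L (D g q b) | Inr k \<Rightarrow> ?e' k q - L (?e k q))" for i q
  define c :: "'a + 3 \<Rightarrow> 'a + 3 \<Rightarrow> 'a \<Rightarrow> 'a \<Rightarrow> real" where
    "c i j q x = (case i of
        Inl d \<Rightarrow> (case j of Inl b \<Rightarrow> christoffel m q x d \<bullet> b
                          | Inr k \<Rightarrow> du q x k * du q d k * a k q)
      | Inr l \<Rightarrow> (case j of Inl b \<Rightarrow> - (normal_shape (\<phi> l q) l q x \<bullet> b)
                          | Inr k \<Rightarrow> conn \<phi> l k q x - (if k = l then \<Sum>j\<in>UNIV. conn \<phi> l j q x else 0)))"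
    for i j q x
  have Fvec: "D g' q v - L (D g q v) = (\<Sum>b\<in>Basis. (v \<bullet> b) *\<^sub>R F (Inl b) q)" if "q \<in> M" for q v
  proof -
    have "linear (\<lambda>v. D g' q v - L (D g q v))"
      using linear_compose[OF g.g.Dg_linear[OF that] linL]
      by (intro linear_compose_sub g'.g.Dg_linear[OF that]) (simp add: o_def)
    then show ?thesis by (subst linear_basis_expansion) (auto simp: F_def)
  qed
  have blL: "bounded_linear L" using linL by (simp add: linear_conv_bounded_linear)
  have F0: "F i q = 0" if i: "i \<in> Basis <+> UNIV" and q: "q \<in> M" for i q
  proof (rule linear_system_vanishes[where F=F and c=c and I="Basis <+> UNIV", OF open_M connected x0 _ _ _ _ _ i q])
    show "finite (Basis <+> UNIV :: ('a + 3) set)" by simp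
    show "linear (c i j q)" if q: "q \<in> M" for i j q
    proof -
      have lc: "linear (\<lambda>x. conn \<phi> l k q x - (if k = l then \<Sum>j\<in>UNIV. conn \<phi> l j q x else 0))" for l k
        by (cases "k = l")
           (auto intro!: linear_compose_sub linear_compose_sum conn_linear[OF q])
      note b = bilinear_ladd[OF f.christoffel_bilinear[OF q]] bilinear_lmul[OF f.christoffel_bilinear[OF q]]
      have li: "linear (\<lambda>x. christoffel m q x d \<bullet> b)" for d b
        by (intro linearI) (simp_all add: b inner_simps)
      have ln: "linear (\<lambda>x. - (normal_shape r l q x \<bullet> b))" for r l b
        by (intro linearI) (simp_all add: linear_add[OF normal_shape_linear[OF q]] linear_scale[OF normal_shape_linear[OF q]] inner_simps)
      have ld: "linear (\<lambda>x. du q x k * s * t)" for k s t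
        by (intro linearI) (simp_all add: linear_add[OF Du_linear[OF q]] linear_scale[OF Du_linear[OF q]] algebra_simps)
      show ?thesis
        unfolding c_def by (cases i; cases j; simp only: sum.case lc li ln ld)
    qed
    show "continuous_on M (\<lambda>q. c i j q x)" for i j x
    proof (rule continuous_on_differentiable)
      fix q assume q: "q \<in> M"
      have cd: "(\<lambda>q. conn \<phi> l k q x) differentiable (at q)" for l k
        by (rule conn_differentiable[OF q g.phi_differentiable[OF q] g.phi_nonzero[OF q]])
      have lc: "(\<lambda>q. conn \<phi> l k q x - (if k = l then \<Sum>j\<in>UNIV. conn \<phi> l j q x else 0)) differentiable (at q)" for l k
        by (cases "k = l") (auto intro!: differentiable_diff differentiable_sum cd)
      have li: "(\<lambda>q. christoffel m q x d \<bullet> b) differentiable (at q)" for d b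
        by (intro differentiable_inner f.christoffel_differentiable[OF q]) auto
      have ln: "(\<lambda>q. - (normal_shape (\<phi> l q) l q x \<bullet> b)) differentiable (at q)" for l b
        by (intro differentiable_minus differentiable_inner
             normal_shape_differentiable[OF q g.phi_differentiable[OF q] g.phi_nonzero[OF q]]) auto
      have ld: "(\<lambda>q. du q x k * du q d k * a k q) differentiable (at q)" for k d
        by (intro differentiable_mult du_differentiable[OF q] a_differentiable[OF q])
      show "(\<lambda>q. c i j q x) differentiable (at q)"
        unfolding c_def by (cases i; cases j; simp only: sum.case lc li ln ld)
    qed
    show "F i x0 = 0" for i by (cases i) (simp_all add: F_def Lg Le)
    fix i q assume q: "q \<in> M"
    have split: "(\<Sum>j\<in>Basis <+> UNIV. c i j q x *\<^sub>R F j q)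
      = (\<Sum>b\<in>Basis. c i (Inl b) q x *\<^sub>R F (Inl b) q) + (\<Sum>k\<in>UNIV. c i (Inr k) q x *\<^sub>R F (Inr k) q)" for i x
      by (subst sum.Plus) auto
    show "(F i has_derivative (\<lambda>x. \<Sum>j\<in>Basis <+> UNIV. c i j q x *\<^sub>R F j q)) (at q)"
    proof (cases i)
      case (Inl d)
      have "((\<lambda>q. D g' q d - L (D g q d)) has_derivative (\<lambda>x. DD g' q x d - L (DD g q x d))) (at q)"
        by (intro has_derivative_diff bounded_linear.has_derivative[OF blL] has_derivative_D
              g.g.Dg_differentiable[OF q] g'.g.Dg_differentiable[OF q])
      moreover have "DD g' q x d - L (DD g q x d) = (\<Sum>j\<in>Basis <+> UNIV. c i j q x *\<^sub>R F j q)" for x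
      proof -
        have "DD g' q x d - L (DD g q x d) =
           (D g' q (christoffel m q x d) - L (D g q (christoffel m q x d)))
           + (\<Sum>k\<in>UNIV. (du q x k * du q d k * a k q) *\<^sub>R (?e' k q - L (?e k q)))"
          unfolding g.g.gauss_formula[OF q] g'.g.gauss_formula[OF q] g.g.second_ff_diagonal[OF q]
            g'.g.second_ff_diagonal[OF q] g.beta_eq[OF q] g'.beta_eq[OF q]
          by (simp add: linear_add[OF linL] linear_sum[OF linL] linear_scale[OF linL] sum_subtractf scaleR_diff_right)
        then show ?thesis unfolding split Fvec[OF q] by (simp add: Inl c_def F_def)
      qed
      ultimately show ?thesis by (simp add: Inl F_def[abs_def])
    next
      case (Inr l)
      have "((\<lambda>q. ?e' l q - L (?e l q)) has_derivative (\<lambda>x. D (?e' l) q x - L (D (?e l) q x))) (at q)"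
        by (intro has_derivative_diff bounded_linear.has_derivative[OF blL] has_derivative_D
              g.eta_differentiable[OF q] g'.eta_differentiable[OF q])
      moreover have "D (?e' l) q x - L (D (?e l) q x) = (\<Sum>j\<in>Basis <+> UNIV. c i j q x *\<^sub>R F j q)" for x
      proof -
        have cc: "conn \<phi>' l k q x = conn \<phi> l k q x" for k by (simp add: conn_def eq[OF q])
        let ?n = "normal_shape (\<phi> l q) l q x"
        have "D (?e' l) q x - L (D (?e l) q x) = - (D g' q ?n - L (D g q ?n))
            + (\<Sum>k\<in>UNIV. conn \<phi> l k q x *\<^sub>R ((?e' k q - L (?e k q)) - (?e' l q - L (?e l q))))"
          unfolding g.D_eta[OF q] g'.D_eta[OF q] cc eq[OF q, symmetric]
          by (simp add: linear_add[OF linL] linear_diff[OF linL] linear_sum[OF linL] linear_scale[OF linL]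
               linear_neg[OF linL] sum_subtractf sum.distrib algebra_simps)
        also have "(\<Sum>k\<in>UNIV. conn \<phi> l k q x *\<^sub>R ((?e' k q - L (?e k q)) - (?e' l q - L (?e l q))))
          = (\<Sum>k\<in>UNIV. conn \<phi> l k q x *\<^sub>R F (Inr k) q) - (\<Sum>j\<in>UNIV. conn \<phi> l j q x) *\<^sub>R F (Inr l) q"
          by (simp add: F_def scaleR_diff_right sum_subtractf scaleR_sum_left scaleR_left_diff_distrib)
        also have "(\<Sum>j\<in>UNIV. conn \<phi> l j q x) *\<^sub>R F (Inr l) q
          = (\<Sum>k\<in>UNIV. (if k = l then \<Sum>j\<in>UNIV. conn \<phi> l j q x else 0) *\<^sub>R F (Inr k) q)"
          by (simp add: if_distrib[of "\<lambda>y. y *\<^sub>R _"] cong: if_cong)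
        finally show ?thesis
          unfolding split Fvec[OF q]
          by (simp add: Inr c_def sum_negf sum_subtractf[symmetric] scaleR_diff_left)
      qed
      ultimately show ?thesis by (simp add: Inr F_def[abs_def])
    qed
  qed
  define b where "b = g' x0 - L (g x0)"
  have "g' q = L (g q) + b" if q: "q \<in> M" for q
  proof -
    have der: "((\<lambda>q. g' q - L (g q)) has_derivative (\<lambda>x. 0)) (at q)" if q: "q \<in> M" for q
    proof -
      have "((\<lambda>q. g' q - L (g q)) has_derivative (\<lambda>x. D g' q x - L (D g q x))) (at q)"
        by (intro has_derivative_diff bounded_linear.has_derivative[OF blL] has_derivative_D
             g.g.g_differentiable[OF q] g'.g.g_differentiable[OF q])
      moreover have "D g' q x - L (D g q x) = 0" for x
        unfolding Fvec[OF q] by (rule sum.neutral) (auto intro!: F0[OF _ q])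
      ultimately show ?thesis by simp
    qed
    have "g' q - L (g q) = g' x0 - L (g x0)"
      by (rule has_derivative_zero_unique_connected[OF open_M connected der q x0])
    then show ?thesis by (simp add: b_def algebra_simps)
  qed
  then show ?thesis unfolding same_germ_def rigid_motion_def
    using open_M x0 linL hL by blast
qed

text \<open>
  Compare the derivatives of \<open>\<phi>\<^sub>0\<close> and \<open>\<phi>'\<^sub>0\<close> along \<open>X\<^sub>0\<close>, using \<open>\<phi>'\<^sub>2 - \<phi>\<^sub>2 = \<phi>\<^sub>1 - \<phi>'\<^sub>1\<close>.
\<close>

lemma gam_eq:
  assumes p: "p \<in> M" and eq0: "\<And>q. q \<in> M \<Longrightarrow> \<phi> 0 q = \<phi>' 0 q" and ne: "\<phi> 1 p \<noteq> \<phi>' 1 p"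
  shows "gam 0 1 p = gam 0 2 p"
proof -
  have U: "UNIV - {0::3} = {1, 2}" using UNIV_index by (auto simp: index_3)
  have "D (\<phi> 0) p (X 0 p) = D (\<phi>' 0) p (X 0 p)"
    by (rule fun_cong[OF D_cong[OF open_M p eq0]])
  then have "\<phi> 1 p * gam 0 1 p + \<phi> 2 p * gam 0 2 p = \<phi>' 1 p * gam 0 1 p + \<phi>' 2 p * gam 0 2 p"
    unfolding g.D_phi_frame(2)[OF p] g'.D_phi_frame(2)[OF p] U by (simp add: index_3)
  moreover have "\<phi> 0 p + \<phi> 1 p + \<phi> 2 p = -1" "\<phi>' 0 p + \<phi>' 1 p + \<phi>' 2 p = -1"
    using g.phi_relation(1)[OF p] g'.phi_relation(1)[OF p] by (simp_all add: sum_index)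
  then have "\<phi>' 2 p = \<phi> 2 p + (\<phi> 1 p - \<phi>' 1 p)" using eq0[OF p] by simp
  ultimately have "(\<phi> 1 p - \<phi>' 1 p) * (gam 0 1 p - gam 0 2 p) = 0" by (simp add: algebra_simps)
  then show ?thesis using ne by simp
qed

lemma distinct_gam_eq:
  assumes x0: "x0 \<in> M" and distinct: "\<not> same_germ h x0 g g'"
    and eq0: "\<And>q. q \<in> M \<Longrightarrow> \<phi> 0 q = \<phi>' 0 q" and p: "p \<in> M"
  shows "gam 0 1 p = gam 0 2 p"
proof (rule gam_eq[OF p eq0])
  show "\<phi> 1 p \<noteq> \<phi>' 1 p"
  proof
    assume e1: "\<phi> 1 p = \<phi>' 1 p"
    have "\<phi> 2 p = \<phi>' 2 p"
      using g.phi_relation(1)[OF p] g'.phi_relation(1)[OF p] eq0[OF p] e1 by (simp add: sum_index)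
    then have "\<phi> i p = \<phi>' i p" for i
      using UNIV_index eq0[OF p] e1 by (metis UNIV_I empty_iff insert_iff)
    then show False using rigidity[OF x0] phi_agree[OF p] distinct by blast
  qed
qed

end

section \<open>The metric induced by the extension\<close>

context hypersurface
begin

abbreviation Y :: "'a \<Rightarrow> 'a" where
  "Y \<equiv> Y_field m f N X u \<nu>"

lemma Y_eq:
  assumes p: "p \<in> M"
  shows "Y p = - (gam 1 0 p / a 1 p) *\<^sub>R X 1 p - (gam 2 0 p / a 2 p) *\<^sub>R X 2 p"
  using christoffel_symbol_eq_gam[OF p, of 0 1] christoffel_symbol_eq_gam[OF p, of 0 2]
  by (simp add: Y_field_def index_3)

lemma Y_differentiable: assumes p: "p \<in> M" shows "Y differentiable (at p)"
proof (rule differentiable_transform_open[OF _ open_M p Y_eq])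
  have "(\<lambda>q. (gam k 0 q / a k q) *\<^sub>R X k q) differentiable (at p)" for k
    by (intro differentiable_scaleR differentiable_divide gam_differentiable a_differentiable X_differentiable
         a_nonzero p)
  then show "(\<lambda>q. - (gam 1 0 q / a 1 q) *\<^sub>R X 1 q - (gam 2 0 q / a 2 q) *\<^sub>R X 2 q) differentiable (at p)"
    by (auto intro!: differentiable_diff differentiable_minus)
qed

lemma du_Y:
  assumes p: "p \<in> M"
  shows "du p (Y p) 0 = 0" "du p (Y p) 1 = - gam 1 0 p / a 1 p" "du p (Y p) 2 = - gam 2 0 p / a 2 p"
  by (simp_all add: Y_eq[OF p] linear_diff[OF Du_linear[OF p]] linear_scale[OF Du_linear[OF p]]
      linear_neg[OF Du_linear[OF p]] du_X[OF p] index_3)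

definition lambda_tangent :: "real \<Rightarrow> 'a \<Rightarrow> 'a \<Rightarrow> 'a" where
  "lambda_tangent r p x = nabla m x Y p - normal_shape r 0 p x"

definition lambda_normal :: "real \<Rightarrow> 'a \<Rightarrow> 'a \<Rightarrow> real" where
  "lambda_normal r p x = - (du p x 0 * gam 0 1 p / r + du p x 1 * gam 1 0 p + du p x 2 * gam 2 0 p)"

text \<open>
  The differential of the extension at \<open>t \<lambda>\<^sub>p\<close>, in the splitting of its image into tangent
  vectors of \<open>M\<close> and multiples of \<open>\<eta>\<^sub>0\<close>.
\<close>

definition extension_differential :: "real \<Rightarrow> 'a \<Rightarrow> real \<Rightarrow> 'a \<times> real \<Rightarrow> 'a \<times> real" where
  "extension_differential r p t z =
     (fst z + snd z *\<^sub>R Y p + t *\<^sub>R lambda_tangent r p (fst z), snd z + t * lambda_normal r p (fst z))"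

lemma extension_differential_linear:
  assumes p: "p \<in> M" shows "linear (extension_differential r p t)"
proof -
  have D: "linear (D Y p)" using Y_differentiable[OF p] by (rule linear_frechet_derivative)
  have C: "linear (\<lambda>x. christoffel m p x (Y p))" using f.christoffel_bilinear[OF p] by (simp add: bilinear_def)
  have T: "linear (lambda_tangent r p)"
    unfolding lambda_tangent_def[abs_def] nabla_def
    by (intro linear_compose_sub linear_compose_add D C normal_shape_linear[OF p])
  have K: "linear (lambda_normal r p)"
    unfolding lambda_normal_def[abs_def]
    by (intro linearI) (simp_all add: linear_add[OF Du_linear[OF p]] linear_scale[OF Du_linear[OF p]]
        algebra_simps add_divide_distrib)
  show ?thesis unfolding extension_differential_def[abs_def]
    by (intro linearI) (simp_all add: linear_add[OF T] linear_scale[OF T] linear_add[OF K] linear_scale[OF K] algebra_simps)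
qed

end

context codim2_immersion
begin

abbreviation lam :: "'a \<Rightarrow> 'w" where
  "lam \<equiv> lambda_field m f N X u \<nu> h g"

abbreviation G :: "'a \<times> real \<Rightarrow> 'w" where
  "G \<equiv> extension_map m f N X u \<nu> h g"

text \<open>
  The field \<open>Y\<close> is chosen so that \<open>\<alpha>\<^sup>g(X\<^sub>j, Y)\<close> cancels the component of \<open>\<nabla>\<^sup>\<bottom>\<eta>\<^sub>0\<close> along \<open>\<eta>\<^sub>j\<close> in the
  directions \<open>X\<^sub>1\<close> and \<open>X\<^sub>2\<close>.  In the direction \<open>X\<^sub>0\<close> the derivative involves
  \<open>\<Gamma>\<^sub>0\<^sub>1\<^sup>1 \<phi>\<^sub>1 \<eta>\<^sub>1 + \<Gamma>\<^sub>0\<^sub>2\<^sup>2 \<phi>\<^sub>2 \<eta>\<^sub>2\<close>, which is a multiple of \<open>\<phi>\<^sub>0 \<eta>\<^sub>0\<close> when the two symbols agree.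
\<close>

lemma D_lambda:
  assumes p: "p \<in> M" and gam: "gam 0 1 p = gam 0 2 p"
  shows "(lam has_derivative (\<lambda>x. D g p (lambda_tangent (\<phi> 0 p) p x) + lambda_normal (\<phi> 0 p) p x *\<^sub>R \<eta> 0 p)) (at p)"
proof -
  have "(lam has_derivative (\<lambda>x. D (\<eta> 0) p x + (D g p (nabla m x Y p) + second_ff h g p x (Y p)))) (at p)"
    unfolding lambda_field_def[abs_def]
    by (intro has_derivative_add has_derivative_D eta_differentiable[OF p]
          g.D_pushforward(1)[OF p Y_differentiable[OF p]])
  moreover have "D (\<eta> 0) p x + (D g p (nabla m x Y p) + second_ff h g p x (Y p))
     = D g p (lambda_tangent (\<phi> 0 p) p x) + lambda_normal (\<phi> 0 p) p x *\<^sub>R \<eta> 0 p" for x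
  proof -
    let ?k = "gam 0 1 p / \<phi> 0 p"
    have a: "second_ff h g p x (Y p) = - (du p x 1 * gam 1 0 p) *\<^sub>R \<eta> 1 p - (du p x 2 * gam 2 0 p) *\<^sub>R \<eta> 2 p"
      using a_nonzero[OF p]
      by (simp add: g.second_ff_diagonal[OF p] beta_eq[OF p] sum_index du_Y[OF p])
    have b: "(\<Sum>k\<in>UNIV. conn \<phi> 0 k p x *\<^sub>R (\<eta> k p - \<eta> 0 p))
       = (du p x 1 * gam 1 0 p) *\<^sub>R (\<eta> 1 p - \<eta> 0 p) + (du p x 2 * gam 2 0 p) *\<^sub>R (\<eta> 2 p - \<eta> 0 p)
         - (du p x 0 * ?k) *\<^sub>R (\<phi> 1 p *\<^sub>R (\<eta> 1 p - \<eta> 0 p) + \<phi> 2 p *\<^sub>R (\<eta> 2 p - \<eta> 0 p))"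
      by (simp add: sum_index conn_def gam[symmetric] algebra_simps)
    have c: "\<phi> 1 p *\<^sub>R (\<eta> 1 p - \<eta> 0 p) + \<phi> 2 p *\<^sub>R (\<eta> 2 p - \<eta> 0 p) = \<eta> 0 p"
    proof -
      have "\<phi> 1 p *\<^sub>R (\<eta> 1 p - \<eta> 0 p) + \<phi> 2 p *\<^sub>R (\<eta> 2 p - \<eta> 0 p)
        = (\<Sum>k\<in>UNIV. \<phi> k p *\<^sub>R \<eta> k p) - (\<Sum>k\<in>UNIV. \<phi> k p) *\<^sub>R \<eta> 0 p"
        by (simp add: sum_index algebra_simps)
      then show ?thesis by (simp add: phi_relation[OF p])
    qed
    show ?thesis
      unfolding D_eta[OF p] a b c lambda_tangent_def lambda_normal_def
      by (simp add: linear_diff[OF g.Dg_linear[OF p]] algebra_simps)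
  qed
  ultimately show ?thesis by simp
qed

lemma D_extension:
  fixes t :: real
  assumes p: "p \<in> M" and gam: "gam 0 1 p = gam 0 2 p"
  defines "\<Phi> \<equiv> extension_differential (\<phi> 0 p) p t"
  shows "D G (p, t) z = D g p (fst (\<Phi> z)) + snd (\<Phi> z) *\<^sub>R \<eta> 0 p"
proof -
  have "((\<lambda>z. g (fst z)) has_derivative (\<lambda>z. D g p (fst z))) (at (p, t))"
    by (rule has_derivative_compose[where f=fst and g=g])
       (auto intro!: derivative_intros has_derivative_D g.g_differentiable[OF p])
  moreover have "((\<lambda>z. lam (fst z)) has_derivative
     (\<lambda>z. D g p (lambda_tangent (\<phi> 0 p) p (fst z)) + lambda_normal (\<phi> 0 p) p (fst z) *\<^sub>R \<eta> 0 p)) (at (p, t))"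
    by (rule has_derivative_compose[where f=fst and g=lam])
       (auto intro!: derivative_intros D_lambda[OF p gam, simplified])
  ultimately have "((\<lambda>z. g (fst z) + snd z *\<^sub>R lam (fst z)) has_derivative
     (\<lambda>z. D g p (fst z) + (snd (p, t) *\<^sub>R (D g p (lambda_tangent (\<phi> 0 p) p (fst z)) + lambda_normal (\<phi> 0 p) p (fst z) *\<^sub>R \<eta> 0 p)
        + snd z *\<^sub>R lam (fst (p, t))))) (at (p, t))"
    by (intro has_derivative_add has_derivative_scaleR) (auto intro!: derivative_intros)
  then have "(G has_derivative
     (\<lambda>z. D g p (fst z) + (t *\<^sub>R (D g p (lambda_tangent (\<phi> 0 p) p (fst z)) + lambda_normal (\<phi> 0 p) p (fst z) *\<^sub>R \<eta> 0 p)
        + snd z *\<^sub>R lam p))) (at (p, t))"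
    by (simp add: extension_map_def case_prod_beta')
  from D_eqI[OF this] show ?thesis
    by (simp add: \<Phi>_def extension_differential_def lambda_field_def linear_add[OF g.Dg_linear[OF p]]
        linear_scale[OF g.Dg_linear[OF p]] algebra_simps)
qed

lemma pullback_extension:
  fixes t :: real
  assumes p: "p \<in> M" and gam: "gam 0 1 p = gam 0 2 p"
  defines "\<Phi> \<equiv> extension_differential (\<phi> 0 p) p t"
  shows "pullback h G (p, t) v w
     = m p (fst (\<Phi> v)) (fst (\<Phi> w)) + (1 + 1 / \<phi> 0 p) * (snd (\<Phi> v) * snd (\<Phi> w))"
  unfolding pullback_def D_extension[OF p gam] \<Phi>_def
  by (simp add: g.h_simps eta_normal[OF p] g.h_commute[of "D g p _" "\<eta> 0 p"] h_eta[OF p] g.m_eq[OF p])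

lemma extension_differential_inj:
  assumes p: "p \<in> M" and gam: "gam 0 1 p = gam 0 2 p" and inj: "inj (D G (p, t))"
  shows "inj (extension_differential (\<phi> 0 p) p t)"
  by (rule injI) (metis D_extension[OF p gam] inj injD)

end

text \<open>
  In the coordinates given by \<open>\<Phi>\<close> the form \<open>T\<close> is the orthogonal sum of \<open>B\<close> and \<open>k\<close> times a square.
  For \<open>k < 0\<close> the projection to the second coordinate is injective on every negative definite
  subspace, which bounds the index by one.
\<close>

lemma form_in_coordinates:
  fixes B :: "'a::euclidean_space form" and \<Phi> :: "'a \<times> real \<Rightarrow> 'a \<times> real"
  assumes B: "riemannian_product B" and lin: "linear \<Phi>" and inj: "inj \<Phi>"
    and T: "\<And>v w. T v w = B (fst (\<Phi> v)) (fst (\<Phi> w)) + k * (snd (\<Phi> v) * snd (\<Phi> w))"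
  shows "k > 0 \<Longrightarrow> riemannian_product T"
    and "k < 0 \<Longrightarrow> lorentzian_product T"
    and "k = 0 \<Longrightarrow> degenerate T"
proof -
  have bil: "bilinear B" and sym: "\<And>v w. B v w = B w v" and pos: "\<And>v. v \<noteq> 0 \<Longrightarrow> B v v > 0"
    using B unfolding riemannian_product_def symmetric_form_def by blast+
  have nonneg: "B v v \<ge> 0" for v using pos[of v] bilinear_lzero[OF bil, of 0] by (cases "v = 0") auto
  have inj0: "\<Phi> v = 0 \<Longrightarrow> v = 0" for v using inj linear_injective_0[OF lin] by blast
  have "surj \<Phi>" using lin inj linear_inj_imp_surj by blast
  then have ex: "\<exists>z. \<Phi> z = y" for y by (metis surjD)
  have "bilinear T"
    unfolding bilinear_def T
    by (intro conjI allI linearI)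
       (simp_all add: linear_add[OF lin] linear_scale[OF lin] bilinear_ladd[OF bil]
        bilinear_lmul[OF bil] bilinear_radd[OF bil] bilinear_rmul[OF bil] algebra_simps)
  then have symT: "symmetric_form T"
    unfolding symmetric_form_def by (auto simp: T sym mult.commute)
  show "riemannian_product T" if "k > 0"
    unfolding riemannian_product_def
  proof (intro conjI allI impI symT)
    fix v :: "'a \<times> real" assume "v \<noteq> 0"
    then have ne: "\<Phi> v \<noteq> 0" using inj0 by blast
    have k0: "k * (snd (\<Phi> v) * snd (\<Phi> v)) \<ge> 0" using \<open>k > 0\<close> by simp
    show "T v v > 0"
    proof (cases "fst (\<Phi> v) = 0")
      case True
      then have "snd (\<Phi> v) \<noteq> 0" using ne by (simp add: prod_eq_iff)
      then have "snd (\<Phi> v) * snd (\<Phi> v) > 0" by (simp add: zero_less_mult_iff linorder_neq_iff disj_commute)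
      then have "k * (snd (\<Phi> v) * snd (\<Phi> v)) > 0" using \<open>k > 0\<close> by simp
      then show ?thesis using nonneg[of "fst (\<Phi> v)"] unfolding T by linarith
    next
      case False
      then show ?thesis using pos k0 unfolding T by (simp add: add_pos_nonneg)
    qed
  qed
  show "degenerate T" if "k = 0"
  proof -
    obtain z where z: "\<Phi> z = (0, 1)" using ex by blast
    have "z \<noteq> 0" using z linear_0[OF lin] by (auto simp: zero_prod_def)
    then show ?thesis unfolding degenerate_def
      using that z by (intro exI[of _ z]) (simp add: T bilinear_lzero[OF bil])
  qed
  show "lorentzian_product T" if k: "k < 0"
    unfolding lorentzian_product_def
  proof (intro conjI symT)
    show "\<not> degenerate T"
    proof
      assume "degenerate T"
      then obtain v where v: "v \<noteq> 0" "\<And>w. T v w = 0" unfolding degenerate_def by blast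
      obtain w where w: "\<Phi> w = (fst (\<Phi> v), - snd (\<Phi> v))" using ex by blast
      have "B (fst (\<Phi> v)) (fst (\<Phi> v)) + (- k) * (snd (\<Phi> v) * snd (\<Phi> v)) = 0"
        using v(2)[of w] by (simp add: T w)
      moreover have "(- k) * (snd (\<Phi> v) * snd (\<Phi> v)) \<ge> 0"
        using k by (intro mult_nonneg_nonneg[of "- k"]) simp_all
      ultimately have "B (fst (\<Phi> v)) (fst (\<Phi> v)) = 0" "(- k) * (snd (\<Phi> v) * snd (\<Phi> v)) = 0"
        using nonneg[of "fst (\<Phi> v)"] by linarith+
      then have "\<Phi> v = 0" using pos[of "fst (\<Phi> v)"] k by (force simp: prod_eq_iff)
      then show False using inj0 v(1) by blast
    qed
    let ?D = "{dim S |S. subspace S \<and> (\<forall>v\<in>S. v \<noteq> 0 \<longrightarrow> T v v < 0)}"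
    show "form_index T = 1" unfolding form_index_def
    proof (rule Max_eqI)
      show "finite ?D"
        by (rule finite_subset[of _ "{..DIM('a \<times> real)}"]) (auto intro!: order_trans[OF dim_subset_UNIV])
      show "d \<le> 1" if d: "d \<in> ?D" for d
      proof -
        obtain S where S: "d = dim S" "subspace S" "\<And>v. v \<in> S \<Longrightarrow> v \<noteq> 0 \<Longrightarrow> T v v < 0"
          using d by auto
        have l: "linear (\<lambda>v. snd (\<Phi> v))"
          by (intro linearI) (simp_all add: linear_add[OF lin] linear_scale[OF lin])
        have "inj_on (\<lambda>v. snd (\<Phi> v)) S"
        proof (rule inj_onI)
          fix v w assume vw: "v \<in> S" "w \<in> S" "snd (\<Phi> v) = snd (\<Phi> w)"
          have "\<not> T (v - w) (v - w) < 0" using vw(3) nonneg by (simp add: T linear_diff[OF lin] not_less)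
          moreover have "v - w \<in> S" using S(2) vw by (simp add: subspace_diff)
          ultimately have "v - w = 0" using S(3) by blast
          then show "v = w" by simp
        qed
        then have "dim ((\<lambda>v. snd (\<Phi> v)) ` S) = dim S"
          using S(2) by (intro dim_image_eq[OF l]) (simp add: span_eq_iff[THEN iffD2])
        then show "d \<le> 1" using S(1) dim_subset_UNIV[of "(\<lambda>v. snd (\<Phi> v)) ` S"] by simp
      qed
      obtain z where z: "\<Phi> z = (0, 1)" using ex by blast
      have "z \<noteq> 0" using z linear_0[OF lin] by (auto simp: zero_prod_def)
      then have dim: "dim (span {z}) = 1" by (simp add: dim_insert)
      have neg: "T v v < 0" if "v \<in> span {z}" "v \<noteq> 0" for v
      proof -
        obtain c where c: "v = c *\<^sub>R z" using \<open>v \<in> span {z}\<close> by (auto simp: span_singleton)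
        have "T v v = k * (c * c)" by (simp add: T c linear_scale[OF lin] z bilinear_lzero[OF bil])
        moreover have "c * c > 0" using that(2) c by (auto simp: zero_less_mult_iff)
        ultimately show ?thesis using k by (simp add: mult_neg_pos)
      qed
      show "1 \<in> ?D"
        using dim neg by (intro CollectI exI[of _ "span {z}"]) (simp add: subspace_span)
    qed
  qed
qed

lemma bounded_bilinear_lorentz: "bounded_bilinear (lorentz :: ('b::euclidean_space \<times> real) form)"
proof -
  have "bilinear (lorentz :: ('b \<times> real) form)"
    unfolding bilinear_def lorentz_def by (auto intro!: linearI simp: inner_simps algebra_simps)
  then show ?thesis by (simp add: bilinear_conv_bounded_bilinear)
qed

lemma lorentz_commute: "lorentz v w = lorentz w v"
  by (simp add: lorentz_def inner_commute mult.commute)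

theorem lemma4p1:
  fixes M :: "'a::euclidean_space set" and m :: "'a \<Rightarrow> 'a form" and x0 :: 'a
    and f N :: "'a \<Rightarrow> 'a \<times> real"
    and u :: "'a \<Rightarrow> real^3" and \<nu> :: "real^3 \<Rightarrow> 'a \<times> real" and X :: "3 \<Rightarrow> 'a \<Rightarrow> 'a"
    and g g' :: "'a \<Rightarrow> ('a \<times> real) \<times> real" and \<phi> \<phi>' :: "3 \<Rightarrow> 'a \<Rightarrow> real"
    and G G' :: "'a \<times> real \<Rightarrow> ('a \<times> real) \<times> real" and \<N> :: "('a \<times> real) set"
  assumes manifold: "open M" "connected M" "x0 \<in> M" "riemannian_metric M m"
    and hypersurface: "isometric_immersion M m inner f"
    and rank: "3 < DIM('a)" "\<forall>p\<in>M. immersion_rank inner f p = 3"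
    and generic: "generic_nullity M m" "real_splitting_eigenvalues M m"
    and gauss: "gauss_map M f N"
    and chart: "leaf_chart M m u" "conjugate_frame M m u X" "descended_gauss_map M u N \<nu>"
    and honest: "honest M m x0 f lorentz g" "honest M m x0 f lorentz g'"
    and rel_nullity: "\<forall>p\<in>M. relative_nullity lorentz g p = nullity m p"
                     "\<forall>p\<in>M. relative_nullity lorentz g' p = nullity m p"
    and distinct: "\<not> same_germ lorentz x0 g g'"
    and phi: "associated_functions M m f N X lorentz g \<phi>"
             "associated_functions M m f N X lorentz g' \<phi>'"
    and phi0: "\<forall>p\<in>M. \<phi> 0 p = \<phi>' 0 p"
    and G: "G = extension_map m f N X u \<nu> lorentz g"
           "G' = extension_map m f N X u \<nu> lorentz g'"
    and nbhd: "open \<N>" "M \<times> {0} \<subseteq> \<N>" "\<N> \<subseteq> M \<times> UNIV"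
    and immersions: "immersion_on \<N> G" "immersion_on \<N> G'"
  shows "(\<forall>z\<in>\<N>. pullback lorentz G z = pullback lorentz G' z) \<and>
         (\<forall>(p, t)\<in>\<N>.
            (1 + 1 / \<phi> 0 p > 0 \<longrightarrow> riemannian_product (pullback lorentz G (p, t))) \<and>
            (1 + 1 / \<phi> 0 p < 0 \<longrightarrow> lorentzian_product (pullback lorentz G (p, t))) \<and>
            (\<phi> 0 p = -1 \<longrightarrow> degenerate (pullback lorentz G (p, t))))"
proof -
  interpret metric_chart M m by unfold_locales (rule manifold)+
  interpret leaf_frame M m u X by unfold_locales (rule chart generic)+
  interpret f: isometric_chart M m inner f
    by (intro isometric_chart.intro isometric_chart_axioms.intro metric_chart_axioms
        hypersurface bounded_bilinear_inner inner_commute)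
  interpret H: hypersurface M m u X f N \<nu> by unfold_locales (rule gauss chart)+
  have iso: "isometric_immersion M m lorentz g" "isometric_immersion M m lorentz g'"
    using honest by (simp_all add: honest_def)
  interpret g: isometric_chart M m lorentz g
    by (intro isometric_chart.intro isometric_chart_axioms.intro metric_chart_axioms
        iso bounded_bilinear_lorentz lorentz_commute)
  interpret g': isometric_chart M m lorentz g'
    by (intro isometric_chart.intro isometric_chart_axioms.intro metric_chart_axioms
        iso bounded_bilinear_lorentz lorentz_commute)
  have null: "second_ff lorentz g p v T = 0" "second_ff lorentz g' p v T = 0"
    if "p \<in> M" "T \<in> nullity m p" for p v T
    using that rel_nullity g.second_ff_commute[of p v T] g'.second_ff_commute[of p v T]
    unfolding relative_nullity_def by fastforce+
  interpret codim2_pair M m u X f N \<nu> lorentz g \<phi> g' \<phi>'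
    by unfold_locales (use null phi manifold in auto)
  have gam: "H.gam 0 1 p = H.gam 0 2 p" if "p \<in> M" for p
    using distinct_gam_eq[OF manifold(3) distinct _ that] phi0 by blast
  have M: "p \<in> M" if "(p, t) \<in> \<N>" for p t using nbhd(3) that by blast
  have "pullback lorentz G (p, t) = pullback lorentz G' (p, t)" if "(p, t) \<in> \<N>" for p t
    using phi0 M[OF that] unfolding G
    by (intro ext) (simp add: g.pullback_extension[OF M[OF that] gam[OF M[OF that]]]
        g'.pullback_extension[OF M[OF that] gam[OF M[OF that]]])
  moreover have "(1 + 1 / \<phi> 0 p > 0 \<longrightarrow> riemannian_product (pullback lorentz G (p, t))) \<and>
            (1 + 1 / \<phi> 0 p < 0 \<longrightarrow> lorentzian_product (pullback lorentz G (p, t))) \<and>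
            (\<phi> 0 p = -1 \<longrightarrow> degenerate (pullback lorentz G (p, t)))" if pt: "(p, t) \<in> \<N>" for p t
  proof -
    note p = M[OF pt]
    have "inj (D G (p, t))" using immersions(1) pt by (auto simp: immersion_on_def)
    then have inj: "inj (H.extension_differential (\<phi> 0 p) p t)"
      unfolding G by (rule g.extension_differential_inj[OF p gam[OF p]])
    note form = form_in_coordinates[OF m_riemannian[OF p] H.extension_differential_linear[OF p] inj
        g.pullback_extension[OF p gam[OF p]], folded G]
    show ?thesis using form by simp
  qed
  ultimately show ?thesis by auto
qed

end
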